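(* Let $(P,P')$ be a pair of $i$-swapped standard parabolic subgroups of $\mathrm{SL}_n(\mathbb{C})$ with Levi subgroups $L$ and $L'$, and let $\Phi_i:=\Phi_i(P,P')$ be the reflection functor (for a fixed torsion scalar $\tau_i\in\mathbb{C}^*$). Then $$\Phi_i([B]\cdot h)=\Phi_i([B])\cdot\sigma_i(h)\qquad\text{for all }h\in L^{\mathrm{ab}}=L/[L,L]$$ and all points $[B]$ of the source. Here, if $h$ is represented by a block-scalar element $\operatorname{diag}(z_1,\dots,z_1,\dots,z_k,\dots,z_k)$, then $\sigma_i(h)$ is obtained by permuting the $i$th and $(i+1)$st blocks of $h$; this defines an isomorphism $L^{\mathrm{ab}}\simeq(L')^{\mathrm{ab}}$.
   Context: Everything is over $\mathbb{C}$. Parabolics. Let $0=d_0<d_1<\dots<d_k=n$ and $s_a:=d_a-d_{a-1}$; $P$ is the standard (block upper triangular) parabolic of $\mathrm{SL}_n$ with ordered block sizes $(s_1,\dots,s_k)$. For $1\le i\le k-1$, the pair $(P,P')$ is $i$-swapped if $P'$ is the standard parabolic obtained by swapping the $i$th and $(i+1)$st block sizes; its partial sums are $d_i'=d_{i-1}+d_{i+1}-d_i$, $d_a'=d_a$ for $a\neq i$. Quiver data. To $P$ attach $T^*V=\bigoplus_{a=1}^{k-1}\big(\operatorname{Hom}(\mathbb{C}^{d_a},\mathbb{C}^{d_{a+1}})\oplus\operatorname{Hom}(\mathbb{C}^{d_{a+1}},\mathbb{C}^{d_a})\big)$ with elements $B=(\alpha_a,\beta_a)_{a=1}^{k-1}$,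 and gauge group $\mathrm{SL}_{\mathbf v}=\prod_{a=1}^{k-1}\mathrm{SL}_{d_a}$ acting by $\alpha_a\mapsto g_{a+1}\alpha_ag_a^{-1}$, $\beta_a\mapsto g_a\beta_ag_{a+1}^{-1}$ (with $g_k=1$). Convention: $\mathbb{C}^{d_0}=0$, $\alpha_0=\beta_0=0$. Let $m_{P,\mathrm{inj}}^{-1}(0)$ be the variety of those $B$ with every $\alpha_a$ injective and such that for each $1\le a\le k-1$ there is a scalar $\lambda_a(B)$ with $\alpha_{a-1}\beta_{a-1}-\beta_a\alpha_a=\lambda_a(B)\,\mathrm{Id}_{d_a}$. It is smooth with free $\mathrm{SL}_{\mathbf v}$-action, and its geometric quotient is isomorphic to $T^*(\mathrm{SL}_n/[P,P])$; hence $\overline{T^*(\mathrm{SL}_n/[P,P])}^{\mathrm{aff}}\cong\mathcal{M}_P:=\operatorname{Spec}\big(\mathbb{C}[m_{P,\mathrm{inj}}^{-1}(0)]^{\mathrm{SL}_{\mathbf v}}\big)$, where $\overline{X}^{\mathrm{aff}}=\operatorname{Spec}\Gamma(X,\mathcal{O}_X)$. Write $[B]$ for the image of $B$ in $\mathcal{M}_P$. Torus action. Elements of $L^{\mathrm{ab}}$ are represented by block-scalar $h=\operatorname{diag}(z_1,\dots,z_1,\dots,z_k,\dots,z_k)\in Z(L)^\circ$, with $z_a$ appearing $s_a$ times and $\prod_az_a^{s_a}=1$. Put $h_a:=\operatorname{diag}(z_1,\dots,z_1,\dots,z_a,\dots,z_a)\in\mathrm{GL}_{d_a}$. Then $[B]\cdot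 h$ is given by $\alpha_a\mapsto h_{a+1}^{-1}\alpha_ah_a$, $\beta_a\mapsto h_a^{-1}\beta_ah_{a+1}$ for $1\le a\le k-2$, and $\alpha_{k-1}\mapsto\alpha_{k-1}h_{k-1}$, $\beta_{k-1}\mapsto h_{k-1}^{-1}\beta_{k-1}$; this induces an action on the quotient and on $\mathcal{M}_P$. The action of $(L')^{\mathrm{ab}}$ on $\mathcal{M}_{P'}$ is defined in the same way. Zippers. Put $\operatorname{out}_i(B)=\begin{pmatrix}\beta_{i-1}\\ \alpha_i\end{pmatrix}:\mathbb{C}^{d_i}\to\mathbb{C}^{d_{i-1}}\oplus\mathbb{C}^{d_{i+1}}$ and $\operatorname{in}_i(B)=\begin{pmatrix}-\alpha_{i-1}&\beta_i\end{pmatrix}:\mathbb{C}^{d_{i-1}}\oplus\mathbb{C}^{d_{i+1}}\to\mathbb{C}^{d_i}$. Let $\Lambda^{\mathrm{surj}}_{P,i}\subset m_{P,\mathrm{inj}}^{-1}(0)$ be the open set where $\operatorname{in}_i(B)$ is surjective. For $\tau\in\mathbb{C}^*$, let $Z_i^{\tau}(P,P')\subset\Lambda^{\mathrm{surj}}_{P,i}\times m_{P',\mathrm{inj}}^{-1}(0)$ be the set of pairs $(B,B')$ such that: (C1) $\alpha_a=\alpha_a'$, $\beta_a=\beta_a'$ for $a\notin\{i-1,i\}$; (C2) $0\to\mathbb{C}^{d_i'}\xrightarrow{\operatorname{out}_i(B')}\mathbb{C}^{d_{i-1}}\oplus\mathbb{C}^{d_{i+1}}\xrightarrow{\operatorname{in}_i(B)}\mathbb{C}^{d_i}\to0$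 is exact and has torsion $\tau$, i.e. with fixed standard volume elements $\mathrm{vol}_a\in\bigwedge^a\mathbb{C}^a$, $\operatorname{out}_i(B')(\mathrm{vol}_{d_i'})\wedge\operatorname{in}_i(B)^{-1}(\mathrm{vol}_{d_i})=\tau\,\mathrm{vol}_{d_{i-1}}\wedge\mathrm{vol}_{d_{i+1}}$, where $\operatorname{in}_i(B)^{-1}(\mathrm{vol}_{d_i})$ is any exterior lift along $\operatorname{in}_i(B)$; (C3) $\operatorname{out}_i(B')\operatorname{in}_i(B')=\operatorname{out}_i(B)\operatorname{in}_i(B)+\lambda_i(B)\,\mathrm{Id}$. Reflection functor. If $s_i\le s_{i+1}$, $\Phi_i(P,P')=\Phi_i^{\tau}(P,P'):\mathcal{M}_P\to\mathcal{M}_{P'}$ is the unique isomorphism with $\Phi_i([B])=[B']$ for all $(B,B')\in Z_i^{\tau}(P,P')$; if $s_i>s_{i+1}$, $\Phi_i^{\tau}(P,P'):=\Phi_i^{\tau}(P',P)^{-1}$. *)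

theory Defs
  imports
    Complex_Main
    "HOL-Algebra.Generated_Groups"
    "HOL-Algebra.RingHom"
    "Jordan_Normal_Form.Determinant"
    "Jordan_Normal_Form.DL_Submatrix"
begin

section \<open>Standard parabolics, Levi subgroups and their abelianizations\<close>

text \<open>A standard parabolic \<open>P\<close> of \<open>SL\<^sub>n(\<complex>)\<close> is given by its ordered list \<open>s\<close> of block sizes. Lists are
  indexed from 0, so \<open>s\<^sub>a\<close> is \<open>s ! (a - 1)\<close>; the number of blocks \<open>k\<close> is \<open>length s\<close>.\<close>

definition block_sizes :: "nat \<Rightarrow> nat list \<Rightarrow> bool" where
  "block_sizes n s \<longleftrightarrow> sum_list s = n \<and> (\<forall>m\<in>set s. 0 < m)"

definition psum :: "nat list \<Rightarrow> nat \<Rightarrow> nat" where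
  "psum s a = sum_list (take a s)"

text \<open>Interchange of the \<open>i\<close>th and \<open>(i+1)\<close>st entries (counted from 1).\<close>

definition swap_adjacent :: "nat \<Rightarrow> 'a list \<Rightarrow> 'a list" where
  "swap_adjacent i xs = xs[i - 1 := xs ! i, i := xs ! (i - 1)]"

definition i_swapped :: "nat \<Rightarrow> nat list \<Rightarrow> nat list \<Rightarrow> bool" where
  "i_swapped i s s' \<longleftrightarrow> 1 \<le> i \<and> i \<le> length s - 1 \<and> s' = swap_adjacent i s"

definition SL :: "nat \<Rightarrow> complex mat monoid" where
  "SL n = \<lparr>carrier = {A \<in> carrier_mat n n. det A = 1}, monoid.mult = (*), one = 1\<^sub>m n\<rparr>"

definition levi :: "nat list \<Rightarrow> complex mat monoid" where
  "levi s = SL (sum_list s)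
     \<lparr>carrier := {diag_block_mat As | As. list_all2 (\<lambda>A m. A \<in> carrier_mat m m) As s \<and>
                                          det (diag_block_mat As) = 1}\<rparr>"

definition Lab :: "nat list \<Rightarrow> complex mat set monoid" where
  "Lab s = levi s Mod derived (levi s) (carrier (levi s))"

definition block_scalar :: "nat list \<Rightarrow> complex list \<Rightarrow> complex mat" where
  "block_scalar s z = diag_block_mat (map2 (\<lambda>m c. c \<cdot>\<^sub>m 1\<^sub>m m) s z)"

text \<open>The scalars \<open>(z\<^sub>1,\<dots>,z\<^sub>k)\<close> of the block-scalar elements of \<open>L\<close>. All of \<open>Z(L)\<close> is allowed, not just
  \<open>Z(L)\<degree>\<close>: two block-scalar matrices of the same class in \<open>L\<^sup>a\<^sup>b\<close> act in the same way.\<close>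

definition ZL :: "nat list \<Rightarrow> complex list set" where
  "ZL s = {z. length z = length s \<and> (\<Prod>a<length s. (z ! a) ^ (s ! a)) = 1}"

definition Lab_class :: "nat list \<Rightarrow> complex list \<Rightarrow> complex mat set" where
  "Lab_class s z = derived (levi s) (carrier (levi s)) #>\<^bsub>levi s\<^esub> block_scalar s z"

definition sigma :: "nat \<Rightarrow> nat list \<Rightarrow> nat list \<Rightarrow> complex mat set \<Rightarrow> complex mat set" where
  "sigma i s s' h = (THE h'. \<exists>z\<in>ZL s. h = Lab_class s z \<and> h' = Lab_class s' (swap_adjacent i z))"


section \<open>Quiver data\<close>

text \<open>\<open>B = (\<alpha>, \<beta>)\<close>. The index \<open>a\<close> ranges over \<open>{0..<k}\<close>; since \<open>d\<^sub>0 = 0\<close> the components \<open>\<alpha>\<^sub>0, \<beta>\<^sub>0\<close> are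
  the unique \<open>d\<^sub>1\<times>0\<close> and \<open>0\<times>d\<^sub>1\<close> matrices, which is the convention \<open>\<alpha>\<^sub>0 = \<beta>\<^sub>0 = 0\<close>.\<close>

type_synonym quiver = "(nat \<Rightarrow> complex mat) \<times> (nat \<Rightarrow> complex mat)"

abbreviation \<alpha> :: "quiver \<Rightarrow> nat \<Rightarrow> complex mat" where "\<alpha> B \<equiv> fst B"
abbreviation \<beta> :: "quiver \<Rightarrow> nat \<Rightarrow> complex mat" where "\<beta> B \<equiv> snd B"

definition TV :: "nat list \<Rightarrow> quiver set" where
  "TV s = (\<Pi>\<^sub>E a\<in>{..<length s}. carrier_mat (psum s (Suc a)) (psum s a)) \<times>
          (\<Pi>\<^sub>E a\<in>{..<length s}. carrier_mat (psum s a) (psum s (Suc a)))"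

definition inj_mat :: "complex mat \<Rightarrow> bool" where
  "inj_mat A \<longleftrightarrow> inj_on (\<lambda>v. A *\<^sub>v v) (carrier_vec (dim_col A))"

definition surj_mat :: "complex mat \<Rightarrow> bool" where
  "surj_mat A \<longleftrightarrow> (\<lambda>v. A *\<^sub>v v) ` carrier_vec (dim_col A) = carrier_vec (dim_row A)"

definition moment :: "quiver \<Rightarrow> nat \<Rightarrow> complex mat" where
  "moment B a = \<alpha> B (a - 1) * \<beta> B (a - 1) - \<beta> B a * \<alpha> B a"

definition m_inj :: "nat list \<Rightarrow> quiver set" where
  "m_inj s = {B \<in> TV s. \<forall>a\<in>{1..<length s}.
     inj_mat (\<alpha> B a) \<and> (\<exists>c. moment B a = c \<cdot>\<^sub>m 1\<^sub>m (psum s a))}"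

definition lam :: "nat list \<Rightarrow> quiver \<Rightarrow> nat \<Rightarrow> complex" where
  "lam s B a = (THE c. moment B a = c \<cdot>\<^sub>m 1\<^sub>m (psum s a))"

text \<open>\<open>SL\<^sub>v\<close>, with the convention \<open>g\<^sub>k = 1\<close> built in (and \<open>g\<^sub>0\<close> the \<open>0\<times>0\<close> matrix).\<close>

definition gauge :: "nat list \<Rightarrow> (nat \<Rightarrow> complex mat) set" where
  "gauge s = {g. (\<forall>a\<le>length s. g a \<in> carrier (SL (psum s a))) \<and> g (length s) = 1\<^sub>m (psum s (length s))}"

definition gauge_act :: "nat list \<Rightarrow> (nat \<Rightarrow> complex mat) \<Rightarrow> quiver \<Rightarrow> quiver" where
  "gauge_act s g B =
     ((\<lambda>a\<in>{..<length s}. g (Suc a) * \<alpha> B a * (inv\<^bsub>SL (psum s a)\<^esub> (g a))),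
      (\<lambda>a\<in>{..<length s}. g a * \<beta> B a * (inv\<^bsub>SL (psum s (Suc a))\<^esub> (g (Suc a)))))"

lemma group_SL: "group (SL n)"
proof (rule groupI)
  fix A assume "A \<in> carrier (SL n)"
  then have A: "A \<in> carrier_mat n n" "det A = 1" by (auto simp: SL_def)
  have "adj_mat A * A = 1\<^sub>m n"
    using adj_mat(3)[OF A(1)] A(2) by auto
  then have "det (adj_mat A) * det A = 1"
    using adj_mat(1)[OF A(1)] A(1) by (metis det_mult det_one)
  then show "\<exists>B\<in>carrier (SL n). B \<otimes>\<^bsub>SL n\<^esub> A = \<one>\<^bsub>SL n\<^esub>"
    using adj_mat[OF A(1)] A by (intro bexI[of _ "adj_mat A"]) (auto simp: SL_def)
qed (auto simp: SL_def det_mult)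

lemma SL_inv:
  assumes "A \<in> carrier (SL n)"
  shows "inv\<^bsub>SL n\<^esub> A \<in> carrier_mat n n" "A * (inv\<^bsub>SL n\<^esub> A) = 1\<^sub>m n" "inv\<^bsub>SL n\<^esub> A * A = 1\<^sub>m n"
  using group.inv_closed[OF group_SL assms] group.r_inv[OF group_SL assms] group.l_inv[OF group_SL assms]
  by (auto simp: SL_def)

lemma inj_mat_conj:
  assumes A: "A \<in> carrier_mat m n" and inj: "inj_mat A"
    and U: "U \<in> carrier_mat m m" "U' \<in> carrier_mat m m" "U' * U = 1\<^sub>m m"
    and V: "V \<in> carrier_mat n n" "V' \<in> carrier_mat n n" "V' * V = 1\<^sub>m n"
  shows "inj_mat (U * A * V)"
proof -
  have "v = w" if v: "v \<in> carrier_vec n" and w: "w \<in> carrier_vec n"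
    and e: "(U * A * V) *\<^sub>v v = (U * A * V) *\<^sub>v w" for v w
  proof -
    have *: "(U * A * V) *\<^sub>v x = U *\<^sub>v (A *\<^sub>v (V *\<^sub>v x))" if "x \<in> carrier_vec n" for x
      using that A U V by (simp add: assoc_mult_mat_vec[of _ m n _ n] assoc_mult_mat_vec[of _ m m _ n])
    have 1: "U' *\<^sub>v (U *\<^sub>v x) = x" if "x \<in> carrier_vec m" for x
      using that U by (simp flip: assoc_mult_mat_vec)
    have 2: "V' *\<^sub>v (V *\<^sub>v x) = x" if "x \<in> carrier_vec n" for x
      using that V by (simp flip: assoc_mult_mat_vec)
    have "A *\<^sub>v (V *\<^sub>v v) = A *\<^sub>v (V *\<^sub>v w)"
      using e v w A V 1 * by (metis mult_mat_vec_carrier)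
    then have "V *\<^sub>v v = V *\<^sub>v w"
      using inj A V v w unfolding inj_mat_def inj_on_def by auto
    then show ?thesis using 2 v w by metis
  qed
  then show ?thesis using A U V unfolding inj_mat_def inj_on_def by auto
qed

lemma gauge_act_m_inj:
  assumes g: "g \<in> gauge s" and B: "B \<in> m_inj s"
  shows "gauge_act s g B \<in> m_inj s"
proof -
  let ?k = "length s"
  define G where "G a = inv\<^bsub>SL (psum s a)\<^esub> (g a)" for a
  have g_carr: "g a \<in> carrier_mat (psum s a) (psum s a)" and G_carr: "G a \<in> carrier_mat (psum s a) (psum s a)"
    and gG: "g a * G a = 1\<^sub>m (psum s a)" "G a * g a = 1\<^sub>m (psum s a)" if "a \<le> ?k" for a
    using g that SL_inv[of "g a" "psum s a"] unfolding gauge_def G_def by (auto simp: SL_def)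
  have carr: "\<alpha> B a \<in> carrier_mat (psum s (Suc a)) (psum s a)" "\<beta> B a \<in> carrier_mat (psum s a) (psum s (Suc a))"
    if "a < ?k" for a
    using B that unfolding m_inj_def TV_def by (auto simp: PiE_def Pi_def)
  have act: "\<alpha> (gauge_act s g B) a = g (Suc a) * \<alpha> B a * G a"
    "\<beta> (gauge_act s g B) a = g a * \<beta> B a * G (Suc a)" if "a < ?k" for a
    using that by (auto simp: gauge_act_def G_def)
  have cancel: "(X * P * U') * (U * Q * Y) = X * (P * Q) * Y"
    if "X \<in> carrier_mat m m" "P \<in> carrier_mat m l" "U' \<in> carrier_mat l l" "U \<in> carrier_mat l l"
      "Q \<in> carrier_mat l m" "Y \<in> carrier_mat m m" "U' * U = 1\<^sub>m l" for X P U' U Q Y :: "complex mat" and m l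
  proof -
    have "(X * P * U') * (U * Q * Y) = X * P * (U' * (U * Q * Y))"
      using that by (intro assoc_mult_mat) auto
    also have "U' * (U * Q * Y) = (U' * U) * (Q * Y)"
      using that assoc_mult_mat[of U l l Q m Y m] assoc_mult_mat[of U' l l U l "Q * Y" m] by simp
    also have "\<dots> = Q * Y" using that by simp
    also have "X * P * (Q * Y) = X * (P * Q) * Y"
      using that by (simp add: assoc_mult_mat[of _ m m _ l _ m] assoc_mult_mat[of _ m l _ m _ m]
        assoc_mult_mat[of _ m m _ m _ m])
    finally show ?thesis .
  qed
  have "g (Suc a) * \<alpha> B a * G a \<in> carrier_mat (psum s (Suc a)) (psum s a)"
    "g a * \<beta> B a * G (Suc a) \<in> carrier_mat (psum s a) (psum s (Suc a))" if "a < ?k" for a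
    using that g_carr[of a] g_carr[of "Suc a"] G_carr[of a] G_carr[of "Suc a"] carr[of a] by auto
  then have TV: "gauge_act s g B \<in> TV s"
    unfolding TV_def gauge_act_def G_def[symmetric] by auto
  have "inj_mat (\<alpha> (gauge_act s g B) a) \<and> (\<exists>c. moment (gauge_act s g B) a = c \<cdot>\<^sub>m 1\<^sub>m (psum s a))"
    if a: "a \<in> {1..<?k}" for a
  proof -
    obtain b where b: "a = Suc b" "b < ?k" "Suc b < ?k" using a by (cases a) auto
    obtain c where c: "moment B a = c \<cdot>\<^sub>m 1\<^sub>m (psum s a)" and inj: "inj_mat (\<alpha> B a)"
      using B a unfolding m_inj_def by blast
    have "inj_mat (\<alpha> (gauge_act s g B) a)"
      unfolding act(1)[OF b(3)[folded b(1)]]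
      using b carr g_carr G_carr gG inj
      by (intro inj_mat_conj[of _ "psum s (Suc a)" "psum s a" _ "G (Suc a)" _ "g a"]) auto
    moreover have "moment (gauge_act s g B) a = g a * moment B a * G a"
    proof -
      have "\<alpha> (gauge_act s g B) b * \<beta> (gauge_act s g B) b = g a * (\<alpha> B b * \<beta> B b) * G a"
        unfolding act[OF b(2)] b(1)
        using b carr[of b] g_carr[of b] G_carr[of b] g_carr[of a] G_carr[of a] gG[of b]
        by (intro cancel[of _ "psum s (Suc b)" _ "psum s b"]) auto
      moreover have "\<beta> (gauge_act s g B) a * \<alpha> (gauge_act s g B) a = g a * (\<beta> B a * \<alpha> B a) * G a"
        unfolding act[OF b(3)[folded b(1)]]
        using b carr[of a] g_carr[of "Suc a"] G_carr[of "Suc a"] g_carr[of a] G_carr[of a] gG[of "Suc a"]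
        by (intro cancel[of _ "psum s a" _ "psum s (Suc a)"]) auto
      moreover have "g a * (\<alpha> B b * \<beta> B b - \<beta> B a * \<alpha> B a) * G a =
        g a * (\<alpha> B b * \<beta> B b) * G a - g a * (\<beta> B a * \<alpha> B a) * G a"
      proof -
        have P: "\<alpha> B b * \<beta> B b \<in> carrier_mat (psum s a) (psum s a)"
          and Q: "\<beta> B a * \<alpha> B a \<in> carrier_mat (psum s a) (psum s a)"
          and X: "g a \<in> carrier_mat (psum s a) (psum s a)" and Y: "G a \<in> carrier_mat (psum s a) (psum s a)"
          using b carr[of b] carr[of a] g_carr[of a] G_carr[of a] by auto
        show ?thesis
          unfolding mult_minus_distrib_mat[OF X P Q]
          by (rule minus_mult_distrib_mat[OF mult_carrier_mat[OF X P] mult_carrier_mat[OF X Q] Y])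
      qed
      ultimately show ?thesis unfolding moment_def b(1) by simp
    qed
    then have "moment (gauge_act s g B) a = c \<cdot>\<^sub>m 1\<^sub>m (psum s a)"
      using b c g_carr[of a] G_carr[of a] gG[of a]
        mult_smult_distrib[of "g a" "psum s a" "psum s a" "1\<^sub>m (psum s a)" "psum s a" c]
        mult_smult_assoc_mat[of "g a" "psum s a" "psum s a" "G a" "psum s a" c] by simp
    ultimately show ?thesis by blast
  qed
  with TV show ?thesis unfolding m_inj_def by blast
qed


section \<open>The affine scheme \<open>M\<^sub>P\<close>\<close>

inductive_set poly_funs :: "nat list \<Rightarrow> (quiver \<Rightarrow> complex) set" for s where
  const: "(\<lambda>_. c) \<in> poly_funs s"
| alpha: "\<lbrakk>a < length s; p < psum s (Suc a); q < psum s a\<rbrakk> \<Longrightarrow> (\<lambda>B. \<alpha> B a $$ (p, q)) \<in> poly_funs s"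
| beta: "\<lbrakk>a < length s; p < psum s a; q < psum s (Suc a)\<rbrakk> \<Longrightarrow> (\<lambda>B. \<beta> B a $$ (p, q)) \<in> poly_funs s"
| add: "\<lbrakk>f \<in> poly_funs s; g \<in> poly_funs s\<rbrakk> \<Longrightarrow> (\<lambda>B. f B + g B) \<in> poly_funs s"
| mult: "\<lbrakk>f \<in> poly_funs s; g \<in> poly_funs s\<rbrakk> \<Longrightarrow> (\<lambda>B. f B * g B) \<in> poly_funs s"

text \<open>\<open>m_inj s\<close> is only quasi-affine, so its regular functions are those which are locally, in the
  Zariski topology, quotients of polynomials.\<close>

definition regular_funs :: "nat list \<Rightarrow> (quiver \<Rightarrow> complex) set" where
  "regular_funs s = {f \<in> extensional (m_inj s). \<forall>B\<in>m_inj s. \<exists>p\<in>poly_funs s. \<exists>q\<in>poly_funs s.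
     q B \<noteq> 0 \<and> (\<forall>B'\<in>m_inj s. q B' \<noteq> 0 \<longrightarrow> f B' = p B' / q B')}"

definition coord_ring :: "nat list \<Rightarrow> (complex, quiver \<Rightarrow> complex) module" where
  "coord_ring s =
    \<lparr>carrier = {f \<in> regular_funs s. \<forall>g\<in>gauge s. \<forall>B\<in>m_inj s. f (gauge_act s g B) = f B},
     monoid.mult = (\<lambda>f g. \<lambda>B\<in>m_inj s. f B * g B),
     monoid.one = (\<lambda>B\<in>m_inj s. 1),
     ring.zero = (\<lambda>B\<in>m_inj s. 0),
     ring.add = (\<lambda>f g. \<lambda>B\<in>m_inj s. f B + g B),
     module.smult = (\<lambda>c f. \<lambda>B\<in>m_inj s. c * f B)\<rparr>"

lemma regular_funs_comb:
  assumes "f \<in> regular_funs s" "g \<in> regular_funs s"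
  shows "(\<lambda>B\<in>m_inj s. f B + g B) \<in> regular_funs s" "(\<lambda>B\<in>m_inj s. f B * g B) \<in> regular_funs s"
proof -
  have "(\<exists>p\<in>poly_funs s. \<exists>q\<in>poly_funs s. q B \<noteq> 0 \<and> (\<forall>B'\<in>m_inj s. q B' \<noteq> 0 \<longrightarrow> (\<lambda>B\<in>m_inj s. f B + g B) B' = p B' / q B'))
      \<and> (\<exists>p\<in>poly_funs s. \<exists>q\<in>poly_funs s. q B \<noteq> 0 \<and> (\<forall>B'\<in>m_inj s. q B' \<noteq> 0 \<longrightarrow> (\<lambda>B\<in>m_inj s. f B * g B) B' = p B' / q B'))"
    if B: "B \<in> m_inj s" for B
  proof -
    obtain p q where 1: "p \<in> poly_funs s" "q \<in> poly_funs s" "q B \<noteq> 0"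
      "\<And>B'. B' \<in> m_inj s \<Longrightarrow> q B' \<noteq> 0 \<Longrightarrow> f B' = p B' / q B'"
      using assms(1) B unfolding regular_funs_def by blast
    obtain r t where 2: "r \<in> poly_funs s" "t \<in> poly_funs s" "t B \<noteq> 0"
      "\<And>B'. B' \<in> m_inj s \<Longrightarrow> t B' \<noteq> 0 \<Longrightarrow> g B' = r B' / t B'"
      using assms(2) B unfolding regular_funs_def by blast
    have qt: "(\<lambda>B. q B * t B) \<in> poly_funs s" using 1 2 by (intro poly_funs.mult)
    show ?thesis
    proof
      have "(\<lambda>B. p B * t B + r B * q B) \<in> poly_funs s"
        using 1 2 by (intro poly_funs.mult poly_funs.add)
      then show "\<exists>p\<in>poly_funs s. \<exists>q\<in>poly_funs s. q B \<noteq> 0 \<and>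
          (\<forall>B'\<in>m_inj s. q B' \<noteq> 0 \<longrightarrow> (\<lambda>B\<in>m_inj s. f B + g B) B' = p B' / q B')"
        using qt 1 2 by (intro bexI[OF _ qt] bexI[of _ "\<lambda>B. p B * t B + r B * q B"])
          (simp_all add: add_frac_eq)
      have "(\<lambda>B. p B * r B) \<in> poly_funs s" using 1 2 by (intro poly_funs.mult)
      then show "\<exists>p\<in>poly_funs s. \<exists>q\<in>poly_funs s. q B \<noteq> 0 \<and>
          (\<forall>B'\<in>m_inj s. q B' \<noteq> 0 \<longrightarrow> (\<lambda>B\<in>m_inj s. f B * g B) B' = p B' / q B')"
        using qt 1 2 by (intro bexI[OF _ qt] bexI[of _ "\<lambda>B. p B * r B"]) simp_all
    qed
  qed
  note * = this
  show "(\<lambda>B\<in>m_inj s. f B + g B) \<in> regular_funs s"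
    unfolding regular_funs_def by (intro CollectI conjI ballI restrict_extensional conjunct1[OF *])
  show "(\<lambda>B\<in>m_inj s. f B * g B) \<in> regular_funs s"
    unfolding regular_funs_def by (intro CollectI conjI ballI restrict_extensional conjunct2[OF *])
qed

lemma regular_funs_const: "(\<lambda>B\<in>m_inj s. c) \<in> regular_funs s"
  unfolding regular_funs_def
  by (intro CollectI conjI ballI restrict_extensional bexI[OF _ poly_funs.const[of c]]
      bexI[OF _ poly_funs.const[of 1]]) simp_all

lemma cring_coord_ring: "cring (coord_ring s)"
proof (rule cringI)
  have cl: "(\<lambda>B\<in>m_inj s. f B + g B) \<in> carrier (coord_ring s)" "(\<lambda>B\<in>m_inj s. f B * g B) \<in> carrier (coord_ring s)"
    if "f \<in> carrier (coord_ring s)" "g \<in> carrier (coord_ring s)" for f g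
    using that regular_funs_comb gauge_act_m_inj by (auto simp: coord_ring_def)
  have co: "(\<lambda>B\<in>m_inj s. c) \<in> carrier (coord_ring s)" for c
    using regular_funs_const gauge_act_m_inj by (auto simp: coord_ring_def)
  have ext: "f \<in> extensional (m_inj s)" if "f \<in> carrier (coord_ring s)" for f
    using that by (simp add: coord_ring_def regular_funs_def)
  have simps: "add (coord_ring s) = (\<lambda>f g. \<lambda>B\<in>m_inj s. f B + g B)" "monoid.mult (coord_ring s) = (\<lambda>f g. \<lambda>B\<in>m_inj s. f B * g B)"
    "zero (coord_ring s) = (\<lambda>B\<in>m_inj s. 0)" "one (coord_ring s) = (\<lambda>B\<in>m_inj s. 1)"
    by (simp_all add: coord_ring_def)
  show "abelian_group (coord_ring s)"
  proof (rule abelian_groupI)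
    fix f assume f: "f \<in> carrier (coord_ring s)"
    show "\<exists>g\<in>carrier (coord_ring s). g \<oplus>\<^bsub>coord_ring s\<^esub> f = \<zero>\<^bsub>coord_ring s\<^esub>"
      using cl(2)[OF co[of "-1"] f] by (intro bexI[of _ "\<lambda>B\<in>m_inj s. (\<lambda>B\<in>m_inj s. - 1) B * f B"]) (auto simp: simps)
  qed (use cl co ext in \<open>auto simp: simps algebra_simps intro!: extensionalityI[where A = "m_inj s"]\<close>)
  show "Group.comm_monoid (coord_ring s)"
    by (rule comm_monoidI) (use cl co ext in \<open>auto simp: simps algebra_simps intro!: extensionalityI[where A = "m_inj s"]\<close>)
qed (auto simp: coord_ring_def algebra_simps restrict_def)

definition Spec :: "('a, 'm) ring_scheme \<Rightarrow> 'a set set" where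
  "Spec R = {p. primeideal p R}"

definition calg_iso :: "(complex, 'a) module \<Rightarrow> (complex, 'b) module \<Rightarrow> ('a \<Rightarrow> 'b) set" where
  "calg_iso R S = {\<phi> \<in> Ring.ring_hom R S. bij_betw \<phi> (carrier R) (carrier S) \<and>
     (\<forall>c. \<forall>f\<in>carrier R. \<phi> (c \<odot>\<^bsub>R\<^esub> f) = c \<odot>\<^bsub>S\<^esub> \<phi> f)}"

text \<open>Isomorphisms \<open>Spec R \<rightarrow> Spec S\<close> of affine schemes over \<open>\<complex>\<close>, as maps of points: they are the maps
  \<open>\<pp> \<mapsto> \<phi>\<^sup>-\<^sup>1(\<pp>)\<close> for an isomorphism \<open>\<phi> : S \<rightarrow> R\<close> of \<open>\<complex>\<close>-algebras. For algebras of \<open>\<complex>\<close>-valued functions,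
  such as the coordinate rings here, \<open>\<phi>\<close> can be recovered from the map of points.\<close>

definition Spec_iso :: "(complex, 'a) module \<Rightarrow> (complex, 'b) module \<Rightarrow> ('a set \<Rightarrow> 'b set) set" where
  "Spec_iso R S = {F. \<exists>\<phi>\<in>calg_iso S R. F = (\<lambda>p\<in>Spec R. {f \<in> carrier S. \<phi> f \<in> p})}"

definition MP :: "nat list \<Rightarrow> (quiver \<Rightarrow> complex) set set" where
  "MP s = Spec (coord_ring s)"

text \<open>The point \<open>[B]\<close>: the kernel of evaluation at \<open>B\<close>.\<close>

definition point :: "nat list \<Rightarrow> quiver \<Rightarrow> (quiver \<Rightarrow> complex) set" where
  "point s B = {f \<in> carrier (coord_ring s). f B = 0}"

lemma point_in_MP:
  assumes B: "B \<in> m_inj s"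
  shows "point s B \<in> MP s"
proof -
  interpret R: cring "coord_ring s" by (rule cring_coord_ring)
  have simps: "add (coord_ring s) = (\<lambda>f g. \<lambda>B\<in>m_inj s. f B + g B)" "monoid.mult (coord_ring s) = (\<lambda>f g. \<lambda>B\<in>m_inj s. f B * g B)"
    "zero (coord_ring s) = (\<lambda>B\<in>m_inj s. 0)" "one (coord_ring s) = (\<lambda>B\<in>m_inj s. 1)"
    by (simp_all add: coord_ring_def)
  have minus: "(\<ominus>\<^bsub>coord_ring s\<^esub> f) B = - f B" if "f \<in> carrier (coord_ring s)" for f
    using R.r_neg[OF that] B by (metis (no_types, lifting) simps(1,3) restrict_apply' add_eq_0_iff)
  have "ideal (point s B) (coord_ring s)"
  proof (rule idealI)
    show "subgroup (point s B) (add_monoid (coord_ring s))"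
    proof (rule group.subgroupI)
      show "Group.group (add_monoid (coord_ring s))" by (rule R.a_group)
    next
      fix f assume "f \<in> point s B"
      then show "inv\<^bsub>add_monoid (coord_ring s)\<^esub> f \<in> point s B"
        using minus[of f] R.a_inv_closed[of f] unfolding point_def a_inv_def by simp
    next
      fix f g assume "f \<in> point s B" "g \<in> point s B"
      then show "f \<otimes>\<^bsub>add_monoid (coord_ring s)\<^esub> g \<in> point s B"
        using B R.a_closed[of f g] by (simp add: point_def simps)
    qed (use B R.zero_closed in \<open>auto simp: point_def simps\<close>)
  next
    fix f g assume "f \<in> point s B" "g \<in> carrier (coord_ring s)"
    then show "g \<otimes>\<^bsub>coord_ring s\<^esub> f \<in> point s B" "f \<otimes>\<^bsub>coord_ring s\<^esub> g \<in> point s B"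
      using B R.m_closed[of f g] R.m_closed[of g f] by (simp_all add: point_def simps)
  qed (rule R.ring_axioms)
  moreover have "carrier (coord_ring s) \<noteq> point s B"
  proof
    assume "carrier (coord_ring s) = point s B"
    then have "\<one>\<^bsub>coord_ring s\<^esub> \<in> point s B" using R.one_closed by simp
    then show False using B by (simp add: point_def simps)
  qed
  ultimately have "primeideal (point s B) (coord_ring s)"
    using B by (intro primeidealI R.is_cring) (auto simp: point_def simps)
  then show ?thesis by (simp add: MP_def Spec_def)
qed


section \<open>The torus action\<close>

text \<open>On \<open>MP s\<close> the action is induced by pullback of functions along \<open>B \<mapsto> B\<cdot>z\<close>. \<open>h_mat s z a\<close> is \<open>h\<^sub>a\<close> for \<open>a < k\<close>. The special form of the action for \<open>a = k - 1\<close> amounts to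
  replacing \<open>h\<^sub>k\<close> by the identity.\<close>

definition h_mat :: "nat list \<Rightarrow> complex list \<Rightarrow> nat \<Rightarrow> complex mat" where
  "h_mat s z a = (if a < length s then block_scalar (take a s) (take a z) else 1\<^sub>m (psum s a))"

definition torus_act_quiver :: "nat list \<Rightarrow> quiver \<Rightarrow> complex list \<Rightarrow> quiver" where
  "torus_act_quiver s B z =
     ((\<lambda>a\<in>{..<length s}. h_mat s (map inverse z) (Suc a) * \<alpha> B a * h_mat s z a),
      (\<lambda>a\<in>{..<length s}. h_mat s (map inverse z) a * \<beta> B a * h_mat s z (Suc a)))"

definition torus_act :: "nat list \<Rightarrow> (quiver \<Rightarrow> complex) set \<Rightarrow> complex list \<Rightarrow> (quiver \<Rightarrow> complex) set" where
  "torus_act s p z = {f \<in> carrier (coord_ring s). (\<lambda>B\<in>m_inj s. f (torus_act_quiver s B z)) \<in> p}"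

definition Lab_act :: "nat list \<Rightarrow> (quiver \<Rightarrow> complex) set \<Rightarrow> complex mat set \<Rightarrow> (quiver \<Rightarrow> complex) set" where
  "Lab_act s p h = (THE q. \<exists>z\<in>ZL s. h = Lab_class s z \<and> q = torus_act s p z)"


section \<open>Exterior powers\<close>

text \<open>An element of \<open>\<Lambda>\<^sup>m \<complex>\<^sup>N\<close> is given by its coordinates in the basis \<open>e\<^sub>I = e\<^sub>i\<^sub>1 \<and> \<dots> \<and> e\<^sub>i\<^sub>m\<close>, where
  \<open>I = {i\<^sub>1 < \<dots> < i\<^sub>m} \<subseteq> {0..<N}\<close>; the induced map \<open>\<Lambda> A\<close> has the minors of \<open>A\<close> as its matrix entries.\<close>

type_synonym multivector = "nat set \<Rightarrow> complex"

definition ext_power :: "nat \<Rightarrow> nat \<Rightarrow> multivector set" where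
  "ext_power m N = {\<omega>. \<forall>I. \<omega> I \<noteq> 0 \<longrightarrow> I \<subseteq> {..<N} \<and> card I = m}"

definition vol :: "nat \<Rightarrow> multivector" where
  "vol m = (\<lambda>I. if I = {..<m} then 1 else 0)"

definition ext_map :: "complex mat \<Rightarrow> multivector \<Rightarrow> multivector" where
  "ext_map A \<omega> = (\<lambda>I. if I \<subseteq> {..<dim_row A}
     then \<Sum>J | J \<subseteq> {..<dim_col A} \<and> card J = card I. det (submatrix A I J) * \<omega> J else 0)"

definition wedge :: "multivector \<Rightarrow> multivector \<Rightarrow> multivector" where
  "wedge \<omega> \<eta> = (\<lambda>K. \<Sum>I\<in>Pow K. (- 1) ^ card {(i, j). i \<in> I \<and> j \<in> K - I \<and> j < i} * \<omega> I * \<eta> (K - I))"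


section \<open>Zippers and the reflection functor\<close>

text \<open>\<open>\<complex>\<^sup>a \<oplus> \<complex>\<^sup>b\<close> is \<open>\<complex>\<^sup>a\<^sup>+\<^sup>b\<close> with the concatenated basis, so \<open>vol\<^sub>a \<and> vol\<^sub>b\<close> is \<open>vol (a + b)\<close>.\<close>

definition out_map :: "quiver \<Rightarrow> nat \<Rightarrow> complex mat" where
  "out_map B i = \<beta> B (i - 1) @\<^sub>r \<alpha> B i"

definition in_map :: "quiver \<Rightarrow> nat \<Rightarrow> complex mat" where
  "in_map B i = four_block_mat (- \<alpha> B (i - 1)) (\<beta> B i)
     (0\<^sub>m 0 (dim_col (\<alpha> B (i - 1)))) (0\<^sub>m 0 (dim_col (\<beta> B i)))"

definition short_exact :: "complex mat \<Rightarrow> complex mat \<Rightarrow> bool" where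
  "short_exact A C \<longleftrightarrow> inj_mat A \<and> surj_mat C \<and>
     (\<lambda>v. A *\<^sub>v v) ` carrier_vec (dim_col A) =
       {w \<in> carrier_vec (dim_col C). C *\<^sub>v w = 0\<^sub>v (dim_row C)}"

text \<open>By exactness the left-hand side does not depend on the exterior lift \<open>\<eta>\<close> of \<open>vol\<close>, and a lift
  exists because \<open>C\<close> is surjective.\<close>

definition has_torsion :: "complex mat \<Rightarrow> complex mat \<Rightarrow> complex \<Rightarrow> bool" where
  "has_torsion A C \<tau> \<longleftrightarrow>
     (\<forall>\<eta>\<in>ext_power (dim_row C) (dim_col C). ext_map C \<eta> = vol (dim_row C) \<longrightarrow>
        wedge (ext_map A (vol (dim_col A))) \<eta> = (\<lambda>I. \<tau> * vol (dim_col C) I))"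

definition Lambda_surj :: "nat list \<Rightarrow> nat \<Rightarrow> quiver set" where
  "Lambda_surj s i = {B \<in> m_inj s. surj_mat (in_map B i)}"

definition zipper :: "nat \<Rightarrow> complex \<Rightarrow> nat list \<Rightarrow> nat list \<Rightarrow> (quiver \<times> quiver) set" where
  "zipper i \<tau> s s' = {(B, B'). B \<in> Lambda_surj s i \<and> B' \<in> m_inj s' \<and>
     (\<forall>a\<in>{1..<length s} - {i - 1, i}. \<alpha> B a = \<alpha> B' a \<and> \<beta> B a = \<beta> B' a) \<and>
     short_exact (out_map B' i) (in_map B i) \<and> has_torsion (out_map B' i) (in_map B i) \<tau> \<and>
     out_map B' i * in_map B' i =
       out_map B i * in_map B i + lam s B i \<cdot>\<^sub>m 1\<^sub>m (psum s (i - 1) + psum s (i + 1))}"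

definition zipper_iso :: "nat \<Rightarrow> complex \<Rightarrow> nat list \<Rightarrow> nat list \<Rightarrow>
    ((quiver \<Rightarrow> complex) set \<Rightarrow> (quiver \<Rightarrow> complex) set) \<Rightarrow> bool" where
  "zipper_iso i \<tau> s s' \<Phi> \<longleftrightarrow> \<Phi> \<in> Spec_iso (coord_ring s) (coord_ring s') \<and>
     (\<forall>(B, B')\<in>zipper i \<tau> s s'. \<Phi> (point s B) = point s' B')"

text \<open>\<open>\<Phi>\<close> is the reflection functor \<open>\<Phi>\<^sub>i\<^sup>\<tau>(P,P')\<close>: the unique isomorphism compatible with the zippers if
  \<open>s\<^sub>i \<le> s\<^sub>i\<^sub>+\<^sub>1\<close>, and the inverse of \<open>\<Phi>\<^sub>i\<^sup>\<tau>(P',P)\<close> otherwise.\<close>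

definition reflection_functor :: "nat \<Rightarrow> complex \<Rightarrow> nat list \<Rightarrow> nat list \<Rightarrow>
    ((quiver \<Rightarrow> complex) set \<Rightarrow> (quiver \<Rightarrow> complex) set) \<Rightarrow> bool" where
  "reflection_functor i \<tau> s s' \<Phi> \<longleftrightarrow>
     (if s ! (i - 1) \<le> s ! i
      then zipper_iso i \<tau> s s' \<Phi> \<and> (\<forall>\<Psi>. zipper_iso i \<tau> s s' \<Psi> \<longrightarrow> \<Psi> = \<Phi>)
      else \<exists>\<Psi>. zipper_iso i \<tau> s' s \<Psi> \<and> (\<forall>\<Psi>'. zipper_iso i \<tau> s' s \<Psi>' \<longrightarrow> \<Psi>' = \<Psi>) \<and>
             \<Phi> = (\<lambda>p\<in>MP s. inv_into (MP s') \<Psi> p))"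

end

theory Submission
  imports Defs "HOL-Algebra.QuotRing"
begin

text \<open>The reflection functor is only known through its uniqueness, and this is what the proof uses. Let \<open>h\<close> be a
  block-scalar element. Conjugating \<open>\<Phi>\<close> by the actions of \<open>h\<close> on the source and of \<open>\<sigma>\<^sub>i(h)\<close> on the target
  gives another isomorphism of affine schemes. If it is again compatible with the zipper, it must be \<open>\<Phi>\<close>, and this
  is the claimed equivariance (\<open>zipper_iso_equivariant\<close>). When \<open>s\<^sub>i > s\<^sub>i\<^sub>+\<^sub>1\<close>, \<open>\<Phi>\<close> is the
  inverse of the functor for the pair in the opposite order, and inherits equivariance from it.

  Compatibility amounts to the following (\<open>zipper_torus\<close>): if \<open>(B, B')\<close> is in the zipper, then so is a pair of
  representatives of \<open>[B]\<cdot>h\<close> and \<open>[B']\<cdot>\<sigma>\<^sub>i(h)\<close>. The torus changes bases by the diagonal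
  matrices \<open>h\<^sub>a\<close>. At a vertex \<open>a \<noteq> i\<close> the matrices \<open>h\<^sub>a\<close> and \<open>\<sigma>\<^sub>i(h)\<^sub>a\<close> have the
  same determinant, so up to the gauge group \<open>B'\<close> may be moved by \<open>h\<^sub>a\<close> there, and by \<open>\<sigma>\<^sub>i(h)\<^sub>i\<close> only at
  the vertex \<open>i\<close>. Then the short exact sequence of the zipper is transported by changes of basis of its three
  terms, and its torsion is multiplied by \<open>det h\<^sub>i \<cdot> det \<sigma>\<^sub>i(h)\<^sub>i / (det h\<^sub>i\<^sub>-\<^sub>1 \<cdot> det h\<^sub>i\<^sub>+\<^sub>1)\<close>. This is 1
  precisely because \<open>\<sigma>\<^sub>i\<close> interchanges the two blocks: with \<open>d = det h\<^sub>i\<^sub>-\<^sub>1\<close>, the four determinants are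
  \<open>d u\<close>, \<open>d v\<close>, \<open>d\<close> and \<open>d u v\<close>, where \<open>u\<close> and \<open>v\<close> are the determinants of the two blocks.

  The statements about \<open>L\<^sup>a\<^sup>b\<close> rest on the description of \<open>[L, L]\<close> as the block diagonal matrices all of whose
  blocks have determinant 1, that is, on the perfectness of \<open>SL\<^sub>m(\<complex>)\<close> (\<open>derived_SL\<close>). It follows that a class
  in \<open>L\<^sup>a\<^sup>b\<close> is given by the determinants of the blocks, that it contains a block-scalar matrix, and that \<open>\<sigma>\<^sub>i\<close>
  and the action of \<open>L\<^sup>a\<^sup>b\<close> do not depend on the choice of this matrix: two choices differ by roots of unity
  whose \<open>h\<^sub>a\<close> have determinant 1 and hence are gauge transformations (\<open>torus_act_cong\<close>).\<close>

section \<open>Changes of basis on the quiver\<close>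

text \<open>A change of basis at every vertex, by \<open>U\<^sub>a\<close> with inverse \<open>V\<^sub>a\<close>. The gauge group and the torus both act in
  this way; the inverse is carried along because the two actions express it differently.\<close>

definition frame :: "nat list \<Rightarrow> (nat \<Rightarrow> complex mat) \<Rightarrow> (nat \<Rightarrow> complex mat) \<Rightarrow> bool" where
  "frame s U V \<longleftrightarrow> (\<forall>a\<le>length s. U a \<in> carrier_mat (psum s a) (psum s a) \<and>
     V a \<in> carrier_mat (psum s a) (psum s a) \<and> U a * V a = 1\<^sub>m (psum s a) \<and> V a * U a = 1\<^sub>m (psum s a))"

definition frame_act :: "nat list \<Rightarrow> (nat \<Rightarrow> complex mat) \<Rightarrow> (nat \<Rightarrow> complex mat) \<Rightarrow> quiver \<Rightarrow> quiver" where
  "frame_act s U V B =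
     ((\<lambda>a\<in>{..<length s}. U (Suc a) * \<alpha> B a * V a), (\<lambda>a\<in>{..<length s}. U a * \<beta> B a * V (Suc a)))"

lemma frameD:
  assumes "frame s U V" "a \<le> length s"
  shows "U a \<in> carrier_mat (psum s a) (psum s a)" "V a \<in> carrier_mat (psum s a) (psum s a)"
    "U a * V a = 1\<^sub>m (psum s a)" "V a * U a = 1\<^sub>m (psum s a)"
  using assms unfolding frame_def by blast+

lemma TV_carrier:
  assumes "B \<in> TV s" "a < length s"
  shows "\<alpha> B a \<in> carrier_mat (psum s (Suc a)) (psum s a)" "\<beta> B a \<in> carrier_mat (psum s a) (psum s (Suc a))"
  using assms unfolding TV_def by (auto simp: PiE_def Pi_def)

lemma TV_eqI:
  assumes "B \<in> TV s" "C \<in> TV s" "\<And>a. a < length s \<Longrightarrow> \<alpha> B a = \<alpha> C a" "\<And>a. a < length s \<Longrightarrow> \<beta> B a = \<beta> C a"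
  shows "B = C"
proof (rule prod_eqI)
  show "fst B = fst C"
    using assms unfolding TV_def
    by (intro PiE_ext[of "fst B" "{..<length s}" "\<lambda>a. carrier_mat (psum s (Suc a)) (psum s a)"]) auto
  show "snd B = snd C"
    using assms unfolding TV_def
    by (intro PiE_ext[of "snd B" "{..<length s}" "\<lambda>a. carrier_mat (psum s a) (psum s (Suc a))"]) auto
qed

lemma m_inj_TV: "B \<in> m_inj s \<Longrightarrow> B \<in> TV s"
  by (simp add: m_inj_def)

lemma frame_act_TV:
  assumes "frame s U V" "B \<in> TV s"
  shows "frame_act s U V B \<in> TV s"
proof -
  have "U (Suc a) * \<alpha> B a * V a \<in> carrier_mat (psum s (Suc a)) (psum s a)"
    "U a * \<beta> B a * V (Suc a) \<in> carrier_mat (psum s a) (psum s (Suc a))" if "a < length s" for a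
    using that frameD[OF assms(1), of a] frameD[OF assms(1), of "Suc a"] TV_carrier[OF assms(2), of a] by auto
  then show ?thesis unfolding TV_def frame_act_def by auto
qed

lemma frame_act_nth:
  assumes "a < length s"
  shows "\<alpha> (frame_act s U V B) a = U (Suc a) * \<alpha> B a * V a" "\<beta> (frame_act s U V B) a = U a * \<beta> B a * V (Suc a)"
  using assms by (simp_all add: frame_act_def)

lemma mult_5_assoc:
  assumes "A \<in> carrier_mat m m" "B \<in> carrier_mat m m" "X \<in> carrier_mat m n" "C \<in> carrier_mat n n" "D \<in> carrier_mat n n"
  shows "A * (B * X * C) * D = (A * B) * X * (C * D)"
proof -
  have "A * (B * X * C) * D = A * (B * X) * C * D"
    using assms by (simp add: assoc_mult_mat[of A m m "B * X" n C n])
  also have "A * (B * X) = A * B * X"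
    using assms by (simp add: assoc_mult_mat[of A m m B m X n])
  also have "A * B * X * C * D = A * B * X * (C * D)"
    using assms by (intro assoc_mult_mat[of _ m n _ n _ n]) auto
  finally show ?thesis .
qed

lemma frame_act_compose:
  assumes "frame s U V" "frame s U' V'" "B \<in> TV s"
  shows "frame_act s U V (frame_act s U' V' B) = frame_act s (\<lambda>a. U a * U' a) (\<lambda>a. V' a * V a) B"
proof (rule prod_eqI)
  show "\<alpha> (frame_act s U V (frame_act s U' V' B)) = \<alpha> (frame_act s (\<lambda>a. U a * U' a) (\<lambda>a. V' a * V a) B)"
  proof
    fix a show "\<alpha> (frame_act s U V (frame_act s U' V' B)) a = \<alpha> (frame_act s (\<lambda>a. U a * U' a) (\<lambda>a. V' a * V a) B) a"
    proof (cases "a < length s")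
      case True
      show ?thesis
        unfolding frame_act_nth[OF True]
        using True frameD[OF assms(1), of a] frameD[OF assms(1), of "Suc a"] frameD[OF assms(2), of a]
          frameD[OF assms(2), of "Suc a"] TV_carrier[OF assms(3), of a]
        by (intro mult_5_assoc) auto
    qed (simp add: frame_act_def)
  qed
  show "\<beta> (frame_act s U V (frame_act s U' V' B)) = \<beta> (frame_act s (\<lambda>a. U a * U' a) (\<lambda>a. V' a * V a) B)"
  proof
    fix a show "\<beta> (frame_act s U V (frame_act s U' V' B)) a = \<beta> (frame_act s (\<lambda>a. U a * U' a) (\<lambda>a. V' a * V a) B) a"
    proof (cases "a < length s")
      case True
      show ?thesis
        unfolding frame_act_nth[OF True]
        using True frameD[OF assms(1), of a] frameD[OF assms(1), of "Suc a"] frameD[OF assms(2), of a]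
          frameD[OF assms(2), of "Suc a"] TV_carrier[OF assms(3), of a]
        by (intro mult_5_assoc) auto
    qed (simp add: frame_act_def)
  qed
qed

lemma frame_act_cong:
  assumes "\<And>a. a \<le> length s \<Longrightarrow> U a = U' a" "\<And>a. a \<le> length s \<Longrightarrow> V a = V' a"
  shows "frame_act s U V B = frame_act s U' V' B"
  using assms by (auto simp: frame_act_def intro!: restrict_ext)

lemma frame_act_one:
  assumes "B \<in> TV s"
  shows "frame_act s (\<lambda>a. 1\<^sub>m (psum s a)) (\<lambda>a. 1\<^sub>m (psum s a)) B = B"
proof (rule TV_eqI[of _ s])
  show "frame_act s (\<lambda>a. 1\<^sub>m (psum s a)) (\<lambda>a. 1\<^sub>m (psum s a)) B \<in> TV s"
    using assms by (intro frame_act_TV) (simp_all add: frame_def)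
next
  fix a assume a: "a < length s"
  show "\<alpha> (frame_act s (\<lambda>a. 1\<^sub>m (psum s a)) (\<lambda>a. 1\<^sub>m (psum s a)) B) a = \<alpha> B a"
    "\<beta> (frame_act s (\<lambda>a. 1\<^sub>m (psum s a)) (\<lambda>a. 1\<^sub>m (psum s a)) B) a = \<beta> B a"
    unfolding frame_act_nth[OF a] using TV_carrier[OF assms a] by simp_all
qed (rule assms)

lemma frame_mult:
  assumes "frame s U V" "frame s U' V'"
  shows "frame s (\<lambda>a. U a * U' a) (\<lambda>a. V' a * V a)"
  unfolding frame_def
proof (intro allI impI conjI)
  fix a assume a: "a \<le> length s"
  note D = frameD[OF assms(1) a] frameD[OF assms(2) a]
  show "U a * U' a \<in> carrier_mat (psum s a) (psum s a)" "V' a * V a \<in> carrier_mat (psum s a) (psum s a)" using D by auto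
  have "U a * U' a * 1\<^sub>m (psum s a) * (V' a * V a) = U a * (U' a * 1\<^sub>m (psum s a) * V' a) * V a"
    by (rule mult_5_assoc[symmetric]) (use D in auto)
  then show "U a * U' a * (V' a * V a) = 1\<^sub>m (psum s a)" using D by simp
  have "V' a * V a * 1\<^sub>m (psum s a) * (U a * U' a) = V' a * (V a * 1\<^sub>m (psum s a) * U a) * U' a"
    by (rule mult_5_assoc[symmetric]) (use D in auto)
  then show "V' a * V a * (U a * U' a) = 1\<^sub>m (psum s a)" using D by simp
qed

lemma frame_sym: "frame s U V \<Longrightarrow> frame s V U"
  by (simp add: frame_def)

lemma mult_conj_cancel:
  assumes "X \<in> carrier_mat m m" "P \<in> carrier_mat m l" "U' \<in> carrier_mat l l" "U \<in> carrier_mat l l"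
    "Q \<in> carrier_mat l n" "Y \<in> carrier_mat n n" "U' * U = 1\<^sub>m l"
  shows "(X * P * U') * (U * Q * Y) = X * (P * Q) * (Y :: complex mat)"
proof -
  have "(X * P * U') * (U * Q * Y) = X * P * (U' * (U * Q * Y))"
    using assms by (intro assoc_mult_mat) auto
  also have "U' * (U * Q * Y) = (U' * U) * (Q * Y)"
    using assms assoc_mult_mat[of U l l Q n Y n] assoc_mult_mat[of U' l l U l "Q * Y" n] by simp
  also have "\<dots> = Q * Y" using assms by simp
  also have "X * P * (Q * Y) = X * (P * Q) * Y"
    using assms by (simp add: assoc_mult_mat[of _ m m _ l _ n] assoc_mult_mat[of _ m l _ n _ n]
      assoc_mult_mat[of _ m m _ n _ n])
  finally show ?thesis .
qed

lemma mult_minus_conj: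
  assumes "X \<in> carrier_mat m m" "P \<in> carrier_mat m n" "Q \<in> carrier_mat m n" "Y \<in> carrier_mat n n"
  shows "X * P * Y - X * Q * Y = X * (P - Q) * (Y :: complex mat)"
proof -
  have 1: "X * P \<in> carrier_mat m n" "X * Q \<in> carrier_mat m n" using assms by auto
  show ?thesis
    unfolding mult_minus_distrib_mat[OF assms(1-3)] minus_mult_distrib_mat[OF 1 assms(4)] ..
qed

lemma mult_smult_one_conj:
  assumes "X \<in> carrier_mat m m" "Y \<in> carrier_mat m m" "X * Y = 1\<^sub>m m"
  shows "X * (c \<cdot>\<^sub>m 1\<^sub>m m) * Y = c \<cdot>\<^sub>m (1\<^sub>m m :: complex mat)"
  using assms mult_smult_distrib[of X m m "1\<^sub>m m" m c] mult_smult_assoc_mat[of X m m Y m c] by simp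

lemma moment_frame_act:
  assumes F: "frame s U V" and B: "B \<in> TV s" and a: "a \<in> {1..<length s}"
  shows "moment (frame_act s U V B) a = U a * moment B a * V a"
proof -
  obtain b where b: "a = Suc b" "b < length s" using a by (cases a) auto
  have al: "a < length s" using a by simp
  note D = frameD[OF F, of a] frameD[OF F, of b] frameD[OF F, of "Suc a"] TV_carrier[OF B, of a] TV_carrier[OF B, of b]
  have 1: "\<alpha> (frame_act s U V B) b * \<beta> (frame_act s U V B) b = U a * (\<alpha> B b * \<beta> B b) * V a"
    unfolding frame_act_nth[OF b(2)] b(1)
    using b al D by (intro mult_conj_cancel[of _ "psum s (Suc b)" _ "psum s b"]) auto
  have 2: "\<beta> (frame_act s U V B) a * \<alpha> (frame_act s U V B) a = U a * (\<beta> B a * \<alpha> B a) * V a"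
    unfolding frame_act_nth[OF al]
    using b al D by (intro mult_conj_cancel[of _ "psum s a" _ "psum s (Suc a)"]) auto
  show ?thesis
    unfolding moment_def using 1 2 b al D
    by (simp add: mult_minus_conj[of _ "psum s a" _ "psum s a"])
qed

lemma moment_frame_act_scalar:
  assumes F: "frame s U V" and B: "B \<in> TV s" and a: "a \<in> {1..<length s}"
    and c: "moment B a = c \<cdot>\<^sub>m 1\<^sub>m (psum s a)"
  shows "moment (frame_act s U V B) a = c \<cdot>\<^sub>m 1\<^sub>m (psum s a)"
  using a frameD[OF F, of a] by (simp add: moment_frame_act[OF F B a] c mult_smult_one_conj)

text \<open>The moment map equation says that a matrix is scalar, and such matrices do not change under
  conjugation; so the variety is stable under all changes of basis, not only those of determinant 1.\<close>

lemma frame_act_m_inj: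
  assumes F: "frame s U V" and B: "B \<in> m_inj s"
  shows "frame_act s U V B \<in> m_inj s"
proof -
  have "inj_mat (\<alpha> (frame_act s U V B) a) \<and> (\<exists>c. moment (frame_act s U V B) a = c \<cdot>\<^sub>m 1\<^sub>m (psum s a))"
    if a: "a \<in> {1..<length s}" for a
  proof -
    obtain c where c: "moment B a = c \<cdot>\<^sub>m 1\<^sub>m (psum s a)" and inj: "inj_mat (\<alpha> B a)"
      using B a unfolding m_inj_def by blast
    have al: "a < length s" using a by simp
    have "inj_mat (\<alpha> (frame_act s U V B) a)"
      unfolding frame_act_nth[OF al]
      using al frameD[OF F, of a] frameD[OF F, of "Suc a"] TV_carrier[OF m_inj_TV[OF B], of a] inj
      by (intro inj_mat_conj[of _ "psum s (Suc a)" "psum s a" _ "V (Suc a)" _ "U a"]) auto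
    with moment_frame_act_scalar[OF F m_inj_TV[OF B] a c] show ?thesis by blast
  qed
  with frame_act_TV[OF F m_inj_TV[OF B]] show ?thesis unfolding m_inj_def by blast
qed

lemma lam_eq:
  assumes "moment B a = c \<cdot>\<^sub>m 1\<^sub>m (psum s a)" "0 < psum s a"
  shows "lam s B a = c"
  unfolding lam_def
proof (rule the_equality)
  fix c' assume "moment B a = c' \<cdot>\<^sub>m 1\<^sub>m (psum s a)"
  then have "(c \<cdot>\<^sub>m 1\<^sub>m (psum s a)) $$ (0,0) = (c' \<cdot>\<^sub>m 1\<^sub>m (psum s a)) $$ (0,0)" using assms by simp
  then show "c' = c" using assms by simp
qed (rule assms)

lemma lam_frame_act:
  assumes F: "frame s U V" and B: "B \<in> m_inj s" and a: "a \<in> {1..<length s}" and "0 < psum s a"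
  shows "lam s (frame_act s U V B) a = lam s B a"
proof -
  obtain c where c: "moment B a = c \<cdot>\<^sub>m 1\<^sub>m (psum s a)"
    using B a unfolding m_inj_def by blast
  then show ?thesis
    using lam_eq[OF c assms(4)] lam_eq[OF moment_frame_act_scalar[OF F m_inj_TV[OF B] a c] assms(4)] by simp
qed

section \<open>Gauge transformations and diagonal changes of basis\<close>

definition unit_entries :: "nat list \<Rightarrow> (nat \<Rightarrow> nat \<Rightarrow> complex) \<Rightarrow> bool" where
  "unit_entries s e \<longleftrightarrow> (\<forall>a\<le>length s. \<forall>p<psum s a. e a p \<noteq> 0)"

definition diag_act :: "nat list \<Rightarrow> (nat \<Rightarrow> nat \<Rightarrow> complex) \<Rightarrow> quiver \<Rightarrow> quiver" where
  "diag_act s e = frame_act s (\<lambda>a. mat_diag (psum s a) (\<lambda>p. inverse (e a p))) (\<lambda>a. mat_diag (psum s a) (e a))"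

lemma mat_diag_cong: "(\<And>p. p < n \<Longrightarrow> f p = g p) \<Longrightarrow> mat_diag n f = mat_diag n g"
  by (auto simp: mat_diag_def)

lemma mat_diag_eq_one: "(\<And>p. p < n \<Longrightarrow> f p = 1) \<Longrightarrow> mat_diag n f = 1\<^sub>m n"
  using mat_diag_cong[of n f "\<lambda>_. 1"] by simp

lemma det_mat_diag: "det (mat_diag n f) = (\<Prod>p<n. f p)"
  by (subst det_upper_triangular[of _ n])
     (auto simp: mat_diag_def upper_triangular_def diag_mat_def prod.list_conv_set_nth
       lessThan_atLeast0 simp flip: atLeastLessThan_upt intro!: prod.cong)

lemma frame_diag:
  assumes "unit_entries s e"
  shows "frame s (\<lambda>a. mat_diag (psum s a) (\<lambda>p. inverse (e a p))) (\<lambda>a. mat_diag (psum s a) (e a))"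
  using assms unfolding frame_def unit_entries_def by (auto intro!: mat_diag_eq_one)

lemma diag_act_entries:
  assumes "B \<in> TV s" "a < length s"
  shows "p < psum s (Suc a) \<Longrightarrow> q < psum s a \<Longrightarrow>
      \<alpha> (diag_act s e B) a $$ (p, q) = inverse (e (Suc a) p) * \<alpha> B a $$ (p, q) * e a q"
    "p < psum s a \<Longrightarrow> q < psum s (Suc a) \<Longrightarrow>
      \<beta> (diag_act s e B) a $$ (p, q) = inverse (e a p) * \<beta> B a $$ (p, q) * e (Suc a) q"
  using TV_carrier[OF assms]
  by (simp_all add: diag_act_def frame_act_nth[OF assms(2)]
      mat_diag_mult_left[of _ "psum s (Suc a)" "psum s a"] mat_diag_mult_left[of _ "psum s a" "psum s (Suc a)"]
      mat_diag_mult_right[of _ "psum s (Suc a)" "psum s a"] mat_diag_mult_right[of _ "psum s a" "psum s (Suc a)"])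

lemma gauge_frame:
  assumes "g \<in> gauge s"
  shows "frame s g (\<lambda>a. inv\<^bsub>SL (psum s a)\<^esub> (g a))"
  using assms SL_inv unfolding frame_def gauge_def by (auto simp: SL_def)

lemma gauge_act_eq: "gauge_act s g = frame_act s g (\<lambda>a. inv\<^bsub>SL (psum s a)\<^esub> (g a))"
  by (rule ext) (simp add: gauge_act_def frame_act_def)

lemma gauge_act_eq_frame_act:
  assumes F: "frame s U V" and det: "\<And>a. a \<le> length s \<Longrightarrow> det (U a) = 1"
    and last: "U (length s) = 1\<^sub>m (psum s (length s))"
  shows "U \<in> gauge s" "gauge_act s U = frame_act s U V"
proof -
  have U: "U a \<in> carrier (SL (psum s a))" if "a \<le> length s" for a
    using frameD[OF F that] det[OF that] by (simp add: SL_def)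
  then show "U \<in> gauge s" using last by (simp add: gauge_def)
  have "inv\<^bsub>SL (psum s a)\<^esub> (U a) = V a" if "a \<le> length s" for a
  proof -
    have "det (U a) * det (V a) = 1"
      using frameD[OF F that] det_mult[of "U a" "psum s a" "V a"] by simp
    then have "V a \<in> carrier (SL (psum s a))"
      using frameD[OF F that] det[OF that] by (simp add: SL_def)
    then show ?thesis
      using U[OF that] frameD[OF F that] by (intro group.inv_equality[OF group_SL]) (simp_all add: SL_def)
  qed
  then show "gauge_act s U = frame_act s U V"
    unfolding gauge_act_eq by (intro ext frame_act_cong) auto
qed

lemma coord_ring_invariant:
  assumes "f \<in> carrier (coord_ring s)" "B \<in> m_inj s" "frame s U V" "\<And>a. a \<le> length s \<Longrightarrow> det (U a) = 1"
    "U (length s) = 1\<^sub>m (psum s (length s))"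
  shows "f (frame_act s U V B) = f B"
  using gauge_act_eq_frame_act[OF assms(3-5)] assms(1,2) by (auto simp: coord_ring_def)

lemma diag_act_m_inj: "unit_entries s e \<Longrightarrow> B \<in> m_inj s \<Longrightarrow> diag_act s e B \<in> m_inj s"
  unfolding diag_act_def by (intro frame_act_m_inj frame_diag)

lemma diag_act_diag_act:
  assumes "unit_entries s e" "unit_entries s e'" "B \<in> TV s"
  shows "diag_act s e (diag_act s e' B) = diag_act s (\<lambda>a p. e a p * e' a p) B"
  unfolding diag_act_def frame_act_compose[OF frame_diag[OF assms(1)] frame_diag[OF assms(2)] assms(3)]
  by (intro frame_act_cong) (auto simp: mult_ac intro!: mat_diag_cong)

lemma diag_act_one:
  assumes "B \<in> TV s" "\<And>a p. a \<le> length s \<Longrightarrow> p < psum s a \<Longrightarrow> e a p = 1"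
  shows "diag_act s e B = B"
proof -
  have "diag_act s e B = frame_act s (\<lambda>a. 1\<^sub>m (psum s a)) (\<lambda>a. 1\<^sub>m (psum s a)) B"
    unfolding diag_act_def using assms by (intro frame_act_cong) (auto intro!: mat_diag_eq_one)
  then show ?thesis by (simp add: frame_act_one[OF assms(1)])
qed

text \<open>The two changes of basis differ by diagonal matrices of determinant 1, which form a gauge transformation. At the
  last vertex the gauge group is trivial, so there they have to coincide.\<close>

lemma coord_ring_diag_act_eq:
  assumes e: "unit_entries s e" and e': "unit_entries s e'" and f: "f \<in> carrier (coord_ring s)" and B: "B \<in> m_inj s"
    and det: "\<And>a. a < length s \<Longrightarrow> (\<Prod>p<psum s a. e a p) = (\<Prod>p<psum s a. e' a p)"
    and last: "\<And>p. p < psum s (length s) \<Longrightarrow> e (length s) p = e' (length s) p"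
  shows "f (diag_act s e B) = f (diag_act s e' B)"
proof -
  define r where "r a p = e a p / e' a p" for a p
  have r: "unit_entries s r" using e e' by (auto simp: r_def unit_entries_def)
  have "f (diag_act s e B) = f (diag_act s r (diag_act s e' B))"
    unfolding diag_act_diag_act[OF r e' m_inj_TV[OF B]] using e'
    by (intro arg_cong[of _ _ f]) (auto simp: diag_act_def r_def unit_entries_def intro!: frame_act_cong mat_diag_cong)
  also have "\<dots> = f (diag_act s e' B)"
    unfolding diag_act_def[of s r]
  proof (rule coord_ring_invariant[OF f diag_act_m_inj[OF e' B] frame_diag[OF r]])
    fix a assume a: "a \<le> length s"
    have "(\<Prod>p<psum s a. r a p) = 1"
    proof (cases "a = length s")
      case True
      then show ?thesis using last e' by (intro prod.neutral) (auto simp: r_def unit_entries_def)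
    next
      case False
      then have "(\<Prod>p<psum s a. e a p) = (\<Prod>p<psum s a. e' a p)" using det a by simp
      moreover have "(\<Prod>p<psum s a. e' a p) \<noteq> 0" using e' a by (simp add: unit_entries_def)
      ultimately show ?thesis by (simp add: r_def prod_dividef)
    qed
    then have "(\<Prod>p<psum s a. inverse (r a p)) = 1"
      using prod_inversef[of "\<lambda>p. r a p" "{..<psum s a}"] by (simp add: o_def)
    then show "det (mat_diag (psum s a) (\<lambda>p. inverse (r a p))) = 1" by (simp add: det_mat_diag)
  next
    show "mat_diag (psum s (length s)) (\<lambda>p. inverse (r (length s) p)) = 1\<^sub>m (psum s (length s))"
      using last e' by (intro mat_diag_eq_one) (auto simp: r_def unit_entries_def)
  qed
  finally show ?thesis .
qed

section \<open>Pullback of functions along a diagonal change of basis\<close>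

definition pullback :: "nat list \<Rightarrow> (nat \<Rightarrow> nat \<Rightarrow> complex) \<Rightarrow> (quiver \<Rightarrow> complex) \<Rightarrow> quiver \<Rightarrow> complex" where
  "pullback s e f = (\<lambda>B\<in>m_inj s. f (diag_act s e B))"

text \<open>A diagonal change of basis multiplies every coordinate by a constant.\<close>

lemma poly_funs_diag_act:
  assumes "p \<in> poly_funs s"
  shows "\<exists>p'\<in>poly_funs s. \<forall>B\<in>TV s. p (diag_act s e B) = p' B"
  using assms
proof induction
  case (const c)
  show ?case by (intro bexI[OF _ poly_funs.const[of c]]) simp
next
  case (alpha a p q)
  have "(\<lambda>B. (inverse (e (Suc a) p) * e a q) * \<alpha> B a $$ (p, q)) \<in> poly_funs s"
    using alpha by (intro poly_funs.mult[OF poly_funs.const poly_funs.alpha])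
  then show ?case
    by (rule bexI[rotated]) (use alpha in \<open>simp add: diag_act_entries\<close>)
next
  case (beta a p q)
  have "(\<lambda>B. (inverse (e a p) * e (Suc a) q) * \<beta> B a $$ (p, q)) \<in> poly_funs s"
    using beta by (intro poly_funs.mult[OF poly_funs.const poly_funs.beta])
  then show ?case
    by (rule bexI[rotated]) (use beta in \<open>simp add: diag_act_entries\<close>)
next
  case (add f g)
  then obtain f' g' where "f' \<in> poly_funs s" "\<forall>B\<in>TV s. f (diag_act s e B) = f' B"
    "g' \<in> poly_funs s" "\<forall>B\<in>TV s. g (diag_act s e B) = g' B" by blast
  then show ?case by (intro bexI[of _ "\<lambda>B. f' B + g' B"] poly_funs.add) simp_all
next
  case (mult f g)
  then obtain f' g' where "f' \<in> poly_funs s" "\<forall>B\<in>TV s. f (diag_act s e B) = f' B"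
    "g' \<in> poly_funs s" "\<forall>B\<in>TV s. g (diag_act s e B) = g' B" by blast
  then show ?case by (intro bexI[of _ "\<lambda>B. f' B * g' B"] poly_funs.mult) simp_all
qed

lemma regular_funs_pullback:
  assumes e: "unit_entries s e" and f: "f \<in> regular_funs s"
  shows "pullback s e f \<in> regular_funs s"
  unfolding regular_funs_def
proof (intro CollectI conjI ballI)
  show "pullback s e f \<in> extensional (m_inj s)" by (simp add: pullback_def)
  fix B assume B: "B \<in> m_inj s"
  let ?C = "diag_act s e"
  have C: "?C B' \<in> m_inj s" if "B' \<in> m_inj s" for B' using diag_act_m_inj[OF e that] .
  obtain p q where pq: "p \<in> poly_funs s" "q \<in> poly_funs s" "q (?C B) \<noteq> 0"
    "\<And>B'. B' \<in> m_inj s \<Longrightarrow> q B' \<noteq> 0 \<Longrightarrow> f B' = p B' / q B'"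
    using f C[OF B] unfolding regular_funs_def by blast
  obtain p' q' where p': "p' \<in> poly_funs s" "\<forall>B\<in>TV s. p (?C B) = p' B"
    and q': "q' \<in> poly_funs s" "\<forall>B\<in>TV s. q (?C B) = q' B"
    using poly_funs_diag_act[OF pq(1)] poly_funs_diag_act[OF pq(2)] by metis
  have "q' B \<noteq> 0" using pq(3) q'(2) m_inj_TV[OF B] by simp
  moreover have "pullback s e f B' = p' B' / q' B'" if "B' \<in> m_inj s" "q' B' \<noteq> 0" for B'
    using pq(4)[OF C[OF that(1)]] that p' q' m_inj_TV[OF that(1)] by (simp add: pullback_def)
  ultimately show "\<exists>p\<in>poly_funs s. \<exists>q\<in>poly_funs s. q B \<noteq> 0 \<and>
      (\<forall>B'\<in>m_inj s. q B' \<noteq> 0 \<longrightarrow> pullback s e f B' = p B' / q B')"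
    using p'(1) q'(1) by blast
qed

text \<open>The torus normalizes the gauge group, hence it acts on the invariant functions.\<close>

lemma coord_ring_pullback:
  assumes e: "unit_entries s e" and f: "f \<in> carrier (coord_ring s)"
  shows "pullback s e f \<in> carrier (coord_ring s)"
proof -
  have inv: "pullback s e f (gauge_act s g B) = pullback s e f B" if g: "g \<in> gauge s" and B: "B \<in> m_inj s" for g B
  proof -
    define E where "E a = mat_diag (psum s a) (e a)" for a
    define E' where "E' a = mat_diag (psum s a) (\<lambda>p. inverse (e a p))" for a
    define G where "G a = inv\<^bsub>SL (psum s a)\<^esub> (g a)" for a
    have F: "frame s E' E" using frame_diag[OF e] unfolding E_def E'_def .
    have Fg: "frame s g G" using gauge_frame[OF g] unfolding G_def .
    have C: "frame_act s E' E B \<in> m_inj s" by (rule frame_act_m_inj[OF F B])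
    define H where "H a = E' a * g a * E a" for a
    define H' where "H' a = E' a * (G a * E a)" for a
    have FH: "frame s H H'"
      unfolding H_def H'_def by (rule frame_mult[OF frame_mult[OF F Fg] frame_sym[OF F]])
    have one: "g (length s) = 1\<^sub>m (psum s (length s))" using g by (simp add: gauge_def)
    have "frame_act s E' E (frame_act s g G B) = frame_act s H H' (frame_act s E' E B)"
      unfolding frame_act_compose[OF F Fg m_inj_TV[OF B]] frame_act_compose[OF FH F m_inj_TV[OF B]]
    proof (rule frame_act_cong)
      fix a assume a: "a \<le> length s"
      note D = frameD[OF F a] frameD[OF Fg a]
      show "E' a * g a = H a * E' a"
        unfolding H_def using D assoc_mult_mat[of "E' a * g a" "psum s a" "psum s a" "E a" "psum s a" "E' a" "psum s a"]
        by simp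
      show "G a * E a = E a * H' a"
        unfolding H'_def using D assoc_mult_mat[of "E a" "psum s a" "psum s a" "E' a" "psum s a" "G a * E a" "psum s a"]
        by simp
    qed
    moreover have "f (frame_act s H H' (frame_act s E' E B)) = f (frame_act s E' E B)"
    proof (rule coord_ring_invariant[OF f C FH])
      fix a assume a: "a \<le> length s"
      note D = frameD[OF F a] frameD[OF Fg a]
      have "det (E' a) * det (E a) = 1"
        using det_mult[OF D(1,2)] D(3) by simp
      moreover have "det (g a) = 1" using g a by (simp add: gauge_def SL_def)
      moreover have "det (H a) = det (E' a) * det (g a) * det (E a)"
        unfolding H_def using D by (simp add: det_mult[of _ "psum s a"])
      ultimately show "det (H a) = 1" by simp
    next
      show "H (length s) = 1\<^sub>m (psum s (length s))"
        unfolding H_def one using frameD[OF F, of "length s"] by simp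
    qed
    moreover have "diag_act s e = frame_act s E' E" "gauge_act s g = frame_act s g G"
      by (simp_all add: diag_act_def gauge_act_eq E_def[abs_def] E'_def[abs_def] G_def[abs_def])
    ultimately show ?thesis
      using B gauge_act_m_inj[OF g B] by (simp add: pullback_def)
  qed
  have "pullback s e f \<in> regular_funs s" using f by (intro regular_funs_pullback e) (simp add: coord_ring_def)
  with inv show ?thesis by (simp add: coord_ring_def)
qed

lemma coord_ring_ops:
  "f \<otimes>\<^bsub>coord_ring s\<^esub> g = (\<lambda>B\<in>m_inj s. f B * g B)" "f \<oplus>\<^bsub>coord_ring s\<^esub> g = (\<lambda>B\<in>m_inj s. f B + g B)"
  "\<one>\<^bsub>coord_ring s\<^esub> = (\<lambda>B\<in>m_inj s. 1)" "c \<odot>\<^bsub>coord_ring s\<^esub> f = (\<lambda>B\<in>m_inj s. c * f B)"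
  by (simp_all add: coord_ring_def)

lemma coord_ring_extensional: "f \<in> carrier (coord_ring s) \<Longrightarrow> f \<in> extensional (m_inj s)"
  by (simp add: coord_ring_def regular_funs_def)

lemma unit_entries_inverse: "unit_entries s e \<Longrightarrow> unit_entries s (\<lambda>a p. inverse (e a p))"
  by (simp add: unit_entries_def)

lemma pullback_inverse:
  assumes e: "unit_entries s e" and f: "f \<in> extensional (m_inj s)"
  shows "pullback s e (pullback s (\<lambda>a p. inverse (e a p)) f) = f"
    "pullback s (\<lambda>a p. inverse (e a p)) (pullback s e f) = f"
proof -
  note e' = unit_entries_inverse[OF e]
  have "diag_act s (\<lambda>a p. inverse (e a p)) (diag_act s e B) = B"
    "diag_act s e (diag_act s (\<lambda>a p. inverse (e a p)) B) = B" if "B \<in> m_inj s" for B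
    unfolding diag_act_diag_act[OF e e' m_inj_TV[OF that]] diag_act_diag_act[OF e' e m_inj_TV[OF that]]
    using e by (auto intro!: diag_act_one[OF m_inj_TV[OF that]] simp: unit_entries_def)
  then show "pullback s e (pullback s (\<lambda>a p. inverse (e a p)) f) = f"
    "pullback s (\<lambda>a p. inverse (e a p)) (pullback s e f) = f"
    using f diag_act_m_inj[OF e] diag_act_m_inj[OF e']
    by (auto simp: pullback_def intro!: extensionalityI[of _ "m_inj s"])
qed

lemma pullback_calg_iso:
  assumes e: "unit_entries s e"
  shows "pullback s e \<in> calg_iso (coord_ring s) (coord_ring s)"
proof -
  have "pullback s e \<in> Ring.ring_hom (coord_ring s) (coord_ring s)"
    using diag_act_m_inj[OF e]
    by (intro ring_hom_memI coord_ring_pullback[OF e])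
       (auto simp: coord_ring_ops pullback_def intro!: restrict_ext)
  moreover have "bij_betw (pullback s e) (carrier (coord_ring s)) (carrier (coord_ring s))"
    by (rule bij_betw_byWitness[where f' = "pullback s (\<lambda>a p. inverse (e a p))"])
       (use e coord_ring_pullback unit_entries_inverse pullback_inverse coord_ring_extensional in blast)+
  ultimately show ?thesis
    using diag_act_m_inj[OF e] unfolding calg_iso_def
    by (auto simp: coord_ring_ops pullback_def intro!: restrict_ext)
qed

section \<open>Isomorphisms of affine schemes\<close>

text \<open>The contraction of \<open>p\<close> along \<open>\<phi>\<close>, without the restriction to prime ideals, so that contractions compose as
  functions.\<close>

definition spec_map :: "('b, 'm) ring_scheme \<Rightarrow> ('b \<Rightarrow> 'a) \<Rightarrow> 'a set \<Rightarrow> 'b set" where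
  "spec_map S \<phi> p = {f \<in> carrier S. \<phi> f \<in> p}"

lemma Spec_iso_alt: "F \<in> Spec_iso R S \<longleftrightarrow> (\<exists>\<phi>\<in>calg_iso S R. F = (\<lambda>p\<in>Spec R. spec_map S \<phi> p))"
  by (simp add: Spec_iso_def spec_map_def)

lemma calg_iso_carrier: "\<phi> \<in> calg_iso R S \<Longrightarrow> f \<in> carrier R \<Longrightarrow> \<phi> f \<in> carrier S"
  unfolding calg_iso_def using ring_hom_closed[of \<phi> R S f] by blast

lemma calg_iso_compose:
  assumes "\<phi> \<in> calg_iso R S" "\<psi> \<in> calg_iso S T"
  shows "\<psi> \<circ> \<phi> \<in> calg_iso R T"
  using assms ring_hom_trans[of \<phi> R S \<psi> T] bij_betw_trans[of \<phi> "carrier R" "carrier S" \<psi> "carrier T"]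
    calg_iso_carrier[OF assms(1)]
  unfolding calg_iso_def by auto

lemma spec_map_compose:
  assumes "\<phi> \<in> calg_iso R S"
  shows "spec_map R \<phi> (spec_map S \<psi> p) = spec_map R (\<psi> \<circ> \<phi>) p"
  using calg_iso_carrier[OF assms] by (auto simp: spec_map_def)

lemma spec_map_Spec:
  assumes R: "cring R" and S: "cring S" and "\<phi> \<in> Ring.ring_hom S R" and p: "p \<in> Spec R"
  shows "spec_map S \<phi> p \<in> Spec S"
proof -
  interpret ring_hom_ring S R \<phi>
    using assms by (intro ring_hom_ringI2) (auto simp: cring_def)
  show ?thesis
    using p primeideal_vimage[OF S, of p] by (simp add: Spec_def spec_map_def)
qed

lemma spec_map_bij:
  assumes R: "cring R" and S: "cring S" and \<phi>: "\<phi> \<in> calg_iso S R"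
  shows "bij_betw (spec_map S \<phi>) (Spec R) (Spec S)"
proof -
  let ?\<psi> = "inv_into (carrier S) \<phi>"
  have hom: "\<phi> \<in> Ring.ring_hom S R" and bij: "bij_betw \<phi> (carrier S) (carrier R)"
    using \<phi> by (auto simp: calg_iso_def)
  have "\<phi> \<in> ring_iso S R" using hom bij by (simp add: ring_iso_def)
  then have hom': "?\<psi> \<in> Ring.ring_hom R S"
    using ring_iso_set_sym[of S \<phi> R] S by (auto simp: cring_def ring_iso_def)
  have sub: "p \<subseteq> carrier A" if "p \<in> Spec A" for p and A :: "('x, 'y) ring_scheme"
    using that by (auto simp: Spec_def primeideal_def dest!: ideal.Icarr)
  have inv: "?\<psi> (\<phi> f) = f" if "f \<in> carrier S" for f
    using bij_betw_inv_into_left[OF bij that] .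
  have inv': "\<phi> (?\<psi> f) = f" "?\<psi> f \<in> carrier S" if "f \<in> carrier R" for f
    using bij_betw_inv_into_right[OF bij that] bij_betw_apply[OF bij_betw_inv_into[OF bij] that] by auto
  show ?thesis
  proof (rule bij_betw_byWitness[where f' = "spec_map R ?\<psi>"])
    show "\<forall>p\<in>Spec R. spec_map R ?\<psi> (spec_map S \<phi> p) = p"
      using sub[of _ R] inv' by (fastforce simp: spec_map_def)
    show "\<forall>q\<in>Spec S. spec_map S \<phi> (spec_map R ?\<psi> q) = q"
      using sub[of _ S] inv calg_iso_carrier[OF \<phi>] by (fastforce simp: spec_map_def)
    show "spec_map S \<phi> ` Spec R \<subseteq> Spec S" using spec_map_Spec[OF R S hom] by blast
    show "spec_map R ?\<psi> ` Spec S \<subseteq> Spec R" using spec_map_Spec[OF S R hom'] by blast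
  qed
qed

lemma Spec_iso_bij:
  assumes "cring R" "cring S" "F \<in> Spec_iso R S"
  shows "bij_betw F (Spec R) (Spec S)"
proof -
  obtain \<phi> where "\<phi> \<in> calg_iso S R" "F = (\<lambda>p\<in>Spec R. spec_map S \<phi> p)"
    using assms(3) unfolding Spec_iso_alt by blast
  then show ?thesis
    using bij_betw_cong[of "Spec R" F "spec_map S \<phi>" "Spec S"] spec_map_bij[OF assms(1,2)] by simp
qed

section \<open>Diagonal changes of basis on the affine scheme\<close>

definition diag_shift :: "nat list \<Rightarrow> (nat \<Rightarrow> nat \<Rightarrow> complex) \<Rightarrow> (quiver \<Rightarrow> complex) set \<Rightarrow> (quiver \<Rightarrow> complex) set" where
  "diag_shift s e = spec_map (coord_ring s) (pullback s e)"

lemma diag_shift_MP: "unit_entries s e \<Longrightarrow> p \<in> MP s \<Longrightarrow> diag_shift s e p \<in> MP s"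
  unfolding diag_shift_def MP_def
  using bij_betw_apply[OF spec_map_bij[OF cring_coord_ring cring_coord_ring pullback_calg_iso]] .

lemma diag_shift_point:
  assumes "unit_entries s e" "B \<in> m_inj s"
  shows "diag_shift s e (point s B) = point s (diag_act s e B)"
  using assms coord_ring_pullback by (auto simp: diag_shift_def spec_map_def point_def pullback_def)

lemma MP_subset: "p \<in> MP s \<Longrightarrow> p \<subseteq> carrier (coord_ring s)"
  by (auto simp: MP_def Spec_def primeideal_def dest!: ideal.Icarr)

lemma diag_shift_inverse:
  assumes e: "unit_entries s e" and p: "p \<in> MP s"
  shows "diag_shift s e (diag_shift s (\<lambda>a p. inverse (e a p)) p) = p"
    "diag_shift s (\<lambda>a p. inverse (e a p)) (diag_shift s e p) = p"
proof -
  have id: "spec_map (coord_ring s) \<phi> p = p" if "\<And>f. f \<in> carrier (coord_ring s) \<Longrightarrow> \<phi> f = f" for \<phi>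
    using MP_subset[OF p] that by (auto simp: spec_map_def)
  show "diag_shift s e (diag_shift s (\<lambda>a p. inverse (e a p)) p) = p"
    unfolding diag_shift_def spec_map_compose[OF pullback_calg_iso[OF e]]
    by (rule id) (simp add: pullback_inverse[OF e coord_ring_extensional])
  show "diag_shift s (\<lambda>a p. inverse (e a p)) (diag_shift s e p) = p"
    unfolding diag_shift_def spec_map_compose[OF pullback_calg_iso[OF unit_entries_inverse[OF e]]]
    by (rule id) (simp add: pullback_inverse[OF e coord_ring_extensional])
qed

section \<open>Exterior powers and rescaling of coordinates\<close>

lemma bij_betw_pick:
  assumes "finite I"
  shows "bij_betw (pick I) {..<card I} I"
proof (rule bij_betwI')
  fix x y assume "x \<in> {..<card I}" "y \<in> {..<card I}"
  then show "(pick I x = pick I y) = (x = y)"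
    using pick_mono_le[of x I y] pick_mono_le[of y I x] by (cases x y rule: linorder_cases) auto
next
  fix x assume "x \<in> {..<card I}"
  then show "pick I x \<in> I" using pick_in_set_le[of x I] by simp
next
  fix y assume y: "y \<in> I"
  have "card {a \<in> I. a < y} < card I" using assms y by (intro psubset_card_mono) auto
  then show "\<exists>x\<in>{..<card I}. y = pick I x" using pick_card_in_set[OF y] by (intro bexI[of _ "card {a \<in> I. a < y}"]) auto
qed

lemma mat_diag_mult_both:
  assumes "A \<in> carrier_mat n m"
  shows "mat_diag n r * A * mat_diag m c = mat n m (\<lambda>(p, q). r p * A $$ (p, q) * c q)"
  using assms by (auto simp: mat_diag_mult_left[of _ n m] mat_diag_mult_right[of _ n m])

text \<open>Diagonal matrices act on the exterior powers through the coordinate basis, so only this special case of the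
  functoriality of \<open>\<Lambda>\<close> is involved.\<close>

lemma det_submatrix_scale:
  assumes A: "A \<in> carrier_mat n m" and I: "I \<subseteq> {..<n}" and J: "J \<subseteq> {..<m}" and IJ: "card J = card I"
  shows "det (submatrix (mat_diag n r * A * mat_diag m c) I J) =
    (\<Prod>p\<in>I. r p) * det (submatrix A I J) * (\<Prod>q\<in>J. c q :: complex)"
proof -
  have fin: "finite I" "finite J" using I J finite_subset by auto
  have sets: "{i. i < n \<and> i \<in> I} = I" "{i. i < m \<and> i \<in> J} = J" using I J by auto
  have pI: "pick I p < n" if "p < card I" for p
    using pick_in_set_le[OF that] I by auto
  have pJ: "pick J p < m" if "p < card J" for p
    using pick_in_set_le[OF that] J by auto
  have sub: "submatrix M I J = mat (card I) (card I) (\<lambda>(p, q). M $$ (pick I p, pick J q))"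
    if "M \<in> carrier_mat n m" for M :: "complex mat"
    unfolding submatrix_def by (simp only: carrier_matD[OF that] sets IJ)
  have S: "submatrix A I J \<in> carrier_mat (card I) (card I)" unfolding sub[OF A] by simp
  have RAC: "mat_diag n r * A * mat_diag m c \<in> carrier_mat n m" unfolding mat_diag_mult_both[OF A] by simp
  have "submatrix (mat_diag n r * A * mat_diag m c) I J =
      mat_diag (card I) (\<lambda>p. r (pick I p)) * submatrix A I J * mat_diag (card I) (\<lambda>q. c (pick J q))"
    (is "?L = ?R")
  proof -
    have L: "?L = mat (card I) (card I) (\<lambda>(p, q). (mat_diag n r * A * mat_diag m c) $$ (pick I p, pick J q))"
      by (rule sub[OF RAC])
    show ?thesis
      unfolding L mat_diag_mult_both[OF S]
      by (rule cong_mat) (use pI pJ IJ in \<open>simp_all add: mat_diag_mult_both[OF A] sub[OF A]\<close>)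
  qed
  then have "det (submatrix (mat_diag n r * A * mat_diag m c) I J) =
      (\<Prod>p<card I. r (pick I p)) * det (submatrix A I J) * (\<Prod>q<card J. c (pick J q))"
    by (simp only: det_mult[OF mult_carrier_mat[OF mat_diag_dim S] mat_diag_dim] det_mult[OF mat_diag_dim S] det_mat_diag IJ)
  then show ?thesis
    using prod.reindex_bij_betw[OF bij_betw_pick[OF fin(1)], of r] prod.reindex_bij_betw[OF bij_betw_pick[OF fin(2)], of c]
    by simp
qed

lemma ext_map_scale:
  assumes A: "A \<in> carrier_mat n m" and I: "I \<subseteq> {..<n}"
  shows "ext_map (mat_diag n r * A * mat_diag m c) \<omega> I =
    (\<Prod>p\<in>I. r p) * ext_map A (\<lambda>J. (\<Prod>q\<in>J. c q) * \<omega> J) I"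
proof -
  have "dim_row (mat_diag n r * A * mat_diag m c) = n" "dim_col (mat_diag n r * A * mat_diag m c) = m"
    using A by (auto simp: mat_diag_mult_both)
  then show ?thesis
    using A I by (auto simp: ext_map_def sum_distrib_left det_submatrix_scale[OF A I] mult_ac intro!: sum.cong)
qed

lemma ext_map_mult: "ext_map A (\<lambda>J. c * \<omega> J) I = c * ext_map A \<omega> I"
  by (auto simp: ext_map_def sum_distrib_left mult_ac intro!: sum.cong)

lemma vol_scale: "(\<Prod>q\<in>J. c q) * vol m J = (\<Prod>q<m. c q) * vol m J"
  by (simp add: vol_def)

text \<open>Apart from the common change of basis in the middle term, \<open>A (vol)\<close> is multiplied by \<open>\<Prod> v\<close> and a lift of \<open>vol\<close> by
  \<open>\<Prod> u\<close>, while the change of basis divides the volume of the middle term by \<open>\<Prod> w\<close>. The three effects cancel under the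
  last hypothesis.\<close>

lemma has_torsion_scale:
  assumes A: "A \<in> carrier_mat N m" and C: "C \<in> carrier_mat n N" and T: "has_torsion A C \<tau>"
    and u: "\<And>p. p < n \<Longrightarrow> u p \<noteq> 0" and w: "\<And>p. p < N \<Longrightarrow> w p \<noteq> 0"
    and prod: "(\<Prod>p<n. u p) * (\<Prod>p<m. v p) = (\<Prod>p<N. w p)"
  shows "has_torsion (mat_diag N (\<lambda>p. inverse (w p)) * A * mat_diag m v)
    (mat_diag n (\<lambda>p. inverse (u p)) * C * mat_diag N w) \<tau>"
  (is "has_torsion ?A ?C \<tau>")
  unfolding has_torsion_def
proof (intro ballI impI)
  have dims: "dim_row ?A = N" "dim_col ?A = m" "dim_row ?C = n" "dim_col ?C = N" using A C by (simp_all add: mat_diag_mult_both)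
  fix \<eta>2 assume \<eta>2: "\<eta>2 \<in> ext_power (dim_row ?C) (dim_col ?C)" "ext_map ?C \<eta>2 = vol (dim_row ?C)"
  define \<kappa> where "\<kappa> = (\<Prod>p<n. u p)"
  have \<kappa>: "\<kappa> \<noteq> 0" using u by (simp add: \<kappa>_def)
  define \<eta> where "\<eta> J = inverse \<kappa> * ((\<Prod>p\<in>J. w p) * \<eta>2 J)" for J
  have "\<eta> \<in> ext_power n N" using \<eta>2(1) unfolding dims by (auto simp: ext_power_def \<eta>_def)
  moreover have "ext_map C \<eta> = vol n"
  proof
    fix I show "ext_map C \<eta> I = vol n I"
    proof (cases "I \<subseteq> {..<n}")
      case True
      have "(\<Prod>p\<in>I. inverse (u p)) * ext_map C (\<lambda>J. (\<Prod>p\<in>J. w p) * \<eta>2 J) I = vol n I"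
        using fun_cong[OF \<eta>2(2), of I] ext_map_scale[OF C True, of "\<lambda>p. inverse (u p)" w \<eta>2] dims by simp
      moreover have "(\<Prod>p\<in>I. u p) * (\<Prod>p\<in>I. inverse (u p)) = 1"
        using u True by (subst prod.distrib[symmetric]) (auto intro!: prod.neutral)
      ultimately have "ext_map C (\<lambda>J. (\<Prod>p\<in>J. w p) * \<eta>2 J) I = (\<Prod>p\<in>I. u p) * vol n I"
        by (metis mult.assoc mult_1)
      then show ?thesis
        unfolding \<eta>_def ext_map_mult vol_scale using \<kappa> by (simp add: \<kappa>_def)
    next
      case False
      then show ?thesis using C by (auto simp: ext_map_def vol_def)
    qed
  qed
  ultimately have wd: "wedge (ext_map A (vol m)) \<eta> = (\<lambda>I. \<tau> * vol N I)"
    using T A C unfolding has_torsion_def by auto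
  have extA: "ext_map ?A (vol m) I = (\<Prod>p<m. v p) * (\<Prod>p\<in>I. inverse (w p)) * ext_map A (vol m) I" for I
  proof (cases "I \<subseteq> {..<N}")
    case True
    show ?thesis unfolding ext_map_scale[OF A True] vol_scale ext_map_mult by simp
  next
    case False
    then show ?thesis using A dims by (simp add: ext_map_def)
  qed
  have ext\<eta>: "\<eta>2 J = \<kappa> * (\<Prod>p\<in>J. inverse (w p)) * \<eta> J" for J
  proof (cases "J \<subseteq> {..<N}")
    case True
    have "(\<Prod>p\<in>J. inverse (w p)) * (\<Prod>p\<in>J. w p) = 1"
      using w True by (subst prod.distrib[symmetric]) (auto intro!: prod.neutral)
    then have P: "(\<Prod>p\<in>J. inverse (w p)) * ((\<Prod>p\<in>J. w p) * \<eta>2 J) = \<eta>2 J" by (metis mult.assoc mult_1)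
    have Q: "\<kappa> * (\<Prod>p\<in>J. inverse (w p)) * \<eta> J =
        (\<kappa> * inverse \<kappa>) * ((\<Prod>p\<in>J. inverse (w p)) * ((\<Prod>p\<in>J. w p) * \<eta>2 J))"
      unfolding \<eta>_def by (simp only: mult_ac)
    show ?thesis unfolding Q P using \<kappa> by simp
  next
    case False
    then have "\<eta>2 J = 0" using \<eta>2(1) unfolding dims ext_power_def by blast
    then show ?thesis by (simp add: \<eta>_def)
  qed
  show "wedge (ext_map ?A (vol (dim_col ?A))) \<eta>2 = (\<lambda>I. \<tau> * vol (dim_col ?C) I)"
  proof
    fix K show "wedge (ext_map ?A (vol (dim_col ?A))) \<eta>2 K = \<tau> * vol (dim_col ?C) K"
    proof (cases "finite K")
      case True
      let ?c = "(\<Prod>p<m. v p) * \<kappa> * (\<Prod>p\<in>K. inverse (w p))"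
      have "wedge (ext_map ?A (vol m)) \<eta>2 K = ?c * wedge (ext_map A (vol m)) \<eta> K"
        unfolding wedge_def sum_distrib_left
      proof (rule sum.cong[OF refl])
        fix I assume "I \<in> Pow K"
        then have P: "(\<Prod>p\<in>K. inverse (w p)) = (\<Prod>p\<in>K - I. inverse (w p)) * (\<Prod>p\<in>I. inverse (w p))"
          using prod.subset_diff[of I K] True by blast
        show "(- 1) ^ card {(i, j). i \<in> I \<and> j \<in> K - I \<and> j < i} * ext_map ?A (vol m) I * \<eta>2 (K - I) =
          ?c * ((- 1) ^ card {(i, j). i \<in> I \<and> j \<in> K - I \<and> j < i} * ext_map A (vol m) I * \<eta> (K - I))"
          unfolding extA ext\<eta>[of "K - I"] P by (simp only: mult_ac)
      qed
      also have "\<dots> = \<tau> * ((\<Prod>p<m. v p) * \<kappa> * (\<Prod>p<N. inverse (w p)) * vol N K)"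
        unfolding wd using vol_scale[where J = K and c = "\<lambda>p. inverse (w p)" and m = N] by (simp only: mult_ac)
      also have "(\<Prod>p<m. v p) * \<kappa> * (\<Prod>p<N. inverse (w p)) = 1"
      proof -
        have "(\<Prod>p<N. w p) * (\<Prod>p<N. inverse (w p)) = 1"
          using w by (subst prod.distrib[symmetric]) (auto intro!: prod.neutral)
        then show ?thesis using prod by (simp add: \<kappa>_def mult.commute)
      qed
      finally show ?thesis using dims by simp
    next
      case False
      then have "K \<noteq> {..<N}" by auto
      then show ?thesis using False dims by (simp add: wedge_def vol_def)
    qed
  qed
qed

lemma surj_mat_conj:
  assumes C: "C \<in> carrier_mat n N" and surj: "surj_mat C"
    and U: "U \<in> carrier_mat n n" "U' \<in> carrier_mat n n" "U * U' = 1\<^sub>m n"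
    and X: "X \<in> carrier_mat N N" "X' \<in> carrier_mat N N" "X * X' = 1\<^sub>m N"
  shows "surj_mat (U * C * X)"
proof -
  have "\<exists>x\<in>carrier_vec N. (U * C * X) *\<^sub>v x = y" if y: "y \<in> carrier_vec n" for y
  proof -
    have "U' *\<^sub>v y \<in> carrier_vec n" using U y by simp
    then obtain v where v: "v \<in> carrier_vec N" "C *\<^sub>v v = U' *\<^sub>v y"
      using surj C unfolding surj_mat_def by (metis carrier_matD imageE)
    have "(U * C * X) *\<^sub>v (X' *\<^sub>v v) = U *\<^sub>v (C *\<^sub>v (X *\<^sub>v (X' *\<^sub>v v)))"
      using U C X v by (simp add: assoc_mult_mat_vec[of _ n N _ N] assoc_mult_mat_vec[of _ n n _ N])
    also have "X *\<^sub>v (X' *\<^sub>v v) = v" using X v by (simp flip: assoc_mult_mat_vec)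
    also have "U *\<^sub>v (C *\<^sub>v v) = y" unfolding v(2) using U y by (simp flip: assoc_mult_mat_vec)
    finally show ?thesis using X v by (intro bexI[of _ "X' *\<^sub>v v"]) auto
  qed
  moreover have "(U * C * X) *\<^sub>v x \<in> carrier_vec n" for x
    by (rule carrier_vecI) (simp only: dim_mult_mat_vec index_mult_mat carrier_matD[OF U(1)])
  ultimately have "(\<lambda>v. (U * C * X) *\<^sub>v v) ` carrier_vec N = carrier_vec n" by blast
  then show ?thesis
    unfolding surj_mat_def by (simp only: index_mult_mat carrier_matD[OF U(1)] carrier_matD[OF X(1)])
qed

lemma short_exact_conj:
  assumes A: "A \<in> carrier_mat N m" and C: "C \<in> carrier_mat n N" and E: "short_exact A C"
    and W: "W \<in> carrier_mat N N" "X \<in> carrier_mat N N" "W * X = 1\<^sub>m N" "X * W = 1\<^sub>m N"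
    and V: "V \<in> carrier_mat m m" "V' \<in> carrier_mat m m" "V * V' = 1\<^sub>m m" "V' * V = 1\<^sub>m m"
    and U: "U \<in> carrier_mat n n" "U' \<in> carrier_mat n n" "U * U' = 1\<^sub>m n" "U' * U = 1\<^sub>m n"
  shows "short_exact (W * A * V) (U * C * X)"
proof -
  have inj: "inj_mat (W * A * V)" using E by (intro inj_mat_conj[OF A _ W(1,2,4) V(1,2,4)]) (simp add: short_exact_def)
  have surj: "surj_mat (U * C * X)" using E by (intro surj_mat_conj[OF C _ U(1,2,3) W(2,1,4)]) (simp add: short_exact_def)
  have im: "(\<lambda>v. A *\<^sub>v v) ` carrier_vec m = {w \<in> carrier_vec N. C *\<^sub>v w = 0\<^sub>v n}"
    using E unfolding short_exact_def by (simp only: carrier_matD[OF A] carrier_matD[OF C])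
  have ker: "C *\<^sub>v w = 0\<^sub>v n \<longleftrightarrow> (\<exists>v\<in>carrier_vec m. w = A *\<^sub>v v)" if "w \<in> carrier_vec N" for w
    using im that by blast
  have mA: "(W * A * V) *\<^sub>v v = W *\<^sub>v (A *\<^sub>v (V *\<^sub>v v))" if "v \<in> carrier_vec m" for v
    using W A V that by (simp add: assoc_mult_mat_vec[of _ N m _ m] assoc_mult_mat_vec[of _ N N _ m])
  have mC: "(U * C * X) *\<^sub>v w = U *\<^sub>v (C *\<^sub>v (X *\<^sub>v w))" if "w \<in> carrier_vec N" for w
    using W C U that by (simp add: assoc_mult_mat_vec[of _ n N _ N] assoc_mult_mat_vec[of _ n n _ N])
  have c: "P *\<^sub>v (Q *\<^sub>v v) = v" if "P \<in> carrier_mat d d" "Q \<in> carrier_mat d d" "P * Q = 1\<^sub>m d" "v \<in> carrier_vec d"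
    for P Q :: "complex mat" and d v
    using that by (simp flip: assoc_mult_mat_vec)
  have eq: "(U * C * X) *\<^sub>v w = 0\<^sub>v n \<longleftrightarrow> (\<exists>v\<in>carrier_vec m. w = (W * A * V) *\<^sub>v v)" if w: "w \<in> carrier_vec N" for w
  proof -
    have Xw: "X *\<^sub>v w \<in> carrier_vec N" using W w by simp
    have "(U * C * X) *\<^sub>v w = 0\<^sub>v n \<longleftrightarrow> C *\<^sub>v (X *\<^sub>v w) = 0\<^sub>v n"
      unfolding mC[OF w]
    proof
      assume z: "U *\<^sub>v (C *\<^sub>v (X *\<^sub>v w)) = 0\<^sub>v n"
      have "C *\<^sub>v (X *\<^sub>v w) = U' *\<^sub>v (U *\<^sub>v (C *\<^sub>v (X *\<^sub>v w)))" by (rule c[OF U(2,1,4), symmetric]) (use C Xw in simp)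
      then show "C *\<^sub>v (X *\<^sub>v w) = 0\<^sub>v n" unfolding z using U by auto
    qed (use U in auto)
    also have "\<dots> \<longleftrightarrow> (\<exists>v\<in>carrier_vec m. X *\<^sub>v w = A *\<^sub>v v)" by (rule ker[OF Xw])
    also have "\<dots> \<longleftrightarrow> (\<exists>v\<in>carrier_vec m. w = (W * A * V) *\<^sub>v v)"
    proof
      assume "\<exists>v\<in>carrier_vec m. X *\<^sub>v w = A *\<^sub>v v"
      then obtain v where v: "v \<in> carrier_vec m" "X *\<^sub>v w = A *\<^sub>v v" by blast
      have "w = (W * A * V) *\<^sub>v (V' *\<^sub>v v)"
        using mA[of "V' *\<^sub>v v"] V v c[OF V(1,2,3) v(1)] c[OF W(1,2,3) w] by simp
      then show "\<exists>v\<in>carrier_vec m. w = (W * A * V) *\<^sub>v v" using V v by (intro bexI[of _ "V' *\<^sub>v v"]) auto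
    next
      assume "\<exists>v\<in>carrier_vec m. w = (W * A * V) *\<^sub>v v"
      then obtain v where v: "v \<in> carrier_vec m" "w = (W * A * V) *\<^sub>v v" by blast
      have "X *\<^sub>v w = A *\<^sub>v (V *\<^sub>v v)"
        unfolding v(2) mA[OF v(1)] by (rule c[OF W(2,1,4)]) (use A V v in simp)
      then show "\<exists>v\<in>carrier_vec m. X *\<^sub>v w = A *\<^sub>v v" using V v by (intro bexI[of _ "V *\<^sub>v v"]) auto
    qed
    finally show ?thesis .
  qed
  have "(W * A * V) *\<^sub>v v \<in> carrier_vec N" for v
    by (rule carrier_vecI) (simp only: dim_mult_mat_vec index_mult_mat carrier_matD[OF W(1)])
  then have "(\<lambda>v. (W * A * V) *\<^sub>v v) ` carrier_vec m = {w \<in> carrier_vec N. (U * C * X) *\<^sub>v w = 0\<^sub>v n}"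
    using eq by blast
  moreover have "dim_row (U * C * X) = n" "dim_col (U * C * X) = N" "dim_col (W * A * V) = m"
    by (simp_all only: index_mult_mat carrier_matD[OF W(1)] carrier_matD[OF W(2)] carrier_matD[OF U(1)] carrier_matD[OF V(1)])
  ultimately show ?thesis using inj surj unfolding short_exact_def by (simp only: conj_assoc)
qed

section \<open>Zippers are stable under diagonal changes of basis\<close>

text \<open>The diagonal of \<open>h\<^sub>i\<^sub>-\<^sub>1 \<oplus> h\<^sub>i\<^sub>+\<^sub>1\<close>, acting on the middle term of the sequence.\<close>

definition mid_entries :: "nat list \<Rightarrow> nat \<Rightarrow> (nat \<Rightarrow> nat \<Rightarrow> complex) \<Rightarrow> nat \<Rightarrow> complex" where
  "mid_entries s i e p = (if p < psum s (i - 1) then e (i - 1) p else e (i + 1) (p - psum s (i - 1)))"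

lemma out_map_carrier:
  assumes "B \<in> TV s" "1 \<le> i" "i < length s"
  shows "out_map B i \<in> carrier_mat (psum s (i - 1) + psum s (i + 1)) (psum s i)"
proof -
  have "i - 1 < length s" "Suc (i - 1) = i" using assms by auto
  then show ?thesis
    unfolding out_map_def
    using TV_carrier(2)[OF assms(1), of "i - 1"] TV_carrier(1)[OF assms(1,3)] by (intro carrier_append_rows) simp_all
qed

lemma in_map_carrier:
  assumes "B \<in> TV s" "1 \<le> i" "i < length s"
  shows "in_map B i \<in> carrier_mat (psum s i) (psum s (i - 1) + psum s (i + 1))"
proof -
  have "i - 1 < length s" "Suc (i - 1) = i" using assms by auto
  then show ?thesis
    unfolding in_map_def
    using TV_carrier(1)[OF assms(1), of "i - 1"] TV_carrier(2)[OF assms(1,3)]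
    by (intro carrier_matI) simp_all
qed

lemma out_map_diag_act:
  assumes e: "unit_entries s e" and B: "B \<in> TV s" and i: "1 \<le> i" "i < length s"
  shows "out_map (diag_act s e B) i =
    mat_diag (psum s (i - 1) + psum s (i + 1)) (\<lambda>p. inverse (mid_entries s i e p)) * out_map B i * mat_diag (psum s i) (e i)"
proof -
  let ?C = "diag_act s e B"
  have C: "?C \<in> TV s" unfolding diag_act_def by (rule frame_act_TV[OF frame_diag[OF e] B])
  have i': "i - 1 < length s" "Suc (i - 1) = i" using i by auto
  note car = TV_carrier[OF B i(2)] TV_carrier[OF B i'(1), unfolded i'(2)]
    TV_carrier[OF C i(2)] TV_carrier[OF C i'(1), unfolded i'(2)]
  show ?thesis
    unfolding mat_diag_mult_both[OF out_map_carrier[OF B i]]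
  proof (rule eq_matI)
    fix p q assume "p < dim_row (mat (psum s (i - 1) + psum s (i + 1)) (psum s i)
        (\<lambda>(p, q). inverse (mid_entries s i e p) * out_map B i $$ (p, q) * e i q))"
      "q < dim_col (mat (psum s (i - 1) + psum s (i + 1)) (psum s i)
        (\<lambda>(p, q). inverse (mid_entries s i e p) * out_map B i $$ (p, q) * e i q))"
    then have pq: "p < psum s (i - 1) + psum s (i + 1)" "q < psum s i" by simp_all
    have entry: "out_map D i $$ (p, q) = (if p < psum s (i - 1) then \<beta> D (i - 1) $$ (p, q) else \<alpha> D i $$ (p - psum s (i - 1), q))"
      if "\<alpha> D i \<in> carrier_mat (psum s (Suc i)) (psum s i)" "\<beta> D (i - 1) \<in> carrier_mat (psum s (i - 1)) (psum s i)" for D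
      using that pq by (auto simp: out_map_def append_rows_def)
    show "out_map ?C i $$ (p, q) = mat (psum s (i - 1) + psum s (i + 1)) (psum s i)
        (\<lambda>(p, q). inverse (mid_entries s i e p) * out_map B i $$ (p, q) * e i q) $$ (p, q)"
      using pq entry[of ?C] entry[of B] car diag_act_entries[OF B i(2), of "p - psum s (i - 1)" q e]
        diag_act_entries[OF B i'(1), of p q e] i'
      by (auto simp: mid_entries_def)
  qed (use out_map_carrier[OF C i] in simp_all)
qed

lemma in_map_diag_act:
  assumes e: "unit_entries s e" and B: "B \<in> TV s" and i: "1 \<le> i" "i < length s"
  shows "in_map (diag_act s e B) i =
    mat_diag (psum s i) (\<lambda>p. inverse (e i p)) * in_map B i * mat_diag (psum s (i - 1) + psum s (i + 1)) (mid_entries s i e)"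
proof -
  let ?C = "diag_act s e B"
  have C: "?C \<in> TV s" unfolding diag_act_def by (rule frame_act_TV[OF frame_diag[OF e] B])
  have i': "i - 1 < length s" "Suc (i - 1) = i" using i by auto
  note car = TV_carrier[OF B i(2)] TV_carrier[OF B i'(1), unfolded i'(2)]
    TV_carrier[OF C i(2)] TV_carrier[OF C i'(1), unfolded i'(2)]
  show ?thesis
    unfolding mat_diag_mult_both[OF in_map_carrier[OF B i]]
  proof (rule eq_matI)
    fix p q assume "p < dim_row (mat (psum s i) (psum s (i - 1) + psum s (i + 1))
        (\<lambda>(p, q). inverse (e i p) * in_map B i $$ (p, q) * mid_entries s i e q))"
      "q < dim_col (mat (psum s i) (psum s (i - 1) + psum s (i + 1))
        (\<lambda>(p, q). inverse (e i p) * in_map B i $$ (p, q) * mid_entries s i e q))"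
    then have pq: "q < psum s (i - 1) + psum s (i + 1)" "p < psum s i" by simp_all
    have entry: "in_map D i $$ (p, q) = (if q < psum s (i - 1) then - \<alpha> D (i - 1) $$ (p, q) else \<beta> D i $$ (p, q - psum s (i - 1)))"
      if "\<beta> D i \<in> carrier_mat (psum s i) (psum s (Suc i))" "\<alpha> D (i - 1) \<in> carrier_mat (psum s i) (psum s (i - 1))" for D
      using that pq by (auto simp: in_map_def)
    show "in_map ?C i $$ (p, q) = mat (psum s i) (psum s (i - 1) + psum s (i + 1))
        (\<lambda>(p, q). inverse (e i p) * in_map B i $$ (p, q) * mid_entries s i e q) $$ (p, q)"
      using pq entry[of ?C] entry[of B] car diag_act_entries[OF B i(2), of p "q - psum s (i - 1)" e]
        diag_act_entries[OF B i'(1), of p q e] i'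
      by (auto simp: mid_entries_def)
  qed (use in_map_carrier[OF C i] in simp_all)
qed

lemma psum_swap_adjacent:
  assumes "1 \<le> i" "i < length s" "a \<noteq> i"
  shows "psum (swap_adjacent i s) a = psum s a"
proof -
  obtain j where j: "i = Suc j" using assms by (cases i) auto
  consider "a \<le> j" | "i < a" using assms(3) j by linarith
  then show ?thesis
  proof cases
    case 1
    then show ?thesis by (simp add: psum_def swap_adjacent_def j take_update_cancel)
  next
    case 2
    have "mset (swap_adjacent i (take a s)) = mset (take a s)"
      using 2 assms j mset_swap[of "Suc j" "take a s" j] by (simp add: swap_adjacent_def)
    moreover have "swap_adjacent i (take a s) = take a (swap_adjacent i s)"
      using 2 j by (simp add: swap_adjacent_def take_update_swap)
    ultimately show ?thesis unfolding psum_def by (metis sum_mset_sum_list)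
  qed
qed

lemma diag_frame_conj_scalar:
  assumes M: "M \<in> carrier_mat N N" and w: "\<And>p. p < N \<Longrightarrow> w p \<noteq> (0::complex)"
  shows "mat_diag N (\<lambda>p. inverse (w p)) * (M + c \<cdot>\<^sub>m 1\<^sub>m N) * mat_diag N w =
    mat_diag N (\<lambda>p. inverse (w p)) * M * mat_diag N w + c \<cdot>\<^sub>m 1\<^sub>m N"
proof -
  have M': "M + c \<cdot>\<^sub>m 1\<^sub>m N \<in> carrier_mat N N" using M by simp
  show ?thesis
    unfolding mat_diag_mult_both[OF M] mat_diag_mult_both[OF M']
    by (rule eq_matI) (use M w in \<open>auto simp: algebra_simps\<close>)
qed

lemma prod_lessThan_add: "(\<Prod>p<m + (n::nat). f p) = (\<Prod>p<m. f p) * (\<Prod>p<n. f (m + p) :: 'a :: comm_monoid_mult)"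
  by (induction n) (simp_all add: mult_ac)

text \<open>The hypothesis on \<open>e'\<close> preserves the equality of the two quivers away from \<open>i\<close>, and makes the two changes of basis
  agree on the middle term of the sequence. The third zipper condition is conjugated by this common change of basis,
  under which its scalar term does not move.\<close>

lemma zipper_diag_act:
  assumes Z: "(B, B') \<in> zipper i \<tau> s s'" and i: "1 \<le> i" "i < length s" and s': "s' = swap_adjacent i s"
    and pos: "0 < psum s i"
    and e: "unit_entries s e" and e': "unit_entries s' e'"
    and eq: "\<And>a p. a \<le> length s \<Longrightarrow> a \<noteq> i \<Longrightarrow> p < psum s a \<Longrightarrow> e' a p = e a p"
    and det: "(\<Prod>p<psum s i. e i p) * (\<Prod>p<psum s' i. e' i p) =
      (\<Prod>p<psum s (i - 1). e (i - 1) p) * (\<Prod>p<psum s (i + 1). e (i + 1) p)"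
  shows "(diag_act s e B, diag_act s' e' B') \<in> zipper i \<tau> s s'"
proof -
  have len: "length s' = length s" by (simp add: s' swap_adjacent_def)
  have ps: "psum s' a = psum s a" if "a \<noteq> i" for a
    unfolding s' by (rule psum_swap_adjacent[OF i that])
  have i': "1 \<le> i" "i < length s'" using i len by auto
  have ps1: "psum s' (i - 1) = psum s (i - 1)" "psum s' (i + 1) = psum s (i + 1)" using i by (auto intro!: ps)
  let ?C = "diag_act s e B" and ?C' = "diag_act s' e' B'" and ?N = "psum s (i - 1) + psum s (i + 1)"
  have B: "B \<in> m_inj s" and surj: "surj_mat (in_map B i)" and B': "B' \<in> m_inj s'"
    and c1: "\<And>a. a \<in> {1..<length s} - {i - 1, i} \<Longrightarrow> \<alpha> B a = \<alpha> B' a \<and> \<beta> B a = \<beta> B' a"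
    and ex: "short_exact (out_map B' i) (in_map B i)" and tor: "has_torsion (out_map B' i) (in_map B i) \<tau>"
    and c3: "out_map B' i * in_map B' i = out_map B i * in_map B i + lam s B i \<cdot>\<^sub>m 1\<^sub>m ?N"
    using Z unfolding zipper_def Lambda_surj_def by auto
  have C: "?C \<in> m_inj s" by (rule diag_act_m_inj[OF e B])
  have C': "?C' \<in> m_inj s'" by (rule diag_act_m_inj[OF e' B'])
  define w where "w = mid_entries s i e"
  have w: "w p \<noteq> 0" if "p < ?N" for p
    using that e i by (auto simp: w_def mid_entries_def unit_entries_def)
  have w': "mid_entries s' i e' p = w p" if "p < ?N" for p
    unfolding w_def mid_entries_def ps1
    using that eq[of "i - 1" p] eq[of "i + 1" "p - psum s (i - 1)"] i by auto
  have eiB: "e i p \<noteq> 0" if "p < psum s i" for p using e i that by (simp add: unit_entries_def)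
  have eiB': "e' i p \<noteq> 0" if "p < psum s' i" for p using e' i' that by (simp add: unit_entries_def)
  have prodw: "(\<Prod>p<?N. w p) = (\<Prod>p<psum s (i - 1). e (i - 1) p) * (\<Prod>p<psum s (i + 1). e (i + 1) p)"
  proof -
    have "(\<Prod>p<?N. w p) = (\<Prod>p<psum s (i - 1). w p) * (\<Prod>p<psum s (i + 1). w (psum s (i - 1) + p))"
      by (rule prod_lessThan_add)
    then show ?thesis by (simp add: w_def mid_entries_def)
  qed
  note O = out_map_carrier[OF m_inj_TV[OF B] i] and I = in_map_carrier[OF m_inj_TV[OF B] i]
  note O' = out_map_carrier[OF m_inj_TV[OF B'] i', unfolded ps1] and I' = in_map_carrier[OF m_inj_TV[OF B'] i', unfolded ps1]
  let ?W = "mat_diag ?N (\<lambda>p. inverse (w p))" and ?X = "mat_diag ?N w"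
  let ?U = "mat_diag (psum s i) (\<lambda>p. inverse (e i p))" and ?U' = "mat_diag (psum s i) (e i)"
  let ?V = "mat_diag (psum s' i) (e' i)" and ?V' = "mat_diag (psum s' i) (\<lambda>p. inverse (e' i p))"
  have outC: "out_map ?C i = ?W * out_map B i * ?U'"
    by (simp only: out_map_diag_act[OF e m_inj_TV[OF B] i] w_def)
  have inC: "in_map ?C i = ?U * in_map B i * ?X"
    by (simp only: in_map_diag_act[OF e m_inj_TV[OF B] i] w_def)
  have ww: "mat_diag ?N (mid_entries s' i e') = ?X" "mat_diag ?N (\<lambda>p. inverse (mid_entries s' i e' p)) = ?W"
    by (auto simp: w' intro!: mat_diag_cong)
  have outC': "out_map ?C' i = ?W * out_map B' i * ?V"
    by (simp only: out_map_diag_act[OF e' m_inj_TV[OF B'] i'] ps1 ww)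
  have inC': "in_map ?C' i = ?V' * in_map B' i * ?X"
    by (simp only: in_map_diag_act[OF e' m_inj_TV[OF B'] i'] ps1 ww)
  have WX: "?W * ?X = 1\<^sub>m ?N" "?X * ?W = 1\<^sub>m ?N" using w by (auto intro!: mat_diag_eq_one)
  have UU: "?U * ?U' = 1\<^sub>m (psum s i)" "?U' * ?U = 1\<^sub>m (psum s i)" using eiB by (auto intro!: mat_diag_eq_one)
  have VV: "?V * ?V' = 1\<^sub>m (psum s' i)" "?V' * ?V = 1\<^sub>m (psum s' i)" using eiB' by (auto intro!: mat_diag_eq_one)
  have "short_exact (out_map ?C' i) (in_map ?C i)"
    unfolding outC' inC
    by (rule short_exact_conj[OF O' I ex mat_diag_dim mat_diag_dim WX mat_diag_dim mat_diag_dim VV mat_diag_dim mat_diag_dim UU])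
  moreover have "has_torsion (out_map ?C' i) (in_map ?C i) \<tau>"
    unfolding outC' inC by (rule has_torsion_scale[OF O' I tor eiB w]) (simp_all only: prodw det)
  moreover have "surj_mat (in_map ?C i)"
    unfolding inC by (rule surj_mat_conj[OF I surj mat_diag_dim mat_diag_dim UU(1) mat_diag_dim mat_diag_dim WX(2)])
  moreover have "out_map ?C' i * in_map ?C' i = out_map ?C i * in_map ?C i + lam s ?C i \<cdot>\<^sub>m 1\<^sub>m ?N"
  proof -
    have l: "lam s ?C i = lam s B i"
      unfolding diag_act_def by (rule lam_frame_act[OF frame_diag[OF e] B _ pos]) (use i in simp)
    have "out_map ?C' i * in_map ?C' i = ?W * (out_map B' i * in_map B' i) * ?X"
      unfolding outC' inC' by (rule mult_conj_cancel[OF mat_diag_dim O' mat_diag_dim mat_diag_dim I' mat_diag_dim VV(1)])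
    also have "\<dots> = ?W * (out_map B i * in_map B i) * ?X + lam s B i \<cdot>\<^sub>m 1\<^sub>m ?N"
      unfolding c3 by (rule diag_frame_conj_scalar[OF mult_carrier_mat[OF O I] w])
    also have "?W * (out_map B i * in_map B i) * ?X = out_map ?C i * in_map ?C i"
      unfolding outC inC by (rule mult_conj_cancel[OF mat_diag_dim O mat_diag_dim mat_diag_dim I mat_diag_dim UU(2), symmetric])
    finally show ?thesis unfolding l .
  qed
  moreover have "\<alpha> ?C a = \<alpha> ?C' a \<and> \<beta> ?C a = \<beta> ?C' a" if a: "a \<in> {1..<length s} - {i - 1, i}" for a
  proof -
    have a': "a < length s" "a < length s'" "a \<noteq> i" "Suc a \<noteq> i" using a len by auto
    have d: "mat_diag (psum s b) (e' b) = mat_diag (psum s b) (e b)"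
      "mat_diag (psum s b) (\<lambda>p. inverse (e' b p)) = mat_diag (psum s b) (\<lambda>p. inverse (e b p))"
      if "b \<le> length s" "b \<noteq> i" for b using eq[OF that] by (auto intro!: mat_diag_cong)
    show ?thesis
      unfolding diag_act_def frame_act_nth[OF a'(1)] frame_act_nth[OF a'(2)]
      using c1[OF a] d[of a] d[of "Suc a"] ps[of a] ps[of "Suc a"] a' by simp
  qed
  ultimately show ?thesis
    using C C' unfolding zipper_def Lambda_surj_def by auto
qed

section \<open>The torus action as a diagonal change of basis\<close>

text \<open>The diagonal of \<open>h\<^sub>a\<close>. For \<open>a < k\<close> it is an initial segment of the diagonal of \<open>h\<close>, so one list serves for
  all \<open>a\<close>; for \<open>a = k\<close> the action uses the identity instead.\<close>

definition torus_entries :: "nat list \<Rightarrow> complex list \<Rightarrow> nat \<Rightarrow> nat \<Rightarrow> complex" where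
  "torus_entries s z a p = (if a < length s then concat (map2 replicate s z) ! p else 1)"

lemma mat_diag_add:
  "mat_diag (m + n) f = four_block_mat (mat_diag m f) (0\<^sub>m m n) (0\<^sub>m n m) (mat_diag n (\<lambda>p. f (m + p)))"
  by (rule eq_matI) (auto simp: mat_diag_def)

lemma mat_diag_const: "mat_diag n (\<lambda>_. c) = c \<cdot>\<^sub>m (1\<^sub>m n :: 'a :: semiring_1 mat)"
  by (rule eq_matI) (auto simp: mat_diag_def)

lemma length_concat_replicate:
  "length s = length z \<Longrightarrow> length (concat (map2 replicate s z)) = sum_list s"
  by (induction s z rule: list_induct2) auto

lemma block_scalar_mat_diag:
  assumes "length s = length z"
  shows "block_scalar s z = mat_diag (sum_list s) (\<lambda>p. concat (map2 replicate s z) ! p)"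
  using assms
proof (induction s z rule: list_induct2)
  case Nil
  show ?case by (simp add: block_scalar_def mat_diag_def) (rule eq_matI; simp)
next
  case (Cons m s c z)
  have "block_scalar (m # s) (c # z) = four_block_mat (c \<cdot>\<^sub>m 1\<^sub>m m) (0\<^sub>m m (sum_list s)) (0\<^sub>m (sum_list s) m) (block_scalar s z)"
    unfolding Cons.IH by (simp add: block_scalar_def Let_def Cons.IH[unfolded block_scalar_def] carrier_matD[OF mat_diag_dim])
  also have "c \<cdot>\<^sub>m 1\<^sub>m m = mat_diag m (\<lambda>p. concat (map2 replicate (m # s) (c # z)) ! p)"
    unfolding mat_diag_const[symmetric] by (rule mat_diag_cong) (simp add: nth_append)
  also have "block_scalar s z = mat_diag (sum_list s) (\<lambda>p. concat (map2 replicate (m # s) (c # z)) ! (m + p))"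
    unfolding Cons.IH by (rule mat_diag_cong) (simp add: nth_append)
  finally show ?case by (simp only: mat_diag_add sum_list.Cons)
qed

lemma psum_le: "psum s a \<le> sum_list s"
  unfolding psum_def by (metis append_take_drop_id le_add1 sum_list_append)

lemma nth_concat_take:
  assumes "length s = length z" "p < psum s a"
  shows "concat (map2 replicate (take a s) (take a z)) ! p = concat (map2 replicate s z) ! p"
proof -
  have "concat (map2 replicate s z) = concat (map2 replicate (take a s) (take a z)) @ concat (map2 replicate (drop a s) (drop a z))"
    by (metis append_take_drop_id concat_append drop_zip map_append take_zip)
  then show ?thesis using assms by (simp add: nth_append length_concat_replicate psum_def)
qed

lemma h_mat_eq:
  assumes "length z = length s"
  shows "h_mat s z a = mat_diag (psum s a) (torus_entries s z a)"
  using assms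
  by (auto simp: h_mat_def torus_entries_def block_scalar_mat_diag psum_def[symmetric] nth_concat_take
      intro!: mat_diag_cong mat_diag_eq_one[symmetric])

lemma torus_entries_inverse:
  assumes "length z = length s" "p < psum s a"
  shows "torus_entries s (map inverse z) a p = inverse (torus_entries s z a p)"
proof -
  have "concat (map2 replicate s (map inverse z)) = map inverse (concat (map2 replicate s z))"
    by (simp add: map_concat zip_map2 o_def case_prod_unfold)
  moreover have "p < length (concat (map2 replicate s z))"
    using assms psum_le[of s a] by (simp add: length_concat_replicate)
  ultimately show ?thesis by (simp add: torus_entries_def)
qed

lemma torus_act_quiver_eq:
  assumes "length z = length s"
  shows "torus_act_quiver s B z = diag_act s (torus_entries s z) B"
proof -
  have "h_mat s (map inverse z) a = mat_diag (psum s a) (\<lambda>p. inverse (torus_entries s z a p))" for a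
    using assms by (subst h_mat_eq) (auto simp: torus_entries_inverse intro!: mat_diag_cong)
  then show ?thesis
    using assms by (simp add: torus_act_quiver_def diag_act_def frame_act_def h_mat_eq)
qed

lemma torus_act_eq:
  assumes "length z = length s"
  shows "torus_act s p z = diag_shift s (torus_entries s z) p"
  by (simp add: torus_act_def diag_shift_def spec_map_def pullback_def torus_act_quiver_eq[OF assms])

lemma torus_entries_prod:
  assumes "length z = length s" "a < length s"
  shows "(\<Prod>p<psum s a. torus_entries s z a p) = (\<Prod>b<a. (z ! b) ^ (s ! b))"
proof -
  have *: "(\<Prod>p<sum_list s. concat (map2 replicate s z) ! p) = (\<Prod>b<length s. (z ! b) ^ (s ! b))"
    if "length s = length z" for s and z :: "complex list"
  proof -
    have "(\<Prod>p<sum_list s. concat (map2 replicate s z) ! p) = prod_list (concat (map2 replicate s z))"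
      using length_concat_replicate[OF that] by (simp add: prod.list_conv_set_nth lessThan_atLeast0)
    also have "\<dots> = prod_list (map2 (\<lambda>m c. c ^ m) s z)"
      using that by (induction s z rule: list_induct2) auto
    also have "\<dots> = (\<Prod>b<length s. (z ! b) ^ (s ! b))"
      using that by (simp add: prod.list_conv_set_nth lessThan_atLeast0)
    finally show ?thesis .
  qed
  have "(\<Prod>p<psum s a. torus_entries s z a p) = (\<Prod>p<psum s a. concat (map2 replicate (take a s) (take a z)) ! p)"
    using assms by (intro prod.cong) (auto simp: torus_entries_def nth_concat_take)
  also have "\<dots> = (\<Prod>b<a. (z ! b) ^ (s ! b))"
    unfolding psum_def using assms by (subst *) auto
  finally show ?thesis .
qed

lemma ZL_nonzero:
  assumes "block_sizes n s" "z \<in> ZL s" "c \<in> set z"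
  shows "c \<noteq> 0"
proof
  assume "c = 0"
  then obtain a where a: "a < length s" "z ! a = 0" using assms unfolding ZL_def by (auto simp: in_set_conv_nth)
  then have "0 < s ! a" using assms(1) by (auto simp: block_sizes_def)
  then have "(\<Prod>a<length s. (z ! a) ^ (s ! a)) = 0" using a by (intro prod_zero) auto
  moreover have "(\<Prod>a<length s. (z ! a) ^ (s ! a)) = 1" using assms(2) by (simp add: ZL_def)
  ultimately show False by (metis zero_neq_one)
qed

lemma unit_entries_torus:
  assumes "block_sizes n s" "z \<in> ZL s"
  shows "unit_entries s (torus_entries s z)"
  unfolding unit_entries_def
proof (intro allI impI)
  fix a p assume p: "p < psum s a"
  have len: "length z = length s" using assms(2) by (simp add: ZL_def)
  have "p < length (concat (map2 replicate s z))" using p psum_le[of s a] len by (simp add: length_concat_replicate)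
  then have "concat (map2 replicate s z) ! p \<in> set (concat (map2 replicate s z))" by (rule nth_mem)
  then have "concat (map2 replicate s z) ! p \<in> set z" by (auto dest: set_zip_rightD split: if_splits)
  then show "torus_entries s z a p \<noteq> 0" using ZL_nonzero[OF assms] by (auto simp: torus_entries_def)
qed

section \<open>Interchange of two adjacent blocks\<close>

lemma swap_adjacent_props:
  "length (swap_adjacent i xs) = length xs"
  "1 \<le> i \<Longrightarrow> i < length xs \<Longrightarrow> swap_adjacent i (swap_adjacent i xs) = xs"
  "1 \<le> i \<Longrightarrow> i < length xs \<Longrightarrow> mset (swap_adjacent i xs) = mset xs"
  "1 \<le> i \<Longrightarrow> i < length xs \<Longrightarrow> b < length xs \<Longrightarrow> swap_adjacent i xs ! b = xs ! Transposition.transpose (i - 1) i b"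
  by (auto simp: swap_adjacent_def mset_swap Transposition.transpose_def nth_list_update intro!: nth_equalityI)

lemma block_sizes_swap:
  assumes "block_sizes n s" "1 \<le> i" "i < length s"
  shows "block_sizes n (swap_adjacent i s)"
  using assms swap_adjacent_props(3)[OF assms(2,3)] unfolding block_sizes_def
  by (metis mset_eq_setD sum_mset_sum_list)

lemma prod_swap:
  assumes "1 \<le> i" "i < length s" "length z = length s" "a \<le> length s" "a \<noteq> i"
  shows "(\<Prod>b<a. (swap_adjacent i z ! b) ^ (swap_adjacent i s ! b)) = (\<Prod>b<a. (z ! b :: complex) ^ (s ! b))"
  by (rule prod.reindex_bij_witness[of _ "Transposition.transpose (i - 1) i" "Transposition.transpose (i - 1) i"])
     (use assms in \<open>auto simp: swap_adjacent_props Transposition.transpose_def split: if_splits\<close>)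

lemma ZL_swap:
  assumes "1 \<le> i" "i < length s" "z \<in> ZL s"
  shows "swap_adjacent i z \<in> ZL (swap_adjacent i s)"
  using assms prod_swap[of i s z "length s"] by (simp add: ZL_def swap_adjacent_props)

text \<open>Both sides count the blocks before the \<open>i\<close>th twice and the blocks \<open>i\<close> and \<open>i + 1\<close> once: on the left \<open>h\<^sub>i\<close> ends
  with the one and \<open>\<sigma>\<^sub>i(h)\<^sub>i\<close> with the other, on the right both are in \<open>h\<^sub>i\<^sub>+\<^sub>1\<close>. At the last vertex,
  where \<open>h\<^sub>k\<close> is replaced by the identity, the equation persists because \<open>det h = 1\<close>.\<close>

lemma torus_entries_det:
  assumes i: "1 \<le> i" "i < length s" and z: "z \<in> ZL s"
  shows "(\<Prod>p<psum s i. torus_entries s z i p) *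
      (\<Prod>p<psum (swap_adjacent i s) i. torus_entries (swap_adjacent i s) (swap_adjacent i z) i p) =
    (\<Prod>p<psum s (i - 1). torus_entries s z (i - 1) p) * (\<Prod>p<psum s (i + 1). torus_entries s z (i + 1) p)"
proof -
  obtain j where j: "i = Suc j" using i by (cases i) auto
  have len: "length z = length s" using z by (simp add: ZL_def)
  let ?g = "\<lambda>b. (z ! b) ^ (s ! b)"
  have "(\<Prod>p<psum (swap_adjacent i s) i. torus_entries (swap_adjacent i s) (swap_adjacent i z) i p) =
      (\<Prod>b<j. (swap_adjacent i z ! b) ^ (swap_adjacent i s ! b)) * (swap_adjacent i z ! j) ^ (swap_adjacent i s ! j)"
    using i len by (simp add: torus_entries_prod swap_adjacent_props j)
  also have "(\<Prod>b<j. (swap_adjacent i z ! b) ^ (swap_adjacent i s ! b)) = (\<Prod>b<j. ?g b)"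
    using i len j by (intro prod_swap) auto
  also have "(swap_adjacent i z ! j) ^ (swap_adjacent i s ! j) = ?g i"
    using i len j by (simp add: swap_adjacent_props)
  finally have 1: "(\<Prod>p<psum (swap_adjacent i s) i. torus_entries (swap_adjacent i s) (swap_adjacent i z) i p) =
    (\<Prod>b<j. ?g b) * ?g i" .
  have 2: "(\<Prod>p<psum s (i + 1). torus_entries s z (i + 1) p) = (\<Prod>b<i + 1. ?g b)"
  proof (cases "i + 1 < length s")
    case True
    then show ?thesis by (rule torus_entries_prod[OF len])
  next
    case False
    then have "i + 1 = length s" using i by simp
    then show ?thesis using z by (simp add: torus_entries_def ZL_def)
  qed
  show ?thesis
    unfolding 1 2 using i len j by (simp add: torus_entries_prod mult_ac)
qed

section \<open>Equivariance\<close>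

text \<open>The representative \<open>C'\<close> of \<open>[B']\<cdot>\<sigma>\<^sub>i(h)\<close> is obtained from \<open>B'\<close> by the change of basis \<open>\<sigma>\<^sub>i(h)\<^sub>i\<close> at the
  vertex \<open>i\<close> and \<open>h\<^sub>a\<close> at the vertices \<open>a \<noteq> i\<close>, so that it agrees with \<open>B\<cdot>h\<close> away from \<open>i\<close>. There
  \<open>h\<^sub>a\<close> and \<open>\<sigma>\<^sub>i(h)\<^sub>a\<close> have the same diagonal entries up to order, hence the same determinant.\<close>

lemma zipper_torus:
  assumes bs: "block_sizes n s" and i: "1 \<le> i" "i < length s" and z: "z \<in> ZL s"
    and s': "s' = swap_adjacent i s" and z': "z' = swap_adjacent i z"
    and Z: "(B, B') \<in> zipper i \<tau> s s'"
  obtains C' where "(diag_act s (torus_entries s z) B, C') \<in> zipper i \<tau> s s'"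
    "point s' C' = point s' (diag_act s' (torus_entries s' z') B')"
proof -
  define e where "e = torus_entries s z"
  define e' where "e' = torus_entries s' z'"
  define e'' where "e'' a p = (if a = i then e' a p else e a p)" for a p
  have len: "length z = length s" "length s' = length s" "length z' = length s'"
    using z by (simp_all add: ZL_def s' z' swap_adjacent_props)
  have bs': "block_sizes n s'" unfolding s' by (rule block_sizes_swap[OF bs i])
  have zz: "z' \<in> ZL s'" unfolding s' z' by (rule ZL_swap[OF i z])
  have ps: "psum s' a = psum s a" if "a \<noteq> i" for a unfolding s' by (rule psum_swap_adjacent[OF i that])
  have e: "unit_entries s e" unfolding e_def by (rule unit_entries_torus[OF bs z])
  have e': "unit_entries s' e'" unfolding e'_def by (rule unit_entries_torus[OF bs' zz])
  have e'': "unit_entries s' e''" using e e' ps len unfolding unit_entries_def e''_def by auto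
  have B': "B' \<in> m_inj s'" using Z by (auto simp: zipper_def)
  have pos: "0 < psum s i"
  proof -
    have "s ! 0 \<in> set (take i s)" using i by (auto simp: in_set_conv_nth intro!: exI[of _ 0])
    then have "s ! 0 \<le> psum s i" unfolding psum_def by (rule member_le_sum_list) simp
    moreover have "0 < s ! 0"
    proof -
      have "0 < length s" using i by linarith
      then have "s ! 0 \<in> set s" by (rule nth_mem)
      then show ?thesis using bs by (simp add: block_sizes_def)
    qed
    ultimately show ?thesis by simp
  qed
  have "(diag_act s e B, diag_act s' e'' B') \<in> zipper i \<tau> s s'"
  proof (rule zipper_diag_act[OF Z i s' pos e e''])
    show "(\<Prod>p<psum s i. e i p) * (\<Prod>p<psum s' i. e'' i p) =
        (\<Prod>p<psum s (i - 1). e (i - 1) p) * (\<Prod>p<psum s (i + 1). e (i + 1) p)"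
      unfolding e''_def e_def e'_def s' z' using torus_entries_det[OF i z] by simp
  qed (simp add: e''_def)
  moreover have "point s' (diag_act s' e'' B') = point s' (diag_act s' e' B')"
  proof -
    have key: "f (diag_act s' e'' B') = f (diag_act s' e' B')" if f: "f \<in> carrier (coord_ring s')" for f
    proof (rule coord_ring_diag_act_eq[OF e'' e' f B'])
      fix a assume a: "a < length s'"
      show "(\<Prod>p<psum s' a. e'' a p) = (\<Prod>p<psum s' a. e' a p)"
      proof (cases "a = i")
        case False
        then have "(\<Prod>p<psum s' a. e'' a p) = (\<Prod>p<psum s a. e a p)" by (simp add: e''_def ps)
        also have "\<dots> = (\<Prod>b<a. (z ! b) ^ (s ! b))" unfolding e_def using a len by (intro torus_entries_prod) auto
        also have "\<dots> = (\<Prod>b<a. (z' ! b) ^ (s' ! b))" unfolding s' z' using i len a False by (intro prod_swap[symmetric]) auto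
        also have "\<dots> = (\<Prod>p<psum s' a. e' a p)" unfolding e'_def using a len by (intro torus_entries_prod[symmetric]) auto
        finally show ?thesis .
      qed (simp add: e''_def)
    next
      show "e'' (length s') p = e' (length s') p" for p
        using i len by (simp add: e''_def e_def e'_def torus_entries_def)
    qed
    show ?thesis
      unfolding point_def
    proof (rule Collect_cong, rule conj_cong[OF refl])
      fix f assume f: "f \<in> carrier (coord_ring s')"
      show "f (diag_act s' e'' B') = 0 \<longleftrightarrow> f (diag_act s' e' B') = 0" unfolding key[OF f] ..
    qed
  qed
  ultimately show ?thesis using that unfolding e_def e'_def by blast
qed

text \<open>The conjugate \<open>\<Psi>\<close> of \<open>\<Phi>\<close> by the torus actions is an isomorphism, and compatible with the zipper by the preceding
  lemma; so it is \<open>\<Phi>\<close>.\<close>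

lemma zipper_iso_equivariant:
  assumes bs: "block_sizes n s" and i: "1 \<le> i" "i < length s" and z: "z \<in> ZL s"
    and s': "s' = swap_adjacent i s"
    and \<Phi>: "zipper_iso i \<tau> s s' \<Phi>" and uniq: "\<And>\<Psi>. zipper_iso i \<tau> s s' \<Psi> \<Longrightarrow> \<Psi> = \<Phi>" and p: "p \<in> MP s"
  shows "\<Phi> (torus_act s p z) = torus_act s' (\<Phi> p) (swap_adjacent i z)"
proof -
  define z' where "z' = swap_adjacent i z"
  define e where "e = torus_entries s z"
  define e' where "e' = torus_entries s' z'"
  have zz: "z' \<in> ZL s'" unfolding s' z'_def by (rule ZL_swap[OF i z])
  have len: "length z = length s" "length z' = length s'" using z zz by (simp_all add: ZL_def)
  have e: "unit_entries s e" unfolding e_def by (rule unit_entries_torus[OF bs z])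
  have e': "unit_entries s' e'" unfolding e'_def s' by (rule unit_entries_torus[OF block_sizes_swap[OF bs i] zz[unfolded s']])
  define r where "r a p = inverse (e' a p)" for a p
  have r: "unit_entries s' r" unfolding r_def by (rule unit_entries_inverse[OF e'])
  define \<Psi> where "\<Psi> = (\<lambda>p\<in>MP s. diag_shift s' r (\<Phi> (diag_shift s e p)))"
  obtain \<phi> where \<phi>: "\<phi> \<in> calg_iso (coord_ring s') (coord_ring s)"
    and \<Phi>_eq: "\<Phi> = (\<lambda>p\<in>MP s. spec_map (coord_ring s') \<phi> p)"
    using \<Phi> unfolding zipper_iso_def Spec_iso_alt MP_def by blast
  have \<Phi>_MP: "\<Phi> q \<in> MP s'" if "q \<in> MP s" for q
    using bij_betw_apply[OF Spec_iso_bij[OF cring_coord_ring cring_coord_ring], of \<Phi> s s' q] \<Phi> that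
    by (auto simp: zipper_iso_def MP_def)
  have zB: "B \<in> m_inj s" "B' \<in> m_inj s'" if "(B, B') \<in> zipper i \<tau> s s'" for B B'
    using that by (auto simp: zipper_def Lambda_surj_def)
  have "\<Psi> \<in> Spec_iso (coord_ring s) (coord_ring s')"
  proof -
    let ?\<psi> = "pullback s e \<circ> (\<phi> \<circ> pullback s' r)"
    have 1: "\<phi> \<circ> pullback s' r \<in> calg_iso (coord_ring s') (coord_ring s)"
      by (rule calg_iso_compose[OF pullback_calg_iso[OF r] \<phi>])
    have 2: "?\<psi> \<in> calg_iso (coord_ring s') (coord_ring s)"
      by (rule calg_iso_compose[OF 1 pullback_calg_iso[OF e]])
    have "\<Psi> = (\<lambda>p\<in>MP s. spec_map (coord_ring s') ?\<psi> p)"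
      unfolding \<Psi>_def
    proof (rule restrict_ext)
      fix q assume q: "q \<in> MP s"
      have "diag_shift s' r (\<Phi> (diag_shift s e q)) =
        spec_map (coord_ring s') (pullback s' r) (spec_map (coord_ring s') \<phi> (spec_map (coord_ring s) (pullback s e) q))"
        using diag_shift_MP[OF e q] by (simp add: \<Phi>_eq diag_shift_def)
      also have "\<dots> = spec_map (coord_ring s') ?\<psi> q"
        unfolding spec_map_compose[OF pullback_calg_iso[OF r]] spec_map_compose[OF 1] ..
      finally show "diag_shift s' r (\<Phi> (diag_shift s e q)) = spec_map (coord_ring s') ?\<psi> q" .
    qed
    then show ?thesis unfolding Spec_iso_alt using 2 by (auto simp: MP_def)
  qed
  moreover have "\<Psi> (point s B) = point s' B'" if Z: "(B, B') \<in> zipper i \<tau> s s'" for B B'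
  proof -
    obtain C' where C': "(diag_act s e B, C') \<in> zipper i \<tau> s s'" "point s' C' = point s' (diag_act s' e' B')"
      using zipper_torus[OF bs i z s' z'_def Z] unfolding e_def e'_def by blast
    have "\<Psi> (point s B) = diag_shift s' r (\<Phi> (point s (diag_act s e B)))"
      using point_in_MP[OF zB(1)[OF Z]] by (simp add: \<Psi>_def diag_shift_point[OF e zB(1)[OF Z]])
    also have "\<Phi> (point s (diag_act s e B)) = point s' C'" using \<Phi> C'(1) by (auto simp: zipper_iso_def)
    also have "point s' C' = diag_shift s' e' (point s' B')"
      unfolding C'(2) diag_shift_point[OF e' zB(2)[OF Z]] ..
    also have "diag_shift s' r (diag_shift s' e' (point s' B')) = point s' B'"
      unfolding r_def by (rule diag_shift_inverse(2)[OF e' point_in_MP[OF zB(2)[OF Z]]])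
    finally show ?thesis .
  qed
  ultimately have "\<Psi> = \<Phi>" by (intro uniq) (auto simp: zipper_iso_def)
  then have "\<Phi> p = \<Psi> p" by (simp only:)
  then have "\<Phi> p = diag_shift s' r (\<Phi> (diag_shift s e p))" using p by (simp only: \<Psi>_def restrict_apply')
  then have "diag_shift s' e' (\<Phi> p) = diag_shift s' e' (diag_shift s' r (\<Phi> (diag_shift s e p)))" by (rule arg_cong)
  also have "\<dots> = \<Phi> (diag_shift s e p)"
    unfolding r_def by (rule diag_shift_inverse(1)[OF e' \<Phi>_MP[OF diag_shift_MP[OF e p]]])
  finally show ?thesis
    unfolding torus_act_eq[OF len(1)] torus_act_eq[OF len(2), unfolded z'_def] e_def e'_def z'_def by simp
qed

text \<open>For \<open>s\<^sub>i > s\<^sub>i\<^sub>+\<^sub>1\<close> the equivariance of the functor \<open>\<Psi>\<close> for the opposite pair is read backwards.\<close>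

lemma reflection_functor_equivariant:
  assumes bs: "block_sizes n s" and i: "1 \<le> i" "i < length s" and z: "z \<in> ZL s"
    and s': "s' = swap_adjacent i s" and \<Phi>: "reflection_functor i \<tau> s s' \<Phi>" and p: "p \<in> MP s"
  shows "\<Phi> (torus_act s p z) = torus_act s' (\<Phi> p) (swap_adjacent i z)"
proof (cases "s ! (i - 1) \<le> s ! i")
  case True
  then show ?thesis
    using \<Phi> unfolding reflection_functor_def if_P[OF True]
    by (intro zipper_iso_equivariant[OF bs i z s' _ _ p]) blast+
next
  case False
  from \<Phi> have "\<exists>\<Psi>. zipper_iso i \<tau> s' s \<Psi> \<and> (\<forall>\<Psi>'. zipper_iso i \<tau> s' s \<Psi>' \<longrightarrow> \<Psi>' = \<Psi>) \<and>
      \<Phi> = (\<lambda>p\<in>MP s. inv_into (MP s') \<Psi> p)"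
    unfolding reflection_functor_def if_not_P[OF False] .
  then obtain \<Psi> where \<Psi>: "zipper_iso i \<tau> s' s \<Psi>" "\<And>\<Psi>'. zipper_iso i \<tau> s' s \<Psi>' \<Longrightarrow> \<Psi>' = \<Psi>"
    and \<Phi>_eq: "\<Phi> = (\<lambda>p\<in>MP s. inv_into (MP s') \<Psi> p)" by blast
  let ?z = "swap_adjacent i z"
  have len: "length s' = length s" "length z = length s" using z by (simp_all add: s' swap_adjacent_props ZL_def)
  have i': "i < length s'" using i len by simp
  have s: "s = swap_adjacent i s'" using i by (simp add: s' swap_adjacent_props)
  have zz: "?z \<in> ZL s'" unfolding s' by (rule ZL_swap[OF i z])
  have bs': "block_sizes n s'" unfolding s' by (rule block_sizes_swap[OF bs i])
  have bij: "bij_betw \<Psi> (MP s') (MP s)"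
    using Spec_iso_bij[OF cring_coord_ring cring_coord_ring] \<Psi>(1) by (auto simp: zipper_iso_def MP_def)
  have q: "\<Phi> p \<in> MP s'" "\<Psi> (\<Phi> p) = p"
    using p bij_betw_apply[OF bij_betw_inv_into[OF bij] p] bij_betw_inv_into_right[OF bij p] by (simp_all add: \<Phi>_eq)
  have tq: "torus_act s' (\<Phi> p) ?z \<in> MP s'" and tp: "torus_act s p z \<in> MP s"
    using zz len diag_shift_MP[OF unit_entries_torus[OF bs' zz] q(1)] diag_shift_MP[OF unit_entries_torus[OF bs z] p]
    by (simp_all add: torus_act_eq ZL_def)
  have "\<Psi> (torus_act s' (\<Phi> p) ?z) = torus_act s (\<Psi> (\<Phi> p)) (swap_adjacent i ?z)"
    by (rule zipper_iso_equivariant[OF bs' i(1) i' zz s \<Psi> q(1)])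
  then have "\<Psi> (torus_act s' (\<Phi> p) ?z) = torus_act s p z"
    using q i len by (simp add: swap_adjacent_props)
  then have "\<Phi> (torus_act s p z) = inv_into (MP s') \<Psi> (\<Psi> (torus_act s' (\<Phi> p) ?z))"
    using tp by (simp add: \<Phi>_eq)
  also have "\<dots> = torus_act s' (\<Phi> p) ?z" by (rule bij_betw_inv_into_left[OF bij tq])
  finally show ?thesis .
qed

text \<open>Under the hypothesis \<open>z\<close> and \<open>w\<close> give the same determinants of all \<open>h\<^sub>a\<close>, so their actions on quivers differ by
  gauge transformations.\<close>

lemma torus_act_cong:
  assumes bs: "block_sizes n s" and z: "z \<in> ZL s" and w: "w \<in> ZL s"
    and eq: "\<And>b. b < length s \<Longrightarrow> (z ! b) ^ (s ! b) = (w ! b) ^ (s ! b)"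
  shows "torus_act s p z = torus_act s p w"
proof -
  have len: "length z = length s" "length w = length s" using z w by (simp_all add: ZL_def)
  have "f (diag_act s (torus_entries s z) B) = f (diag_act s (torus_entries s w) B)"
    if "f \<in> carrier (coord_ring s)" "B \<in> m_inj s" for f B
  proof (rule coord_ring_diag_act_eq[OF unit_entries_torus[OF bs z] unit_entries_torus[OF bs w] that])
    fix a assume a: "a < length s"
    have "(\<Prod>b<a. (z ! b) ^ (s ! b)) = (\<Prod>b<a. (w ! b) ^ (s ! b))" using a eq by (intro prod.cong) auto
    then show "(\<Prod>p<psum s a. torus_entries s z a p) = (\<Prod>p<psum s a. torus_entries s w a p)"
      unfolding torus_entries_prod[OF len(1) a] torus_entries_prod[OF len(2) a] .
  qed (simp add: torus_entries_def)
  then have "pullback s (torus_entries s z) f = pullback s (torus_entries s w) f" if "f \<in> carrier (coord_ring s)" for f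
    unfolding pullback_def using that by (intro restrict_ext) auto
  then show ?thesis
    unfolding torus_act_eq[OF len(1)] torus_act_eq[OF len(2)] diag_shift_def spec_map_def by auto
qed

section \<open>The special linear group is perfect\<close>

text \<open>This is \<open>1 + u e\<^sub>j\<^sup>T\<close> for the column vector \<open>u\<close> with its \<open>j\<close>th entry set to 0.\<close>

definition transvection :: "nat \<Rightarrow> nat \<Rightarrow> (nat \<Rightarrow> complex) \<Rightarrow> complex mat" where
  "transvection m j u = mat m m (\<lambda>(p, q). if p = q then 1 else if q = j then u p else 0)"

lemma transvection_carrier: "transvection m j u \<in> carrier_mat m m"
  by (simp add: transvection_def)

lemma transvection_mult_left:
  assumes A: "A \<in> carrier_mat m n" and j: "j < m" and pq: "p < m" "q < n"
  shows "(transvection m j u * A) $$ (p, q) = A $$ (p, q) + (if p = j then 0 else u p * A $$ (j, q))"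
proof -
  have "(transvection m j u * A) $$ (p, q) = (\<Sum>r<m. transvection m j u $$ (p, r) * A $$ (r, q))"
    using A pq by (simp add: transvection_def scalar_prod_def lessThan_atLeast0)
  also have "\<dots> = (\<Sum>r<m. (if r = p then A $$ (p, q) else 0) + (if r = j then (if p = j then 0 else u p * A $$ (j, q)) else 0))"
    using pq by (intro sum.cong) (auto simp: transvection_def)
  also have "\<dots> = A $$ (p, q) + (if p = j then 0 else u p * A $$ (j, q))"
    using pq j by (simp add: sum.distrib)
  finally show ?thesis .
qed

lemma transvection_add:
  assumes "j < m"
  shows "transvection m j u * transvection m j v = transvection m j (\<lambda>p. u p + v p)"
proof (rule eq_matI)
  fix p q assume "p < dim_row (transvection m j (\<lambda>p. u p + v p))" "q < dim_col (transvection m j (\<lambda>p. u p + v p))"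
  then have pq: "p < m" "q < m" by (simp_all add: transvection_def)
  show "(transvection m j u * transvection m j v) $$ (p, q) = transvection m j (\<lambda>p. u p + v p) $$ (p, q)"
    unfolding transvection_mult_left[OF transvection_carrier assms pq]
    using pq assms by (auto simp: transvection_def)
qed (simp_all add: transvection_def)

lemma transvection_zero: "transvection m j (\<lambda>_. 0) = 1\<^sub>m m"
  by (rule eq_matI) (auto simp: transvection_def)

lemma transvection_conj_diag:
  assumes "\<And>p. p < m \<Longrightarrow> d p \<noteq> 0"
  shows "mat_diag m d * transvection m j u * mat_diag m (\<lambda>p. inverse (d p)) = transvection m j (\<lambda>p. d p * u p * inverse (d j))"
  unfolding mat_diag_mult_left[OF transvection_carrier]
  by (subst mat_diag_mult_right[of _ m m]) (use assms in \<open>auto simp: transvection_def intro!: cong_mat\<close>)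

text \<open>Conjugation by a suitable diagonal matrix of determinant 1 multiplies \<open>u\<close> by \<open>2\<^sup>m\<close>. So every
  transvection is the commutator of this diagonal matrix with another transvection; computing the determinant
  of that commutator also shows that transvections have determinant 1.\<close>

lemma transvection_commutator:
  assumes j: "j < m"
  obtains D v where "D \<in> carrier (SL m)" "transvection m j v \<in> carrier (SL m)"
    "transvection m j u \<in> carrier (SL m)"
    "transvection m j u = D * transvection m j v * (inv\<^bsub>SL m\<^esub> D) * (inv\<^bsub>SL m\<^esub> (transvection m j v))"
proof -
  interpret S: group "SL m" by (rule group_SL)
  let ?T = "transvection m j"
  \<comment> \<open>the ratios \<open>d p / d j\<close> with \<open>p \<noteq> j\<close> equal \<open>2\<^sup>m\<close>, and the product of the entries is 1\<close>
  define d :: "nat \<Rightarrow> complex" where "d p = (if p = j then inverse (2 ^ (m - 1)) else 2)" for p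
  let ?D = "mat_diag m d" and ?D' = "mat_diag m (\<lambda>p. inverse (d p))"
  have d0: "d p \<noteq> 0" for p by (simp add: d_def)
  have "(\<Prod>p<m. d p) = d j * (\<Prod>p\<in>{..<m} - {j}. d p)" using j by (intro prod.remove) auto
  also have "(\<Prod>p\<in>{..<m} - {j}. d p) = 2 ^ (m - 1)" using j by (subst prod.cong[of _ "{..<m} - {j}" d "\<lambda>_. 2"]) (auto simp: d_def)
  finally have prod_d: "(\<Prod>p<m. d p) = 1" by (simp add: d_def)
  have prod_d': "(\<Prod>p<m. inverse (d p)) = 1" using prod_d prod_inversef[of d "{..<m}"] by (simp add: o_def)
  have D: "?D \<in> carrier (SL m)" "?D' \<in> carrier (SL m)" using prod_d prod_d' by (simp_all add: SL_def det_mat_diag)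
  have DD: "?D' * ?D = 1\<^sub>m m" using d0 mat_diag_one[of m] by simp
  have invD: "inv\<^bsub>SL m\<^esub> ?D = ?D'" using D DD by (intro S.inv_equality) (simp_all add: SL_def)
  have conj: "?D * ?T w * ?D' = ?T (\<lambda>p. 2 ^ m * w p)" for w
  proof -
    have "(2::complex) * 2 ^ (m - 1) = 2 ^ m" using j by (cases m) auto
    then have "?T (\<lambda>p. d p * w p * inverse (d j)) = ?T (\<lambda>p. 2 ^ m * w p)"
      unfolding transvection_def by (intro cong_mat) (auto simp: d_def)
    then show ?thesis using transvection_conj_diag[of m d j w] d0 by simp
  qed
  have det_scale: "det (?T (\<lambda>p. 2 ^ m * w p)) = det (?T w)" for w
  proof -
    have "det (?D * ?T w * ?D') = det ?D * det (?T w) * det ?D'"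
      by (simp only: det_mult[OF mult_carrier_mat[OF mat_diag_dim transvection_carrier] mat_diag_dim]
          det_mult[OF mat_diag_dim transvection_carrier])
    then show ?thesis unfolding conj by (simp add: det_mat_diag prod_d prod_d')
  qed
  have det_minus: "det (?T w) * det (?T (\<lambda>p. - w p)) = 1" for w
    using transvection_add[OF j, of w "\<lambda>p. - w p"] det_mult[OF transvection_carrier transvection_carrier, of m j w j "\<lambda>p. - w p"]
    by (simp add: transvection_zero)
  have split: "?T (\<lambda>p. 2 ^ m * w p) * ?T (\<lambda>p. - w p) = ?T (\<lambda>p. (2 ^ m - 1) * w p)" for w
    unfolding transvection_add[OF j] by (simp add: algebra_simps)
  have c: "(2 ^ m - 1 :: complex) \<noteq> 0"
  proof
    assume "(2 ^ m - 1 :: complex) = 0"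
    then have "(of_nat (2 ^ m) :: complex) = of_nat 1" by simp
    then have "(2::nat) ^ m = 1" by (simp only: of_nat_eq_iff)
    then show False using j by simp
  qed
  have T_split: "?T w = ?T (\<lambda>p. 2 ^ m * (w p / (2 ^ m - 1))) * ?T (\<lambda>p. - (w p / (2 ^ m - 1)))" for w
    unfolding split using c by simp
  have det_T: "det (?T w) = 1" for w
    unfolding T_split[of w] det_mult[OF transvection_carrier transvection_carrier] det_scale by (rule det_minus)
  then have T: "?T w \<in> carrier (SL m)" for w by (simp add: SL_def transvection_carrier)
  have invT: "inv\<^bsub>SL m\<^esub> (?T w) = ?T (\<lambda>p. - w p)" for w
    using T transvection_add[OF j, of "\<lambda>p. - w p" w] by (intro S.inv_equality) (simp_all add: SL_def transvection_zero)
  define v where "v p = u p / (2 ^ m - 1)" for p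
  have "?T u = ?D * ?T v * (inv\<^bsub>SL m\<^esub> ?D) * (inv\<^bsub>SL m\<^esub> (?T v))"
    unfolding invD invT conj v_def by (rule T_split)
  then show ?thesis using that D T by blast
qed

lemma transvection_in_derived:
  assumes "j < m"
  shows "transvection m j u \<in> derived (SL m) (carrier (SL m))" "transvection m j u \<in> carrier (SL m)"
proof -
  obtain D v where *: "D \<in> carrier (SL m)" "transvection m j v \<in> carrier (SL m)" "transvection m j u \<in> carrier (SL m)"
    "transvection m j u = D * transvection m j v * (inv\<^bsub>SL m\<^esub> D) * (inv\<^bsub>SL m\<^esub> (transvection m j v))"
    using transvection_commutator[OF assms] by metis
  then have "transvection m j u \<in> derived_set (SL m) (carrier (SL m))"
    by (auto simp: SL_def)
  then show "transvection m j u \<in> derived (SL m) (carrier (SL m))"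
    unfolding derived_def by (rule generate.incl)
qed (rule transvection_commutator[OF assms])

text \<open>Gaussian elimination by left multiplication with transvections, where the first \<open>j\<close> columns are already those of
  the identity. If the pivot is 1, it clears its column. A nonzero entry below the pivot serves to make the pivot 1. If
  all entries below are zero, the pivot is nonzero and produces such an entry in the next row; in the last column
  there is no next row, but there the pivot is the determinant.\<close>

lemma SL_elimination:
  assumes N: "subgroup N (SL m)" "\<And>j u. j < m \<Longrightarrow> transvection m j u \<in> N"
    and "A \<in> carrier (SL m)" "j \<le> m" "\<And>p q. p < m \<Longrightarrow> q < j \<Longrightarrow> A $$ (p, q) = (if p = q then 1 else 0)"
  shows "A \<in> N"
  using assms(4,3,5)
proof (induction j arbitrary: A rule: inc_induct)
  case base
  then have "A = 1\<^sub>m m" by (intro eq_matI) (auto simp: SL_def)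
  then show ?case using subgroup.one_closed[OF N(1)] by (simp add: SL_def)
next
  case (step j)
  have j: "j < m" by fact
  have T_carr: "transvection m k u \<in> carrier (SL m)" if "k < m" for k u
    using subgroup.mem_carrier[OF N(1) N(2)[OF that]] .
  have TA_carr: "transvection m k u * M \<in> carrier (SL m)" if "k < m" "M \<in> carrier (SL m)" for k u M
    using T_carr[OF that(1)] that(2) by (auto simp: SL_def det_mult[of _ m] intro!: mult_carrier_mat)
  have cancel: "M \<in> N" if "k < m" "M \<in> carrier (SL m)" "transvection m k u * M \<in> N" for k u M
  proof -
    have "transvection m k (\<lambda>p. - u p) * (transvection m k u * M) \<in> N"
      using subgroup.m_closed[OF N(1) N(2)[OF that(1)] that(3)] by (simp add: SL_def)
    also have "transvection m k (\<lambda>p. - u p) * (transvection m k u * M) =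
        (transvection m k (\<lambda>p. - u p) * transvection m k u) * M"
      using that(2) by (intro assoc_mult_mat[symmetric, of _ m m _ m _ m]) (auto simp: transvection_carrier SL_def)
    also have "\<dots> = M" using that(2) by (auto simp: transvection_add[OF that(1)] transvection_zero SL_def)
    finally show ?thesis .
  qed
  have carr: "M \<in> carrier_mat m m" if "M \<in> carrier (SL m)" for M using that by (simp add: SL_def)
  have pivot_one: "M \<in> N"
    if M: "M \<in> carrier (SL m)" "\<And>p q. p < m \<Longrightarrow> q < j \<Longrightarrow> M $$ (p, q) = (if p = q then 1 else 0)" "M $$ (j, j) = 1" for M
  proof -
    have "transvection m j (\<lambda>p. - M $$ (p, j)) * M \<in> N"
      by (rule step.IH[OF TA_carr[OF j M(1)]])
         (use M j in \<open>auto simp: transvection_mult_left[OF carr[OF M(1)] j] less_Suc_eq\<close>)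
    then show ?thesis by (rule cancel[OF j M(1)])
  qed
  have below: "M \<in> N"
    if M: "M \<in> carrier (SL m)" "\<And>p q. p < m \<Longrightarrow> q < j \<Longrightarrow> M $$ (p, q) = (if p = q then 1 else 0)"
      and k: "j < k" "k < m" "M $$ (k, j) \<noteq> 0" for M k
  proof -
    have "transvection m k (\<lambda>p. if p = j then (1 - M $$ (j, j)) / M $$ (k, j) else 0) * M \<in> N"
      by (rule pivot_one[OF TA_carr[OF k(2) M(1)]])
         (use M j k in \<open>auto simp: transvection_mult_left[OF carr[OF M(1)] k(2)]\<close>)
    then show ?thesis by (rule cancel[OF k(2) M(1)])
  qed
  note A = step.prems
  have A_carr: "A \<in> carrier_mat m m" and det_A: "det A = 1" using A(1) by (auto simp: SL_def)
  show ?case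
  proof (cases "\<exists>k. j < k \<and> k < m \<and> A $$ (k, j) \<noteq> 0")
    case True
    then show ?thesis using below[OF A] by blast
  next
    case False
    then have zero: "A $$ (k, j) = 0" if "j < k" "k < m" for k using that by blast
    show ?thesis
    proof (cases "Suc j < m")
      case True
      have "A $$ (j, j) \<noteq> 0"
      proof
        assume piv: "A $$ (j, j) = 0"
        \<comment> \<open>then column \<open>j\<close> is a combination of the unit vectors in the columns before it\<close>
        define v where "v = vec m (\<lambda>p. if p = j then 1 else if p < j then - A $$ (p, j) else 0)"
        have v: "v \<in> carrier_vec m" "v $ j = 1" using j by (auto simp: v_def)
        have "(A *\<^sub>v v) $ p = 0" if p: "p < m" for p
        proof -
          have "(A *\<^sub>v v) $ p = (\<Sum>q<m. A $$ (p, q) * v $ q)"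
            using A_carr p v by (simp add: scalar_prod_def lessThan_atLeast0)
          also have "\<dots> = (\<Sum>q<m. (if q = j then A $$ (p, j) else 0) + (if q = p then (if p < j then - A $$ (p, j) else 0) else 0))"
            using p A(2) by (intro sum.cong) (auto simp: v_def)
          also have "\<dots> = A $$ (p, j) + (if p < j then - A $$ (p, j) else 0)"
            using p j by (simp add: sum.distrib)
          also have "\<dots> = 0" using zero[of p] piv p by (cases p j rule: linorder_cases) auto
          finally show ?thesis .
        qed
        then have "A *\<^sub>v v = 0\<^sub>v m" using A_carr by (intro eq_vecI) auto
        moreover have "v \<noteq> 0\<^sub>v m" using v j by auto
        ultimately have "det A = 0" using det_0_iff_vec_prod_zero[OF A_carr] v by blast
        then show False using det_A by simp
      qed
      then have "transvection m j (\<lambda>p. if p = Suc j then 1 else 0) * A \<in> N"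
        using A j True zero[of "Suc j"]
        by (intro below[OF TA_carr[OF j A(1)], where k = "Suc j"]) (auto simp: transvection_mult_left[OF A_carr j])
      then show ?thesis by (rule cancel[OF j A(1)])
    next
      case False
      then have jm: "m = Suc j" using j by simp
      have "upper_triangular A" using A(2) A_carr jm by (auto simp: upper_triangular_def)
      then have "det A = (\<Prod>p<m. A $$ (p, p))"
        using det_upper_triangular[OF _ A_carr] A_carr
        by (simp add: diag_mat_def prod.list_conv_set_nth lessThan_atLeast0)
      also have "\<dots> = A $$ (j, j)" using A(2) by (simp add: jm)
      finally show ?thesis using pivot_one[OF A] det_A by simp
    qed
  qed
qed

lemma derived_SL: "derived (SL m) (carrier (SL m)) = carrier (SL m)"
proof
  show "derived (SL m) (carrier (SL m)) \<subseteq> carrier (SL m)"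
    by (rule group.derived_in_carrier[OF group_SL]) simp
  have "subgroup (derived (SL m) (carrier (SL m))) (SL m)"
    by (rule group.derived_is_subgroup[OF group_SL]) simp
  then show "carrier (SL m) \<subseteq> derived (SL m) (carrier (SL m))"
    using SL_elimination[of "derived (SL m) (carrier (SL m))" m _ 0] transvection_in_derived by blast
qed

section \<open>Block diagonal matrices\<close>

definition blocks :: "nat list \<Rightarrow> complex mat list set" where
  "blocks s = {As. list_all2 (\<lambda>A m. A \<in> carrier_mat m m) As s}"

lemma blocks_nth: "As \<in> blocks s \<longleftrightarrow> length As = length s \<and> (\<forall>b<length s. As ! b \<in> carrier_mat (s ! b) (s ! b))"
  by (auto simp: blocks_def list_all2_conv_all_nth)

lemma blocks_induct [consumes 1, case_names Nil Cons]:
  assumes "As \<in> blocks s" and "P [] []"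
    and "\<And>A m As s. A \<in> carrier_mat m m \<Longrightarrow> As \<in> blocks s \<Longrightarrow> P As s \<Longrightarrow> P (A # As) (m # s)"
  shows "P As s"
proof -
  have "list_all2 (\<lambda>A m. A \<in> carrier_mat m m) As s" using assms(1) by (simp add: blocks_def)
  then show ?thesis by (induction rule: list_all2_induct) (use assms in \<open>auto simp: blocks_def\<close>)
qed

lemma diag_block_mat_carrier:
  assumes "As \<in> blocks s"
  shows "diag_block_mat As \<in> carrier_mat (sum_list s) (sum_list s)"
  using assms by (induction rule: blocks_induct) (auto simp: Let_def)

lemma diag_block_mat_Cons_eq:
  assumes "A \<in> carrier_mat m m" "As \<in> blocks s"
  shows "diag_block_mat (A # As) =
    four_block_mat A (0\<^sub>m m (sum_list s)) (0\<^sub>m (sum_list s) m) (diag_block_mat As)"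
  using assms diag_block_mat_carrier[OF assms(2)] by (auto simp: Let_def)

lemma blocks_mult:
  assumes "As \<in> blocks s" "Bs \<in> blocks s"
  shows "map2 (*) As Bs \<in> blocks s"
  using assms by (auto simp: blocks_nth intro!: mult_carrier_mat)

lemma diag_block_mat_mult:
  assumes "As \<in> blocks s" "Bs \<in> blocks s"
  shows "diag_block_mat As * diag_block_mat Bs = diag_block_mat (map2 (*) As Bs)"
  using assms
proof (induction arbitrary: Bs rule: blocks_induct)
  case Nil
  then show ?case by (simp add: blocks_nth)
next
  case (Cons A m As s)
  then obtain B Bs' where Bs: "Bs = B # Bs'" "B \<in> carrier_mat m m" "Bs' \<in> blocks s"
    by (cases Bs) (auto simp: blocks_def)
  note D = diag_block_mat_carrier[OF Cons.hyps(2)] diag_block_mat_carrier[OF Bs(3)]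
  show ?case
    unfolding Bs(1) diag_block_mat_Cons_eq[OF Cons.hyps(1,2)] diag_block_mat_Cons_eq[OF Bs(2,3)] list.map zip_Cons_Cons
      prod.case diag_block_mat_Cons_eq[OF mult_carrier_mat[OF Cons.hyps(1) Bs(2)] blocks_mult[OF Cons.hyps(2) Bs(3)]]
    using Cons.hyps Bs D Cons.IH[OF Bs(3)] diag_block_mat_carrier[OF blocks_mult[OF Cons.hyps(2) Bs(3)]]
    by (subst mult_four_block_mat[OF Cons.hyps(1) zero_carrier_mat zero_carrier_mat D(1) Bs(2) zero_carrier_mat zero_carrier_mat D(2)])
       (simp add: left_add_zero_mat[of _ m m] right_add_zero_mat[of _ m m])
qed

lemma det_diag_block_mat:
  assumes "As \<in> blocks s"
  shows "det (diag_block_mat As) = prod_list (map det As)"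
  using assms
proof (induction rule: blocks_induct)
  case (Cons A m As s)
  then show ?case
    unfolding diag_block_mat_Cons_eq[OF Cons.hyps(1,2)]
    by (subst det_four_block_mat_upper_right_zero[OF Cons.hyps(1) refl zero_carrier_mat diag_block_mat_carrier[OF Cons.hyps(2)]]) simp
qed simp

lemma diag_block_mat_inj:
  assumes "As \<in> blocks s" "Bs \<in> blocks s" "diag_block_mat As = diag_block_mat Bs"
  shows "As = Bs"
  using assms
proof (induction arbitrary: Bs rule: blocks_induct)
  case Nil
  then show ?case by (simp add: blocks_nth)
next
  case (Cons A m As s)
  then obtain B Bs' where Bs: "Bs = B # Bs'" "B \<in> carrier_mat m m" "Bs' \<in> blocks s"
    by (cases Bs) (auto simp: blocks_def)
  note D = diag_block_mat_carrier[OF Cons.hyps(2)] diag_block_mat_carrier[OF Bs(3)]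
  note eq = Cons.prems(2)[unfolded Bs(1) diag_block_mat_Cons_eq[OF Cons.hyps(1,2)] diag_block_mat_Cons_eq[OF Bs(2,3)]]
  have "A $$ (p, q) = B $$ (p, q)" if "p < m" "q < m" for p q
    using arg_cong[OF eq, of "\<lambda>M. M $$ (p, q)"] that Cons.hyps(1) Bs(2) D by simp
  moreover have "diag_block_mat As $$ (p, q) = diag_block_mat Bs' $$ (p, q)" if "p < sum_list s" "q < sum_list s" for p q
    using arg_cong[OF eq, of "\<lambda>M. M $$ (m + p, m + q)"] that Cons.hyps(1) Bs(2) D by simp
  ultimately have "A = B" "diag_block_mat As = diag_block_mat Bs'"
    using Cons.hyps(1) Bs(2) D by (auto intro!: eq_matI)
  then show ?case using Cons.IH[OF Bs(3)] Bs(1) by simp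
qed

lemma diag_block_mat_one: "diag_block_mat (map (\<lambda>m. 1\<^sub>m m) s) = (1\<^sub>m (sum_list s) :: complex mat)"
  using diag_block_one_mat[of "map (\<lambda>m. 1\<^sub>m m :: complex mat) s"] by (simp add: o_def)

lemma blocks_one: "map (\<lambda>m. 1\<^sub>m m) s \<in> blocks s"
  by (simp add: blocks_nth)

section \<open>The Levi subgroup and its abelianization\<close>

lemma levi_carrier: "carrier (levi s) = {diag_block_mat As | As. As \<in> blocks s \<and> det (diag_block_mat As) = 1}"
  by (simp add: levi_def blocks_def)

lemma levi_ops: "x \<otimes>\<^bsub>levi s\<^esub> y = x * y" "\<one>\<^bsub>levi s\<^esub> = 1\<^sub>m (sum_list s)"
  by (simp_all add: levi_def SL_def)

definition inv_blocks :: "complex mat list \<Rightarrow> complex mat list" where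
  "inv_blocks As = map (\<lambda>A. inverse (det A) \<cdot>\<^sub>m adj_mat A) As"

lemma inv_blocks:
  assumes "As \<in> blocks s" "\<forall>A\<in>set As. det A \<noteq> 0"
  shows "inv_blocks As \<in> blocks s" "map2 (*) (inv_blocks As) As = map (\<lambda>m. 1\<^sub>m m) s"
    "b < length s \<Longrightarrow> det (inv_blocks As ! b) = inverse (det (As ! b))"
proof -
  have len: "length As = length s" using assms(1) by (simp add: blocks_nth)
  have nth: "inv_blocks As ! b \<in> carrier_mat (s ! b) (s ! b)" "inv_blocks As ! b * As ! b = 1\<^sub>m (s ! b)" if "b < length s" for b
  proof -
    have A: "As ! b \<in> carrier_mat (s ! b) (s ! b)" "det (As ! b) \<noteq> 0"
      using assms that len by (auto simp: blocks_nth)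
    show "inv_blocks As ! b \<in> carrier_mat (s ! b) (s ! b)"
      using adj_mat(1)[OF A(1)] that len by (simp add: inv_blocks_def)
    have "inverse (det (As ! b)) \<cdot>\<^sub>m adj_mat (As ! b) * As ! b = inverse (det (As ! b)) \<cdot>\<^sub>m (adj_mat (As ! b) * As ! b)"
      using adj_mat(1)[OF A(1)] A(1) by (rule mult_smult_assoc_mat)
    also have "\<dots> = 1\<^sub>m (s ! b)" unfolding adj_mat(3)[OF A(1)] using A(2) by (intro eq_matI) auto
    finally show "inv_blocks As ! b * As ! b = 1\<^sub>m (s ! b)" using that len by (simp add: inv_blocks_def)
  qed
  show "inv_blocks As \<in> blocks s" using nth(1) len by (simp add: blocks_nth inv_blocks_def)
  show "map2 (*) (inv_blocks As) As = map (\<lambda>m. 1\<^sub>m m) s"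
    using nth(2) len by (intro nth_equalityI) (auto simp: inv_blocks_def)
  assume b: "b < length s"
  have "det (inv_blocks As ! b) * det (As ! b) = 1"
    using nth[OF b] assms(1) b det_mult[of "inv_blocks As ! b" "s ! b" "As ! b"] by (simp add: blocks_nth)
  then show "det (inv_blocks As ! b) = inverse (det (As ! b))" by (metis inverse_unique mult.commute)
qed

lemma inv_blocks_mult:
  assumes "As \<in> blocks s" "\<forall>A\<in>set As. det A \<noteq> 0"
  shows "diag_block_mat (inv_blocks As) * diag_block_mat As = 1\<^sub>m (sum_list s)"
proof -
  have "diag_block_mat (inv_blocks As) * diag_block_mat As = diag_block_mat (map2 (*) (inv_blocks As) As)"
    by (rule diag_block_mat_mult[OF inv_blocks(1)[OF assms] assms(1)])
  also have "map2 (*) (inv_blocks As) As = map (\<lambda>m. 1\<^sub>m m) s" by (rule inv_blocks(2)[OF assms])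
  finally show ?thesis by (simp only: diag_block_mat_one)
qed

lemma prod_list_all_one: "(\<And>x. x \<in> set xs \<Longrightarrow> x = 1) \<Longrightarrow> prod_list xs = (1 :: 'a :: comm_monoid_mult)"
  by (induction xs) auto

lemma levi_blocks_nonzero:
  assumes "As \<in> blocks s" "det (diag_block_mat As) = 1"
  shows "\<forall>A\<in>set As. det A \<noteq> 0"
proof -
  have "0 \<notin> set (map det As)"
    using assms(2) det_diag_block_mat[OF assms(1)] prod_list_zero_iff[of "map det As"] by auto
  then show ?thesis by force
qed

lemma group_levi: "group (levi s)"
proof (rule groupI)
  fix x y assume "x \<in> carrier (levi s)" "y \<in> carrier (levi s)"
  then obtain As Bs where *: "x = diag_block_mat As" "As \<in> blocks s" "det x = 1" "y = diag_block_mat Bs" "Bs \<in> blocks s" "det y = 1"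
    unfolding levi_carrier by blast
  then have "det (x * y) = 1" using det_mult[of x "sum_list s" y] diag_block_mat_carrier by simp
  moreover have "x * y = diag_block_mat (map2 (*) As Bs)" using diag_block_mat_mult[OF *(2,5)] * by simp
  ultimately show "x \<otimes>\<^bsub>levi s\<^esub> y \<in> carrier (levi s)"
    unfolding levi_carrier levi_ops using blocks_mult[OF *(2,5)] by auto
next
  show "\<one>\<^bsub>levi s\<^esub> \<in> carrier (levi s)"
    unfolding levi_carrier levi_ops using blocks_one diag_block_mat_one[of s, symmetric]
    by (intro CollectI exI[of _ "map (\<lambda>m. 1\<^sub>m m) s"]) (auto simp: diag_block_mat_one)
next
  fix x y z assume "x \<in> carrier (levi s)" "y \<in> carrier (levi s)" "z \<in> carrier (levi s)"
  then have "x \<in> carrier_mat (sum_list s) (sum_list s)" "y \<in> carrier_mat (sum_list s) (sum_list s)" "z \<in> carrier_mat (sum_list s) (sum_list s)"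
    unfolding levi_carrier using diag_block_mat_carrier by auto
  then show "x \<otimes>\<^bsub>levi s\<^esub> y \<otimes>\<^bsub>levi s\<^esub> z = x \<otimes>\<^bsub>levi s\<^esub> (y \<otimes>\<^bsub>levi s\<^esub> z)"
    unfolding levi_ops by (rule assoc_mult_mat)
next
  fix x assume "x \<in> carrier (levi s)"
  then obtain As where *: "x = diag_block_mat As" "As \<in> blocks s" "det x = 1" unfolding levi_carrier by blast
  then have x: "x \<in> carrier_mat (sum_list s) (sum_list s)" using diag_block_mat_carrier by simp
  then show "\<one>\<^bsub>levi s\<^esub> \<otimes>\<^bsub>levi s\<^esub> x = x" unfolding levi_ops by simp
  have nz: "\<forall>A\<in>set As. det A \<noteq> 0" using * levi_blocks_nonzero by blast
  note inv = inv_blocks[OF *(2) nz]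
  have 1: "diag_block_mat (inv_blocks As) * x = 1\<^sub>m (sum_list s)"
    unfolding *(1) by (rule inv_blocks_mult[OF *(2) nz])
  have "det (diag_block_mat (inv_blocks As)) * det x = 1"
    using det_mult[OF diag_block_mat_carrier[OF inv(1)] x] 1 by simp
  then have "diag_block_mat (inv_blocks As) \<in> carrier (levi s)" unfolding levi_carrier using inv(1) *(3) by auto
  then show "\<exists>y\<in>carrier (levi s). y \<otimes>\<^bsub>levi s\<^esub> x = \<one>\<^bsub>levi s\<^esub>" unfolding levi_ops using 1 by blast
qed

lemma levi_inv:
  assumes "As \<in> blocks s" "det (diag_block_mat As) = 1"
  shows "inv\<^bsub>levi s\<^esub> (diag_block_mat As) = diag_block_mat (inv_blocks As)"
proof (rule group.inv_equality[OF group_levi])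
  have nz: "\<forall>A\<in>set As. det A \<noteq> 0" using assms levi_blocks_nonzero by blast
  note inv = inv_blocks[OF assms(1) nz]
  show 1: "diag_block_mat (inv_blocks As) \<otimes>\<^bsub>levi s\<^esub> diag_block_mat As = \<one>\<^bsub>levi s\<^esub>"
    unfolding levi_ops by (rule inv_blocks_mult[OF assms(1) nz])
  show "diag_block_mat As \<in> carrier (levi s)" unfolding levi_carrier using assms by blast
  have "det (diag_block_mat (inv_blocks As)) * det (diag_block_mat As) = 1"
    using det_mult[OF diag_block_mat_carrier[OF inv(1)] diag_block_mat_carrier[OF assms(1)]] 1[unfolded levi_ops] by simp
  then show "diag_block_mat (inv_blocks As) \<in> carrier (levi s)" unfolding levi_carrier using inv(1) assms(2) by auto
qed

definition block_embed :: "nat list \<Rightarrow> nat \<Rightarrow> complex mat \<Rightarrow> complex mat" where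
  "block_embed s b A = diag_block_mat ((map (\<lambda>m. 1\<^sub>m m) s)[b := A])"

lemma block_embed_blocks:
  assumes "A \<in> carrier_mat (s ! b) (s ! b)"
  shows "(map (\<lambda>m. 1\<^sub>m m) s)[b := A] \<in> blocks s"
proof -
  have "(map (\<lambda>m. 1\<^sub>m m) s)[b := A] ! c \<in> carrier_mat (s ! c) (s ! c)" if "c < length s" for c
    using that assms by (cases "c = b") auto
  then show ?thesis by (simp add: blocks_nth)
qed

lemma block_embed_hom:
  assumes b: "b < length s"
  shows "group_hom (SL (s ! b)) (levi s) (block_embed s b)"
proof (intro group_hom.intro group_hom_axioms.intro group_SL group_levi homI)
  fix A assume A: "A \<in> carrier (SL (s ! b))"
  then have bl: "(map (\<lambda>m. 1\<^sub>m m) s)[b := A] \<in> blocks s" by (intro block_embed_blocks) (simp add: SL_def)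
  have "prod_list (map det ((map (\<lambda>m. 1\<^sub>m m) s)[b := A])) = 1"
    using A by (intro prod_list_all_one) (auto simp: SL_def dest!: subsetD[OF set_update_subset_insert])
  then show "block_embed s b A \<in> carrier (levi s)"
    unfolding levi_carrier block_embed_def using bl det_diag_block_mat[OF bl] by auto
next
  fix A B assume A: "A \<in> carrier (SL (s ! b))" and B: "B \<in> carrier (SL (s ! b))"
  then have bl: "(map (\<lambda>m. 1\<^sub>m m) s)[b := A] \<in> blocks s" "(map (\<lambda>m. 1\<^sub>m m) s)[b := B] \<in> blocks s"
    by (auto intro!: block_embed_blocks simp: SL_def)
  have "map2 (*) ((map (\<lambda>m. 1\<^sub>m m) s)[b := A]) ((map (\<lambda>m. 1\<^sub>m m) s)[b := B]) = (map (\<lambda>m. 1\<^sub>m m) s)[b := A * B]"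
    using b by (intro nth_equalityI) (auto simp: nth_list_update)
  then show "block_embed s b (A \<otimes>\<^bsub>SL (s ! b)\<^esub> B) = block_embed s b A \<otimes>\<^bsub>levi s\<^esub> block_embed s b B"
    unfolding levi_ops block_embed_def diag_block_mat_mult[OF bl] by (simp add: SL_def)
qed

lemma block_embed_derived:
  assumes "b < length s" "A \<in> carrier_mat (s ! b) (s ! b)" "det A = 1"
  shows "block_embed s b A \<in> derived (levi s) (carrier (levi s))"
proof -
  interpret h: group_hom "SL (s ! b)" "levi s" "block_embed s b" by (rule block_embed_hom[OF assms(1)])
  have "block_embed s b A \<in> block_embed s b ` derived (SL (s ! b)) (carrier (SL (s ! b)))"
    unfolding derived_SL using assms by (simp add: SL_def)
  also have "\<dots> = derived (levi s) (block_embed s b ` carrier (SL (s ! b)))"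
    by (rule h.derived_img[symmetric]) simp
  also have "\<dots> \<subseteq> derived (levi s) (carrier (levi s))"
    by (rule group.mono_derived[OF group_levi]) auto
  finally show ?thesis .
qed

text \<open>The matrix is the product of its blocks, each embedded as a perfect subgroup \<open>SL\<^sub>s\<^sub>b\<close>; the blocks are put in one
  after the other.\<close>

lemma derived_levi_supset:
  assumes As: "As \<in> blocks s" and det: "\<And>b. b < length s \<Longrightarrow> det (As ! b) = 1"
  shows "diag_block_mat As \<in> derived (levi s) (carrier (levi s))"
proof -
  let ?D = "derived (levi s) (carrier (levi s))" and ?ones = "map (\<lambda>m. 1\<^sub>m m) s :: complex mat list"
  have sub: "subgroup ?D (levi s)" by (rule group.derived_is_subgroup[OF group_levi]) simp
  have len: "length As = length s" using As by (simp add: blocks_nth)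
  have "diag_block_mat (take a As @ drop a ?ones) \<in> ?D" if "a \<le> length s" for a
    using that
  proof (induction a)
    case 0
    then show ?case using subgroup.one_closed[OF sub] by (simp add: levi_ops diag_block_mat_one)
  next
    case (Suc a)
    have A: "As ! a \<in> carrier_mat (s ! a) (s ! a)" using As Suc.prems by (simp add: blocks_nth)
    have bl: "take a As @ drop a ?ones \<in> blocks s" using As Suc.prems len by (auto simp: blocks_nth nth_append)
    have eq: "map2 (*) (take a As @ drop a ?ones) (?ones[a := As ! a]) = take (Suc a) As @ drop (Suc a) ?ones" (is "?L = ?R")
    proof (rule nth_equalityI)
      show "length ?L = length ?R" using Suc.prems len by simp
      fix b assume "b < length ?L"
      then have b: "b < length s" using Suc.prems len by simp
      have "As ! b \<in> carrier_mat (s ! b) (s ! b)" using As b by (simp add: blocks_nth)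
      then show "?L ! b = ?R ! b" using b Suc.prems len by (auto simp: nth_append nth_list_update less_Suc_eq)
    qed
    have "diag_block_mat (take a As @ drop a ?ones) * block_embed s a (As ! a) \<in> ?D"
      using subgroup.m_closed[OF sub Suc.IH block_embed_derived[OF _ A det]] Suc.prems by (simp add: levi_ops)
    then show ?case unfolding block_embed_def diag_block_mat_mult[OF bl block_embed_blocks[OF A]] eq .
  qed
  from this[of "length s"] show ?thesis using len by simp
qed

text \<open>The determinant of a block is a homomorphism to a commutative group, so it is 1 on commutators.\<close>

lemma derived_levi_subset:
  "derived (levi s) (carrier (levi s)) \<subseteq> {diag_block_mat As | As. As \<in> blocks s \<and> (\<forall>b<length s. det (As ! b) = 1)}"
    (is "_ \<subseteq> ?K")
proof -
  have K_levi: "As \<in> blocks s \<Longrightarrow> \<forall>b<length s. det (As ! b) = 1 \<Longrightarrow> det (diag_block_mat As) = 1" for As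
    by (subst det_diag_block_mat) (auto simp: blocks_nth in_set_conv_nth intro!: prod_list_all_one)
  have det_mul: "det (map2 (*) As Bs ! b) = det (As ! b) * det (Bs ! b)"
    if "As \<in> blocks s" "Bs \<in> blocks s" "b < length s" for As Bs b
    using that by (auto simp: blocks_nth det_mult[of _ "s ! b"])
  note nz = levi_blocks_nonzero
  have "subgroup ?K (levi s)"
  proof (rule group.subgroupI[OF group_levi])
    show "?K \<subseteq> carrier (levi s)" unfolding levi_carrier using K_levi by blast
    have "diag_block_mat (map (\<lambda>m. 1\<^sub>m m) s) \<in> ?K" using blocks_one by force
    then show "?K \<noteq> {}" by blast
  next
    fix x assume "x \<in> ?K"
    then obtain As where *: "x = diag_block_mat As" "As \<in> blocks s" "\<forall>b<length s. det (As ! b) = 1" by blast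
    note inv = inv_blocks[OF *(2) nz[OF *(2) K_levi[OF *(2,3)]]]
    show "inv\<^bsub>levi s\<^esub> x \<in> ?K"
      unfolding *(1) levi_inv[OF *(2) K_levi[OF *(2,3)]] using inv(1,3) *(3) by auto
  next
    fix x y assume "x \<in> ?K" "y \<in> ?K"
    then obtain As Bs where *: "x = diag_block_mat As" "As \<in> blocks s" "\<forall>b<length s. det (As ! b) = 1"
      "y = diag_block_mat Bs" "Bs \<in> blocks s" "\<forall>b<length s. det (Bs ! b) = 1" by blast
    have "x \<otimes>\<^bsub>levi s\<^esub> y = diag_block_mat (map2 (*) As Bs)"
      unfolding levi_ops *(1,4) by (rule diag_block_mat_mult[OF *(2,5)])
    moreover have "\<forall>b<length s. det (map2 (*) As Bs ! b) = 1" using det_mul[OF *(2,5)] *(3,6) by simp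
    ultimately show "x \<otimes>\<^bsub>levi s\<^esub> y \<in> ?K" using blocks_mult[OF *(2,5)] by blast
  qed
  moreover have "derived_set (levi s) (carrier (levi s)) \<subseteq> ?K"
  proof (clarsimp simp only: UN_iff singleton_iff subset_iff)
    fix x y assume "x \<in> carrier (levi s)" "y \<in> carrier (levi s)"
    then obtain As Bs where *: "x = diag_block_mat As" "As \<in> blocks s" "det (diag_block_mat As) = 1"
      "y = diag_block_mat Bs" "Bs \<in> blocks s" "det (diag_block_mat Bs) = 1" unfolding levi_carrier by auto
    note iA = inv_blocks[OF *(2) nz[OF *(2,3)]] and iB = inv_blocks[OF *(5) nz[OF *(5,6)]]
    note AB = blocks_mult[OF *(2,5)]
    note ABA = blocks_mult[OF AB iA(1)]
    note ABAB = blocks_mult[OF ABA iB(1)]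
    let ?C = "map2 (*) (map2 (*) (map2 (*) As Bs) (inv_blocks As)) (inv_blocks Bs)"
    have eq: "x \<otimes>\<^bsub>levi s\<^esub> y \<otimes>\<^bsub>levi s\<^esub> inv\<^bsub>levi s\<^esub> x \<otimes>\<^bsub>levi s\<^esub> inv\<^bsub>levi s\<^esub> y = diag_block_mat ?C"
      unfolding *(1,4) levi_inv[OF *(2,3)] levi_inv[OF *(5,6)] levi_ops
      by (simp only: diag_block_mat_mult[OF *(2,5)] diag_block_mat_mult[OF AB iA(1)] diag_block_mat_mult[OF ABA iB(1)])
    have "det (?C ! b) = 1" if b: "b < length s" for b
    proof -
      have len: "length As = length s" "length Bs = length s" using *(2,5) by (auto simp: blocks_nth)
      have "det (As ! b) \<noteq> 0" "det (Bs ! b) \<noteq> 0" using nz[OF *(2,3)] nz[OF *(5,6)] b len by auto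
      moreover have "det (?C ! b) = det (As ! b) * det (Bs ! b) * inverse (det (As ! b)) * inverse (det (Bs ! b))"
        unfolding det_mul[OF ABA iB(1) b] det_mul[OF AB iA(1) b] det_mul[OF *(2,5) b] iA(3)[OF b] iB(3)[OF b] ..
      ultimately show ?thesis by (simp add: field_simps)
    qed
    then show "\<exists>As. x \<otimes>\<^bsub>levi s\<^esub> y \<otimes>\<^bsub>levi s\<^esub> inv\<^bsub>levi s\<^esub> x \<otimes>\<^bsub>levi s\<^esub> inv\<^bsub>levi s\<^esub> y = diag_block_mat As \<and>
        As \<in> blocks s \<and> (\<forall>b<length s. det (As ! b) = 1)"
      using eq ABAB by blast
  qed
  ultimately show ?thesis unfolding derived_def by (intro group.generate_subgroup_incl[OF group_levi])
qed

abbreviation scalar_blocks :: "nat list \<Rightarrow> complex list \<Rightarrow> complex mat list" where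
  "scalar_blocks s z \<equiv> map2 (\<lambda>m c. c \<cdot>\<^sub>m 1\<^sub>m m) s z"

lemma scalar_blocks_blocks: "length z = length s \<Longrightarrow> scalar_blocks s z \<in> blocks s"
  by (simp add: blocks_nth)

lemma det_scalar_blocks:
  assumes "length z = length s" "b < length s"
  shows "det (scalar_blocks s z ! b) = (z ! b) ^ (s ! b)"
  using assms by simp

lemma block_scalar_levi:
  assumes "z \<in> ZL s"
  shows "block_scalar s z \<in> carrier (levi s)" "det (diag_block_mat (scalar_blocks s z)) = 1"
proof -
  have len: "length z = length s" using assms by (simp add: ZL_def)
  have "prod_list (map det (scalar_blocks s z)) = (\<Prod>a<length s. (z ! a) ^ (s ! a))"
    using len by (simp add: prod.list_conv_set_nth lessThan_atLeast0)
  then show "det (diag_block_mat (scalar_blocks s z)) = 1"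
    unfolding det_diag_block_mat[OF scalar_blocks_blocks[OF len]] using assms by (simp add: ZL_def)
  then show "block_scalar s z \<in> carrier (levi s)"
    unfolding levi_carrier block_scalar_def using scalar_blocks_blocks[OF len] by blast
qed

lemma subgroup_derived_levi: "subgroup (derived (levi s) (carrier (levi s))) (levi s)"
  by (rule group.derived_is_subgroup[OF group_levi]) simp

text \<open>The quotient of the \<open>b\<close>th block by \<open>z\<^sub>b\<close> has determinant 1 exactly under the condition on the right, and the block
  diagonal matrices with blocks of determinant 1 make up \<open>[L, L]\<close>.\<close>

lemma Lab_class_mem_iff:
  assumes z: "z \<in> ZL s" and nz: "\<And>c. c \<in> set z \<Longrightarrow> c \<noteq> 0" and As: "As \<in> blocks s"
  shows "diag_block_mat As \<in> Lab_class s z \<longleftrightarrow> (\<forall>b<length s. det (As ! b) = (z ! b) ^ (s ! b))"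
proof
  have len: "length z = length s" "length As = length s" using z As by (simp_all add: ZL_def blocks_nth)
  note S = scalar_blocks_blocks[OF len(1)]
  {
    assume "diag_block_mat As \<in> Lab_class s z"
    then obtain d where "d \<in> derived (levi s) (carrier (levi s))" "diag_block_mat As = d * block_scalar s z"
      unfolding Lab_class_def r_coset_def levi_ops by blast
    then obtain Cs where Cs: "Cs \<in> blocks s" "\<forall>b<length s. det (Cs ! b) = 1"
        "diag_block_mat As = diag_block_mat Cs * diag_block_mat (scalar_blocks s z)"
      using derived_levi_subset unfolding block_scalar_def by blast
    have "As = map2 (*) Cs (scalar_blocks s z)"
      using Cs(3) unfolding diag_block_mat_mult[OF Cs(1) S] by (rule diag_block_mat_inj[OF As blocks_mult[OF Cs(1) S]])
    then have "As ! b = Cs ! b * scalar_blocks s z ! b" if "b < length s" for b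
      using that len Cs(1) by (simp add: blocks_nth)
    moreover have "Cs ! b \<in> carrier_mat (s ! b) (s ! b)" "scalar_blocks s z ! b \<in> carrier_mat (s ! b) (s ! b)" if "b < length s" for b
      using that Cs(1) S unfolding blocks_nth by blast+
    ultimately have "det (As ! b) = det (Cs ! b) * det (scalar_blocks s z ! b)" if "b < length s" for b
      using that by (metis det_mult)
    then show "\<forall>b<length s. det (As ! b) = (z ! b) ^ (s ! b)"
      using Cs(2) det_scalar_blocks[OF len(1)] by simp
  }
  {
    assume det: "\<forall>b<length s. det (As ! b) = (z ! b) ^ (s ! b)"
    define Cs where "Cs = map2 (\<lambda>A c. inverse c \<cdot>\<^sub>m A) As z"
    have Cs: "Cs \<in> blocks s" using As len by (auto simp: blocks_nth Cs_def)
    have z0: "z ! b \<noteq> 0" if "b < length s" for b using nz[OF nth_mem[of b z]] that len by simp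
    have "det (Cs ! b) = 1" if b: "b < length s" for b
    proof -
      have "As ! b \<in> carrier_mat (s ! b) (s ! b)" using As b by (simp add: blocks_nth)
      then have "det (Cs ! b) = inverse (z ! b) ^ (s ! b) * det (As ! b)" using b len by (simp add: Cs_def)
      also have "\<dots> = (inverse (z ! b) * z ! b) ^ (s ! b)" using det b by (simp only: power_mult_distrib)
      finally show ?thesis using z0[OF b] by simp
    qed
    then have "diag_block_mat Cs \<in> derived (levi s) (carrier (levi s))" by (rule derived_levi_supset[OF Cs])
    moreover have "map2 (*) Cs (scalar_blocks s z) = As"
    proof (rule nth_equalityI)
      fix b assume "b < length (map2 (*) Cs (scalar_blocks s z))"
      then have b: "b < length s" using len by (simp add: Cs_def)
      have A: "As ! b \<in> carrier_mat (s ! b) (s ! b)" using As b by (simp add: blocks_nth)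
      have "map2 (*) Cs (scalar_blocks s z) ! b = inverse (z ! b) \<cdot>\<^sub>m (As ! b) * (z ! b \<cdot>\<^sub>m 1\<^sub>m (s ! b))"
        using b len by (simp add: Cs_def)
      also have "\<dots> = As ! b" using A z0[OF b]
        by (subst mult_smult_distrib[of _ "s ! b" "s ! b" _ "s ! b"]) (auto intro!: eq_matI)
      finally show "map2 (*) Cs (scalar_blocks s z) ! b = As ! b" .
    qed (use len in \<open>simp add: Cs_def\<close>)
    then have "diag_block_mat As = diag_block_mat Cs * block_scalar s z"
      unfolding block_scalar_def diag_block_mat_mult[OF Cs S] by simp
    ultimately show "diag_block_mat As \<in> Lab_class s z"
      unfolding Lab_class_def r_coset_def levi_ops by blast
  }
qed

lemma Lab_class_eq_iff:
  assumes bs: "block_sizes n s" and z: "z \<in> ZL s" and w: "w \<in> ZL s"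
  shows "Lab_class s z = Lab_class s w \<longleftrightarrow> (\<forall>b<length s. (z ! b) ^ (s ! b) = (w ! b) ^ (s ! b))"
proof -
  have len: "length w = length s" using w by (simp add: ZL_def)
  have "Lab_class s z = Lab_class s w \<longleftrightarrow> block_scalar s w \<in> Lab_class s z"
    unfolding Lab_class_def
    using group.repr_independence[OF group_levi _ block_scalar_levi(1)[OF z] subgroup_derived_levi]
      group.rcos_self[OF group_levi block_scalar_levi(1)[OF w] subgroup_derived_levi] by blast
  also have "\<dots> \<longleftrightarrow> (\<forall>b<length s. det (scalar_blocks s w ! b) = (z ! b) ^ (s ! b))"
    unfolding block_scalar_def
    by (rule Lab_class_mem_iff[OF z ZL_nonzero[OF bs z] scalar_blocks_blocks[OF len]])
  also have "\<dots> \<longleftrightarrow> (\<forall>b<length s. (z ! b) ^ (s ! b) = (w ! b) ^ (s ! b))"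
    using det_scalar_blocks[OF len] by metis
  finally show ?thesis .
qed

lemma complex_root_exists:
  assumes "0 < m"
  shows "\<exists>c::complex. c ^ m = w"
proof
  have "w = rcis (cmod w) (Arg w)" by (simp add: rcis_cmod_Arg)
  then show "rcis (root m (cmod w)) (Arg w / of_nat m) ^ m = w"
    using assms by (simp add: DeMoivre2)
qed

text \<open>Since \<open>\<complex>\<close> is algebraically closed, each block can be replaced by a scalar matrix of the same determinant.\<close>

lemma Lab_carrier:
  assumes bs: "block_sizes n s"
  shows "carrier (Lab s) = Lab_class s ` ZL s"
proof
  show "Lab_class s ` ZL s \<subseteq> carrier (Lab s)"
    using block_scalar_levi(1) by (auto simp: Lab_def carrier_FactGroup Lab_class_def)
  show "carrier (Lab s) \<subseteq> Lab_class s ` ZL s"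
  proof
    fix h assume "h \<in> carrier (Lab s)"
    then obtain x where x: "x \<in> carrier (levi s)" and h: "h = derived (levi s) (carrier (levi s)) #>\<^bsub>levi s\<^esub> x"
      by (auto simp: Lab_def carrier_FactGroup)
    obtain As where As: "x = diag_block_mat As" "As \<in> blocks s" "det (diag_block_mat As) = 1"
      using x unfolding levi_carrier by blast
    have len: "length As = length s" using As(2) by (simp add: blocks_nth)
    have "\<forall>b. \<exists>c. b < length s \<longrightarrow> c ^ (s ! b) = det (As ! b)"
      using complex_root_exists bs unfolding block_sizes_def by (metis nth_mem)
    then obtain c where c: "\<And>b. b < length s \<Longrightarrow> c b ^ (s ! b) = det (As ! b)" by metis
    define z where "z = map c [0..<length s]"
    have z: "length z = length s" "\<And>b. b < length s \<Longrightarrow> (z ! b) ^ (s ! b) = det (As ! b)"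
      using c by (simp_all add: z_def)
    have "(\<Prod>b<length s. (z ! b) ^ (s ! b)) = (\<Prod>b<length s. det (As ! b))"
      using z(2) by (intro prod.cong) auto
    also have "\<dots> = prod_list (map det As)" using len by (simp add: prod.list_conv_set_nth lessThan_atLeast0)
    also have "\<dots> = 1" using As(3) det_diag_block_mat[OF As(2)] by simp
    finally have ZL: "z \<in> ZL s" using z(1) by (simp add: ZL_def)
    have "x \<in> Lab_class s z"
      unfolding As(1) using z(2) by (subst Lab_class_mem_iff[OF ZL ZL_nonzero[OF bs ZL] As(2)]) auto
    then have "Lab_class s z = h"
      unfolding h Lab_class_def
      by (rule group.repr_independence[OF group_levi _ block_scalar_levi(1)[OF ZL] subgroup_derived_levi])
    then show "h \<in> Lab_class s ` ZL s" using ZL by blast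
  qed
qed

lemma Lab_mult:
  assumes "z \<in> ZL s" "w \<in> ZL s"
  shows "Lab_class s z \<otimes>\<^bsub>Lab s\<^esub> Lab_class s w = Lab_class s (map2 (*) z w)" "map2 (*) z w \<in> ZL s"
proof -
  have len: "length z = length s" "length w = length s" using assms by (simp_all add: ZL_def)
  show "map2 (*) z w \<in> ZL s"
    using assms by (simp add: ZL_def power_mult_distrib prod.distrib)
  have N: "derived (levi s) (carrier (levi s)) \<lhd> levi s" by (rule group.derived_self_is_normal[OF group_levi])
  have "map2 (*) (scalar_blocks s z) (scalar_blocks s w) = scalar_blocks s (map2 (*) z w)"
    by (rule nth_equalityI) (use len in \<open>simp_all flip: mat_diag_const\<close>)
  then have "block_scalar s z \<otimes>\<^bsub>levi s\<^esub> block_scalar s w = block_scalar s (map2 (*) z w)"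
    unfolding block_scalar_def levi_ops
    by (simp only: diag_block_mat_mult[OF scalar_blocks_blocks[OF len(1)] scalar_blocks_blocks[OF len(2)]])
  then show "Lab_class s z \<otimes>\<^bsub>Lab s\<^esub> Lab_class s w = Lab_class s (map2 (*) z w)"
    using normal.rcos_sum[OF N block_scalar_levi(1)[OF assms(1)] block_scalar_levi(1)[OF assms(2)]]
    by (simp add: Lab_def Lab_class_def)
qed

section \<open>The isomorphism \<open>\<sigma>\<^sub>i\<close> and the theorem\<close>

lemma Lab_class_swap_iff:
  assumes bs: "block_sizes n s" and i: "1 \<le> i" "i < length s" and z: "z \<in> ZL s" and w: "w \<in> ZL s"
  shows "Lab_class (swap_adjacent i s) (swap_adjacent i z) = Lab_class (swap_adjacent i s) (swap_adjacent i w) \<longleftrightarrow>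
    Lab_class s z = Lab_class s w"
proof -
  let ?t = "Transposition.transpose (i - 1) i"
  have len: "length z = length s" "length w = length s" using z w by (simp_all add: ZL_def)
  have t: "?t b < length s" if "b < length s" for b using that i by (auto simp: Transposition.transpose_def)
  have "(\<forall>b<length s. (z ! ?t b) ^ (s ! ?t b) = (w ! ?t b) ^ (s ! ?t b)) \<longleftrightarrow>
      (\<forall>b<length s. (z ! b) ^ (s ! b) = (w ! b) ^ (s ! b))"
    by (metis t transpose_involutory)
  then show ?thesis
    unfolding Lab_class_eq_iff[OF bs z w] Lab_class_eq_iff[OF block_sizes_swap[OF bs i] ZL_swap[OF i z] ZL_swap[OF i w]]
    using i len by (simp add: swap_adjacent_props)
qed

lemma sigma_Lab_class:
  assumes bs: "block_sizes n s" and i: "1 \<le> i" "i < length s" and z: "z \<in> ZL s"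
  shows "sigma i s (swap_adjacent i s) (Lab_class s z) = Lab_class (swap_adjacent i s) (swap_adjacent i z)"
  unfolding sigma_def
  by (rule the_equality) (use z Lab_class_swap_iff[OF bs i] in blast)+

lemma Lab_act_Lab_class:
  assumes bs: "block_sizes n s" and z: "z \<in> ZL s"
  shows "Lab_act s p (Lab_class s z) = torus_act s p z"
  unfolding Lab_act_def
proof (rule the_equality)
  fix q assume "\<exists>w\<in>ZL s. Lab_class s z = Lab_class s w \<and> q = torus_act s p w"
  then obtain w where w: "w \<in> ZL s" "Lab_class s z = Lab_class s w" "q = torus_act s p w" by blast
  then show "q = torus_act s p z"
    using Lab_class_eq_iff[OF bs z w(1)] torus_act_cong[OF bs z w(1)] by simp
qed (use z in blast)

lemma sigma_iso:
  assumes bs: "block_sizes n s" and i: "1 \<le> i" "i < length s"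
  shows "sigma i s (swap_adjacent i s) \<in> iso (Lab s) (Lab (swap_adjacent i s))"
proof (rule isoI)
  let ?s = "swap_adjacent i s" and ?w = "swap_adjacent i :: complex list \<Rightarrow> _"
  note bs' = block_sizes_swap[OF bs i]
  note \<sigma> = sigma_Lab_class[OF bs i]
  show "sigma i s ?s \<in> hom (Lab s) (Lab ?s)"
  proof (rule homI)
    fix h assume "h \<in> carrier (Lab s)"
    then show "sigma i s ?s h \<in> carrier (Lab ?s)"
      unfolding Lab_carrier[OF bs] Lab_carrier[OF bs'] using \<sigma> ZL_swap[OF i] by auto
  next
    fix h h' assume "h \<in> carrier (Lab s)" "h' \<in> carrier (Lab s)"
    then obtain z z' where *: "z \<in> ZL s" "z' \<in> ZL s" "h = Lab_class s z" "h' = Lab_class s z'"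
      unfolding Lab_carrier[OF bs] by auto
    have "length z = length s" "length z' = length s" using * by (simp_all add: ZL_def)
    then have "?w (map2 (*) z z') = map2 (*) (?w z) (?w z')"
      using i by (intro nth_equalityI) (auto simp: swap_adjacent_def nth_list_update)
    then show "sigma i s ?s (h \<otimes>\<^bsub>Lab s\<^esub> h') = sigma i s ?s h \<otimes>\<^bsub>Lab ?s\<^esub> sigma i s ?s h'"
      unfolding *(3,4) Lab_mult(1)[OF *(1,2)] \<sigma>[OF *(1)] \<sigma>[OF *(2)] \<sigma>[OF Lab_mult(2)[OF *(1,2)]]
        Lab_mult(1)[OF ZL_swap[OF i *(1)] ZL_swap[OF i *(2)]] by simp
  qed
  show "bij_betw (sigma i s ?s) (carrier (Lab s)) (carrier (Lab ?s))"
    unfolding bij_betw_def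
  proof
    show "inj_on (sigma i s ?s) (carrier (Lab s))"
      unfolding Lab_carrier[OF bs] using \<sigma> Lab_class_swap_iff[OF bs i] by (auto simp: inj_on_def)
    have "Lab_class ?s z \<in> sigma i s ?s ` Lab_class s ` ZL s" if z: "z \<in> ZL ?s" for z
    proof -
      have len: "length ?s = length s" "length z = length s" using z by (simp_all add: ZL_def swap_adjacent_props)
      have "?w z \<in> ZL s" using ZL_swap[of i ?s z] z i len by (simp add: swap_adjacent_props)
      moreover have "?w (?w z) = z" using i len by (simp add: swap_adjacent_props)
      ultimately show ?thesis using \<sigma>[of "?w z"] by force
    qed
    then show "sigma i s ?s ` carrier (Lab s) = carrier (Lab ?s)"
      unfolding Lab_carrier[OF bs] Lab_carrier[OF bs'] using \<sigma> ZL_swap[OF i] by auto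
  qed
qed

theorem proposition2p18:
  fixes n i :: nat and s s' :: "nat list" and \<tau> :: complex
    and \<Phi> :: "(quiver \<Rightarrow> complex) set \<Rightarrow> (quiver \<Rightarrow> complex) set"
  assumes "block_sizes n s" and "i_swapped i s s'"
    and "\<tau> \<noteq> 0" and "reflection_functor i \<tau> s s' \<Phi>"
  shows "sigma i s s' \<in> iso (Lab s) (Lab s') \<and>
    (\<forall>z\<in>ZL s. sigma i s s' (Lab_class s z) = Lab_class s' (swap_adjacent i z)) \<and>
    (\<forall>h\<in>carrier (Lab s). \<forall>p\<in>MP s. \<Phi> (Lab_act s p h) = Lab_act s' (\<Phi> p) (sigma i s s' h))"
proof -
  have i: "1 \<le> i" "i < length s" and s': "s' = swap_adjacent i s"
    using assms(2) by (auto simp: i_swapped_def)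
  note \<sigma> = sigma_Lab_class[OF assms(1) i, folded s']
  have bs': "block_sizes n s'" unfolding s' by (rule block_sizes_swap[OF assms(1) i])
  have "\<Phi> (Lab_act s p h) = Lab_act s' (\<Phi> p) (sigma i s s' h)" if h: "h \<in> carrier (Lab s)" and p: "p \<in> MP s" for h p
  proof -
    obtain z where z: "z \<in> ZL s" "h = Lab_class s z" using h unfolding Lab_carrier[OF assms(1)] by blast
    have z': "swap_adjacent i z \<in> ZL s'" unfolding s' by (rule ZL_swap[OF i z(1)])
    show ?thesis
      unfolding z(2) \<sigma>[OF z(1)] Lab_act_Lab_class[OF assms(1) z(1)] Lab_act_Lab_class[OF bs' z']
      by (rule reflection_functor_equivariant[OF assms(1) i z(1) s' assms(4) p])
  qed
  then show ?thesis using sigma_iso[OF assms(1) i] \<sigma> unfolding s' by blast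
qed

end
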